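(* Let $n\ge 1$ be an integer, let $1\le p\le\infty$, and let $F:\mathbb R^2\to\mathbb C$ be a complex valued function. If $F$ operates in $M^{p,1}(\mathbb R^n)$, then $F$ is real analytic on $\mathbb R^2$. Moreover, if $1\le p<\infty$, then $F(0)=0$.
   Context: For a fixed nonzero window $g\in\mathcal S(\mathbb R^n)$ (Schwartz space), the short time Fourier transform of a tempered distribution $f$ on $\mathbb R^n$ is $V_gf(x,w)=\langle f, M_wT_xg\rangle=\int_{\mathbb R^n} f(t)\overline{g(t-x)}e^{-2\pi i w\cdot t}\,dt$, $(x,w)\in\mathbb R^{2n}$, where $T_xg(t)=g(t-x)$ and $M_wg(t)=e^{2\pi i w\cdot t}g(t)$. The modulation space $M^{p,1}(\mathbb R^n)$ is the space of tempered distributions $f$ with $\|f\|_{M^{p,1}}=\int_{\mathbb R^n}\|V_gf(\cdot,w)\|_{L^p(\mathbb R^n)}\,dw<\infty$; different windows give the same space with equivalent norms. Elements of $M^{p,1}(\mathbb R^n)$ are identified with continuous functions. $F$ operates in $M^{p,1}(\mathbb R^n)$ means: $F(f_1,f_2)\in M^{p,1}(\mathbb R^n)$ (the function $x\mapsto F(f_1(x),f_2(x))$) whenever $f=f_1+if_2\in M^{p,1}(\mathbb R^n)$ with $f_1=\mathrm{Re}(f)$, $f_2=\mathrm{Im}(f)$. $F$ is real analytic on $\mathbb R^2$ if for every $(s_0,t_0)\in\mathbb R^2$ there are $a_{jk}\in\mathbb C$ such that $F(s,t)=\sum_{j,k=0}^\infty a_{jk}(s-s_0)^j(t-t_0)^k$,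 the series converging absolutely for all $(s,t)$ in some neighbourhood of $(s_0,t_0)$. *)

theory Defs
  imports "HOL-Analysis.Analysis" "HOL-Probability.Essential_Supremum"
begin

definition partial_deriv :: "'n::finite \<Rightarrow> (real^'n \<Rightarrow> complex) \<Rightarrow> real^'n \<Rightarrow> complex" where
  "partial_deriv i \<phi> x = vector_derivative (\<lambda>h. \<phi> (x + h *\<^sub>R axis i 1)) (at 0)"

text \<open>A multi-index is given as the list of the coordinates to differentiate in. Lists that are
  permutations of each other give the same derivative of a smooth function.\<close>

definition partial_derivs :: "'n::finite list \<Rightarrow> (real^'n \<Rightarrow> complex) \<Rightarrow> real^'n \<Rightarrow> complex" where
  "partial_derivs \<beta> \<phi> = foldr partial_deriv \<beta> \<phi>"

definition smooth :: "(real^'n::finite \<Rightarrow> complex) \<Rightarrow> bool" where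
  "smooth \<phi> \<longleftrightarrow> (\<forall>\<beta>. partial_derivs \<beta> \<phi> differentiable_on UNIV)"

definition schwartz :: "(real^'n::finite \<Rightarrow> complex) set" where
  "schwartz = {\<phi>. smooth \<phi> \<and>
     (\<forall>k \<beta>. bounded (range (\<lambda>x. (1 + norm x) ^ k *\<^sub>R partial_derivs \<beta> \<phi> x)))}"

text \<open>A real supremum; it is meaningful because the set is bounded for \<open>\<phi>\<close> in the Schwartz space.\<close>

definition schwartz_seminorm :: "nat \<Rightarrow> 'n::finite list \<Rightarrow> (real^'n \<Rightarrow> complex) \<Rightarrow> real" where
  "schwartz_seminorm k \<beta> \<phi> = (SUP x. (1 + norm x) ^ k * norm (partial_derivs \<beta> \<phi> x))"

definition schwartz_topology :: "(real^'n::finite \<Rightarrow> complex) topology" where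
  "schwartz_topology = topology_generated_by
     {{\<psi> \<in> schwartz. schwartz_seminorm k \<beta> (\<lambda>x. \<psi> x - \<phi> x) < e} | k \<beta> \<phi> e. \<phi> \<in> schwartz \<and> e > 0}"

text \<open>Only the values of a distribution on the Schwartz space matter.\<close>

definition tempered_distribution :: "((real^'n::finite \<Rightarrow> complex) \<Rightarrow> complex) \<Rightarrow> bool" where
  "tempered_distribution u \<longleftrightarrow>
     (\<forall>\<phi>\<in>schwartz. \<forall>\<psi>\<in>schwartz. u (\<lambda>x. \<phi> x + \<psi> x) = u \<phi> + u \<psi>) \<and>
     (\<forall>c. \<forall>\<phi>\<in>schwartz. u (\<lambda>x. c * \<phi> x) = c * u \<phi>) \<and>
     continuous_map schwartz_topology euclidean u"

definition translate :: "real^'n::finite \<Rightarrow> (real^'n \<Rightarrow> complex) \<Rightarrow> real^'n \<Rightarrow> complex" where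
  "translate x g t = g (t - x)"

definition modulate :: "real^'n::finite \<Rightarrow> (real^'n \<Rightarrow> complex) \<Rightarrow> real^'n \<Rightarrow> complex" where
  "modulate w g t = cis (2 * pi * (w \<bullet> t)) * g t"

text \<open>The bracket \<open>\<langle>u, M\<^sub>w T\<^sub>x g\<rangle>\<close> is antilinear in its second argument, whereas distributions are
  complex linear; hence the conjugate.\<close>

definition stft :: "(real^'n::finite \<Rightarrow> complex) \<Rightarrow> ((real^'n \<Rightarrow> complex) \<Rightarrow> complex) \<Rightarrow>
    real^'n \<Rightarrow> real^'n \<Rightarrow> complex" where
  "stft g u x w = u (\<lambda>t. cnj (modulate w (translate x g) t))"

definition Lp_norm :: "ennreal \<Rightarrow> (real^'n::finite \<Rightarrow> complex) \<Rightarrow> ennreal" where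
  "Lp_norm p h =
     (if p = \<infinity> then esssup lborel (\<lambda>x. ennreal (norm (h x)))
      else let I = \<integral>\<^sup>+x. ennreal (norm (h x) powr enn2real p) \<partial>lborel
           in if I = \<infinity> then \<infinity> else ennreal (enn2real I powr (1 / enn2real p)))"

definition modulation_norm :: "(real^'n::finite \<Rightarrow> complex) \<Rightarrow> ennreal \<Rightarrow>
    ((real^'n \<Rightarrow> complex) \<Rightarrow> complex) \<Rightarrow> ennreal" where
  "modulation_norm g p u = (\<integral>\<^sup>+w. Lp_norm p (\<lambda>x. stft g u x w) \<partial>lborel)"

text \<open>The space \<open>M\<^bsup>p,1\<^esup>\<close>, computed with the window \<open>g\<close>.\<close>

definition modulation_space :: "(real^'n::finite \<Rightarrow> complex) \<Rightarrow> ennreal \<Rightarrow>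
    ((real^'n \<Rightarrow> complex) \<Rightarrow> complex) set" where
  "modulation_space g p = {u. tempered_distribution u \<and> modulation_norm g p u < \<infinity>}"

text \<open>The continuous functions identified with elements of \<open>M\<^bsup>p,1\<^esup>\<close>. Integrability is required
  explicitly since the Bochner integral of a non-integrable function is 0.\<close>

definition modulation_functions :: "(real^'n::finite \<Rightarrow> complex) \<Rightarrow> ennreal \<Rightarrow>
    (real^'n \<Rightarrow> complex) set" where
  "modulation_functions g p = {f. continuous_on UNIV f \<and>
     (\<forall>\<phi>\<in>schwartz. integrable lborel (\<lambda>x. f x * \<phi> x)) \<and>
     (\<lambda>\<phi>. \<integral>x. f x * \<phi> x \<partial>lborel) \<in> modulation_space g p}"

definition operates_in_modulation_space :: "(real^'n::finite \<Rightarrow> complex) \<Rightarrow> ennreal \<Rightarrow>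
    (real \<times> real \<Rightarrow> complex) \<Rightarrow> bool" where
  "operates_in_modulation_space g p F \<longleftrightarrow>
     (\<forall>f\<in>modulation_functions g p. (\<lambda>x. F (Re (f x), Im (f x))) \<in> modulation_functions g p)"

definition real_analytic :: "(real \<times> real \<Rightarrow> complex) \<Rightarrow> bool" where
  "real_analytic F \<longleftrightarrow>
     (\<forall>s\<^sub>0 t\<^sub>0. \<exists>a :: nat \<Rightarrow> nat \<Rightarrow> complex. \<forall>\<^sub>F (s, t) in nhds (s\<^sub>0, t\<^sub>0).
        (\<lambda>(j, k). norm (a j k * of_real ((s - s\<^sub>0) ^ j * (t - t\<^sub>0) ^ k))) summable_on UNIV \<and>
        ((\<lambda>(j, k). a j k * of_real ((s - s\<^sub>0) ^ j * (t - t\<^sub>0) ^ k)) has_sum F (s, t)) UNIV)"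

end

theory Submission
  imports Defs "HOL-Probability.Sinc_Integral" "HOL-Real_Asymp.Real_Asymp"
    "HOL-Complex_Analysis.Cauchy_Integral_Formula"
begin

text \<open>
  Real analyticity at \<open>z\<^sub>0\<close> is obtained from exponential decay of the Fourier coefficients \<open>c\<^sub>N\<close> of
  \<open>\<theta> \<mapsto> F(z\<^sub>0 + r (\<sigma> sin \<theta> + \<tau>))\<close>, uniformly in \<open>|\<sigma>|, |\<tau>| \<le> 1\<close>; substituting \<open>\<theta> = arcsin x\<close> then
  turns the double Fourier series into a power series.

  A gliding hump argument at disjoint bumps shows that, near some bump, \<open>F \<circ> f\<close> is bounded in norm
  for all \<open>f = z\<^sub>0 + r \<psi> (\<sigma> sin (\<theta> + \<phi>) + \<tau>)\<close> with \<open>\<phi>\<close> a real multiplier of norm at most 1. Averaging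
  over \<open>\<theta>\<close> against \<open>e\<^bsup>-iN\<theta>\<^esup>\<close> gives a bound for \<open>c\<^sub>N e\<^bsup>iN\<phi>\<^esup>\<close> near the bump. Norms are bounded below by
  pairing with trigonometric polynomials whose coefficients are at most 1. With
  \<open>\<phi> = (1/N) \<Sum>\<^sub>k cos (2\<pi> \<lambda>\<^sub>k t\<^sub>1)\<close> and a Riesz product \<open>\<Prod>\<^sub>k (1 - 2i cos (2\<pi> \<lambda>\<^sub>k t\<^sub>1))\<close>, lacunary frequencies
  make \<open>e\<^bsup>iN\<phi>\<^esup>\<close> of norm at least \<open>(5/4)\<^bsup>|N|\<^esup>\<close>, so \<open>c\<^sub>N\<close> decays. The cutoff to the bump is the \<open>|N|\<close>-th
  power of a trigonometric polynomial with absolute coefficient sum 1: it costs nothing in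
  norm, and its error is itself exponentially small.

  If \<open>p < \<infinity>\<close>, then \<open>F \<circ> 0\<close> is a constant in the space; the modulus of its short time Fourier transform
  does not depend on \<open>x\<close>, so the constant vanishes, because the Fourier transform of the window does not.
\<close>

subsection \<open>Smooth functions\<close>

text \<open>The pattern is that of the Helson-Kahane-Katznelson-Rudin theorem on functions operating
  in a Fourier algebra. The hypothesis contains no estimate of the image norm in terms of
  \<open>f\<close>; the only uniformity to be had is the one forced at some bump. It suffices
  because \<open>sin (\<theta> + \<phi>)\<close> has multiplier norm at most e for every admissible
  \<phi>, whereas the N-th coefficient gets multiplied by e^(iN\<phi>), whose norm may grow
  exponentially in |N|: one constant serves all N. Testing with integer frequencies is cheap because
  multiplication by \<open>T\<close> shifts the transform by the frequencies, and integer translates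
  of a unit cube are disjoint; so only the largest coefficient of \<open>T\<close> matters, and a
  Riesz product costs no more than the constant 1. The obstacle is localisation: the averaged
  function is the wanted coefficient inside the bump and 0 outside, but arbitrary in between. The
  transition zone, where the peak is at most some q1 < 1, loses against a neighbourhood of the
  centre, where the peak exceeds a number chosen closer to 1 than both q1 and 4/5.\<close>

primrec differentiable_upto :: "nat \<Rightarrow> (real^'n::finite \<Rightarrow> complex) \<Rightarrow> bool" where
  "differentiable_upto 0 \<phi> \<longleftrightarrow> \<phi> differentiable_on UNIV"
| "differentiable_upto (Suc m) \<phi> \<longleftrightarrow>
     \<phi> differentiable_on UNIV \<and> (\<forall>i. differentiable_upto m (partial_deriv i \<phi>))"

lemma partial_derivs_Nil [simp]: "partial_derivs [] \<phi> = \<phi>"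
  by (simp add: partial_derivs_def)

lemma partial_derivs_Cons: "partial_derivs (i # \<beta>) \<phi> = partial_deriv i (partial_derivs \<beta> \<phi>)"
  by (simp add: partial_derivs_def)

lemma partial_derivs_snoc: "partial_derivs (\<beta> @ [i]) \<phi> = partial_derivs \<beta> (partial_deriv i \<phi>)"
  by (simp add: partial_derivs_def)

text \<open>The recursion removes the derivative that acts first, which is the last entry of the
  list; hence lists are taken apart from their end. The detour through finite orders lets products
  be handled with one product rule per step, without a Leibniz formula over lists.\<close>

lemma differentiable_upto_iff:
  "differentiable_upto m \<phi> \<longleftrightarrow> (\<forall>\<beta>. length \<beta> \<le> m \<longrightarrow> partial_derivs \<beta> \<phi> differentiable_on UNIV)"
proof (induction m arbitrary: \<phi>)
  case 0
  then show ?case by auto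
next
  case (Suc m)
  show ?case
  proof
    assume A: "differentiable_upto (Suc m) \<phi>"
    show "\<forall>\<beta>. length \<beta> \<le> Suc m \<longrightarrow> partial_derivs \<beta> \<phi> differentiable_on UNIV"
    proof (intro allI impI)
      fix \<beta> :: "'a list"
      assume "length \<beta> \<le> Suc m"
      then show "partial_derivs \<beta> \<phi> differentiable_on UNIV"
        using A Suc.IH by (cases \<beta> rule: rev_cases) (auto simp: partial_derivs_snoc)
    qed
  next
    assume A: "\<forall>\<beta>. length \<beta> \<le> Suc m \<longrightarrow> partial_derivs \<beta> \<phi> differentiable_on UNIV"
    have "differentiable_upto m (partial_deriv i \<phi>)" for i
      unfolding Suc.IH
    proof (intro allI impI)
      fix \<beta> :: "'a list"
      assume "length \<beta> \<le> m"
      then show "partial_derivs \<beta> (partial_deriv i \<phi>) differentiable_on UNIV"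
        using A[rule_format, of "\<beta> @ [i]"] by (simp add: partial_derivs_snoc)
    qed
    moreover have "\<phi> differentiable_on UNIV"
      using A[rule_format, of "[]"] by simp
    ultimately show "differentiable_upto (Suc m) \<phi>"
      by simp
  qed
qed

lemma smooth_iff_differentiable_upto: "smooth \<phi> \<longleftrightarrow> (\<forall>m. differentiable_upto m \<phi>)"
  unfolding smooth_def differentiable_upto_iff by blast

lemma differentiable_upto_imp_differentiable_on:
  "differentiable_upto m \<phi> \<Longrightarrow> \<phi> differentiable_on UNIV"
  by (cases m) auto

lemma differentiable_upto_imp_differentiable:
  "differentiable_upto m \<phi> \<Longrightarrow> \<phi> differentiable (at x)"
  by (drule differentiable_upto_imp_differentiable_on) (simp add: differentiable_on_def)

lemma differentiable_upto_Suc_imp: "differentiable_upto (Suc m) \<phi> \<Longrightarrow> differentiable_upto m \<phi>"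
  unfolding differentiable_upto_iff by auto

lemma smooth_imp_differentiable: "smooth \<phi> \<Longrightarrow> \<phi> differentiable (at x)"
  using differentiable_upto_imp_differentiable smooth_iff_differentiable_upto by blast

lemma smooth_imp_continuous_on: "smooth \<phi> \<Longrightarrow> continuous_on A \<phi>"
  by (meson smooth_imp_differentiable continuous_at_imp_continuous_on differentiable_imp_continuous_within)

lemma smooth_partial_deriv: "smooth \<phi> \<Longrightarrow> smooth (partial_deriv i \<phi>)"
  unfolding smooth_def by (metis partial_derivs_snoc)

lemma smooth_partial_derivs: "smooth \<phi> \<Longrightarrow> smooth (partial_derivs \<beta> \<phi>)"
  by (induction \<beta>) (auto simp: partial_derivs_Cons smooth_partial_deriv)

lemma partial_deriv_eq:
  assumes "(\<phi> has_derivative D) (at x)"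
  shows "partial_deriv i \<phi> x = D (axis i 1)"
proof -
  have "((\<lambda>h. x + h *\<^sub>R axis i 1) has_derivative (\<lambda>h. h *\<^sub>R axis i 1)) (at 0)"
    by (auto intro!: derivative_eq_intros)
  moreover have "(\<phi> has_derivative D) (at (x + 0 *\<^sub>R axis i 1))"
    using assms by simp
  ultimately have "((\<lambda>h. \<phi> (x + h *\<^sub>R axis i 1)) has_derivative (\<lambda>h. D (h *\<^sub>R axis i 1))) (at 0)"
    by (rule has_derivative_compose)
  moreover have "D (h *\<^sub>R axis i 1) = h *\<^sub>R D (axis i 1)" for h
    using has_derivative_bounded_linear[OF assms] by (simp add: linear_scale[OF bounded_linear.linear])
  ultimately have "((\<lambda>h. \<phi> (x + h *\<^sub>R axis i 1)) has_vector_derivative D (axis i 1)) (at 0)"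
    by (simp add: has_vector_derivative_def)
  then show ?thesis
    unfolding partial_deriv_def by (rule vector_derivative_at)
qed

lemma partial_deriv_eq_frechet:
  "\<phi> differentiable (at x) \<Longrightarrow> partial_deriv i \<phi> x = frechet_derivative \<phi> (at x) (axis i 1)"
  by (rule partial_deriv_eq) (simp add: frechet_derivative_works)

lemma partial_deriv_line:
  assumes "\<And>y. \<phi> differentiable (at y)"
  shows "((\<lambda>h. \<phi> (x + h *\<^sub>R axis i 1)) has_vector_derivative partial_deriv i \<phi> (x + h *\<^sub>R axis i 1)) (at h)"
proof -
  let ?y = "x + h *\<^sub>R axis i 1"
  let ?D = "frechet_derivative \<phi> (at ?y)"
  have D: "(\<phi> has_derivative ?D) (at ?y)"
    using assms frechet_derivative_works by blast
  have "((\<lambda>h. x + h *\<^sub>R axis i 1) has_derivative (\<lambda>h. h *\<^sub>R axis i 1)) (at h)"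
    by (auto intro!: derivative_eq_intros)
  from has_derivative_compose[OF this D]
  have "((\<lambda>h. \<phi> (x + h *\<^sub>R axis i 1)) has_derivative (\<lambda>h. ?D (h *\<^sub>R axis i 1))) (at h)" .
  moreover have "?D (h *\<^sub>R axis i 1) = h *\<^sub>R ?D (axis i 1)" for h
    using has_derivative_bounded_linear[OF D] by (simp add: linear_scale[OF bounded_linear.linear])
  ultimately show ?thesis
    using partial_deriv_eq[OF D] by (simp add: has_vector_derivative_def)
qed

lemma partial_deriv_add:
  assumes "\<And>x. \<phi> differentiable (at x)" "\<And>x. \<psi> differentiable (at x)"
  shows "partial_deriv i (\<lambda>x. \<phi> x + \<psi> x) = (\<lambda>x. partial_deriv i \<phi> x + partial_deriv i \<psi> x)"
proof
  fix x
  from has_derivative_add[OF assms[of x, unfolded frechet_derivative_works]]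
  show "partial_deriv i (\<lambda>x. \<phi> x + \<psi> x) x = partial_deriv i \<phi> x + partial_deriv i \<psi> x"
    by (subst partial_deriv_eq) (auto simp: partial_deriv_eq_frechet assms)
qed

lemma partial_deriv_mult:
  assumes "\<And>x. \<phi> differentiable (at x)" "\<And>x. \<psi> differentiable (at x)"
  shows "partial_deriv i (\<lambda>x. \<phi> x * \<psi> x) = (\<lambda>x. partial_deriv i \<phi> x * \<psi> x + \<phi> x * partial_deriv i \<psi> x)"
proof
  fix x
  from has_derivative_mult[OF assms[of x, unfolded frechet_derivative_works]]
  show "partial_deriv i (\<lambda>x. \<phi> x * \<psi> x) x = partial_deriv i \<phi> x * \<psi> x + \<phi> x * partial_deriv i \<psi> x"
    by (subst partial_deriv_eq, assumption) (simp add: partial_deriv_eq_frechet assms)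
qed

lemma partial_deriv_const [simp]: "partial_deriv i (\<lambda>x. c) = (\<lambda>x. 0)"
  by (rule ext) (simp add: partial_deriv_eq[OF has_derivative_const])

lemma partial_deriv_component:
  fixes i j :: "'a::finite"
  shows "partial_deriv i (\<lambda>x. of_real (x $ j)) = (\<lambda>x. if i = j then 1 else 0)"
proof
  fix x :: "real^'a"
  have "((\<lambda>x. complex_of_real (x $ j)) has_derivative (\<lambda>h. of_real (h $ j))) (at x)"
    by (intro has_derivative_of_real bounded_linear_imp_has_derivative bounded_linear_vec_nth)
  from partial_deriv_eq[OF this, of i]
  show "partial_deriv i (\<lambda>x. of_real (x $ j)) x = (if i = j then 1 else 0)"
    by (simp add: axis_def)
qed

lemma differentiable_upto_add:
  "differentiable_upto m \<phi> \<Longrightarrow> differentiable_upto m \<psi> \<Longrightarrow> differentiable_upto m (\<lambda>x. \<phi> x + \<psi> x)"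
proof (induction m arbitrary: \<phi> \<psi>)
  case 0
  then show ?case by (auto intro: differentiable_on_add)
next
  case (Suc m)
  then have "partial_deriv i (\<lambda>x. \<phi> x + \<psi> x) = (\<lambda>x. partial_deriv i \<phi> x + partial_deriv i \<psi> x)" for i
    by (intro partial_deriv_add) (auto simp: differentiable_on_def)
  with Suc show ?case by (auto intro!: differentiable_on_add)
qed

lemma differentiable_upto_mult:
  "differentiable_upto m \<phi> \<Longrightarrow> differentiable_upto m \<psi> \<Longrightarrow> differentiable_upto m (\<lambda>x. \<phi> x * \<psi> x)"
proof (induction m arbitrary: \<phi> \<psi>)
  case 0
  then show ?case by (auto simp: differentiable_on_def)
next
  case (Suc m)
  then have *: "partial_deriv i (\<lambda>x. \<phi> x * \<psi> x) = (\<lambda>x. partial_deriv i \<phi> x * \<psi> x + \<phi> x * partial_deriv i \<psi> x)" for i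
    by (intro partial_deriv_mult) (auto simp: differentiable_on_def)
  have "(\<lambda>x. \<phi> x * \<psi> x) differentiable_on UNIV"
    using Suc.prems by (auto simp: differentiable_on_def)
  moreover have "differentiable_upto m (\<lambda>x. partial_deriv i \<phi> x * \<psi> x + \<phi> x * partial_deriv i \<psi> x)" for i
    using Suc.prems differentiable_upto_Suc_imp[of m \<phi>] differentiable_upto_Suc_imp[of m \<psi>]
    by (intro differentiable_upto_add Suc.IH) auto
  ultimately show ?case
    using * by simp
qed

lemma differentiable_upto_const: "differentiable_upto m (\<lambda>x. c)"
  by (induction m arbitrary: c) auto

lemma smooth_const: "smooth (\<lambda>x. c)"
  by (simp add: smooth_iff_differentiable_upto differentiable_upto_const)

lemma smooth_add: "smooth \<phi> \<Longrightarrow> smooth \<psi> \<Longrightarrow> smooth (\<lambda>x. \<phi> x + \<psi> x)"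
  by (simp add: smooth_iff_differentiable_upto differentiable_upto_add)

lemma smooth_mult: "smooth \<phi> \<Longrightarrow> smooth \<psi> \<Longrightarrow> smooth (\<lambda>x. \<phi> x * \<psi> x)"
  by (simp add: smooth_iff_differentiable_upto differentiable_upto_mult)

lemma smooth_sum: "(\<And>i. i \<in> I \<Longrightarrow> smooth (f i)) \<Longrightarrow> smooth (\<lambda>x. \<Sum>i\<in>I. f i x)"
  by (induction I rule: infinite_finite_induct) (auto intro: smooth_add smooth_const)

lemma smooth_component: "smooth (\<lambda>x. of_real (x $ j))"
proof -
  have *: "(\<lambda>x::real^'a. complex_of_real (x $ j)) differentiable_on UNIV"
    unfolding differentiable_on_def differentiable_def
    using has_derivative_of_real[OF bounded_linear_imp_has_derivative[OF bounded_linear_vec_nth]] by blast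
  have "differentiable_upto m (\<lambda>x. of_real (x $ j))" for m
    using * by (cases m) (auto simp: partial_deriv_component differentiable_upto_const)
  then show ?thesis
    by (simp add: smooth_iff_differentiable_upto)
qed

text \<open>\<open>G\<close> is the whole tower of derivatives of one real function. The chain rule
  turns level k into level k + 1 times a smooth factor, so the induction on the order has to treat
  all levels at once.\<close>

lemma smooth_compose_real:
  fixes G :: "nat \<Rightarrow> real \<Rightarrow> real" and u :: "real^'n::finite \<Rightarrow> real"
  assumes G: "\<And>k y. (G k has_real_derivative G (Suc k) y) (at y)"
    and u: "smooth (\<lambda>x. of_real (u x))"
  shows "smooth (\<lambda>x. of_real (G k (u x)))"
proof -
  have du: "(u has_derivative (\<lambda>h. Re (frechet_derivative (\<lambda>x. complex_of_real (u x)) (at x) h))) (at x)" for x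
    using smooth_imp_differentiable[OF u, of x, unfolded frechet_derivative_works]
    by (auto dest: has_derivative_Re)
  have D: "((\<lambda>x. complex_of_real (G k (u x))) has_derivative
      (\<lambda>h. of_real (G (Suc k) (u x) * Re (frechet_derivative (\<lambda>x. complex_of_real (u x)) (at x) h)))) (at x)" for k x
  proof -
    have "(G k has_derivative (*) (G (Suc k) (u x))) (at (u x))"
      using G by (simp add: has_field_derivative_def)
    from has_derivative_compose[OF du this]
    show ?thesis
      by (rule has_derivative_of_real)
  qed
  have real: "partial_deriv i (\<lambda>x. complex_of_real (u x)) x =
      of_real (Re (frechet_derivative (\<lambda>x. complex_of_real (u x)) (at x) (axis i 1)))" for i x
    using partial_deriv_eq[OF has_derivative_of_real[OF du[of x]]] .
  have pd: "partial_deriv i (\<lambda>x. of_real (G k (u x))) =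
      (\<lambda>x. of_real (G (Suc k) (u x)) * partial_deriv i (\<lambda>x. of_real (u x)) x)" for i k
    by (rule ext) (simp add: partial_deriv_eq[OF D] real)
  have diff: "(\<lambda>x. complex_of_real (G k (u x))) differentiable_on UNIV" for k
    unfolding differentiable_on_def differentiable_def using D by blast
  have "differentiable_upto m (\<lambda>x. of_real (G k (u x)))" for m k
  proof (induction m arbitrary: k)
    case 0
    then show ?case using diff by simp
  next
    case (Suc m)
    have "differentiable_upto m (\<lambda>x. of_real (G (Suc k) (u x)) * partial_deriv i (\<lambda>x. of_real (u x)) x)" for i
      using smooth_partial_deriv[OF u, of i] Suc.IH
      by (intro differentiable_upto_mult) (auto simp: smooth_iff_differentiable_upto)
    then show ?case using diff pd by simp
  qed
  then show ?thesis by (simp add: smooth_iff_differentiable_upto)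
qed

lemma smooth_reflect_translate:
  assumes "smooth \<phi>"
  shows "smooth (\<lambda>t. cnj (\<phi> (t - x)))"
    and "partial_deriv i (\<lambda>t. cnj (\<phi> (t - x))) = (\<lambda>t. cnj (partial_deriv i \<phi> (t - x)))"
proof -
  have D: "((\<lambda>t. cnj (\<phi> (t - x))) has_derivative (\<lambda>h. cnj (frechet_derivative \<phi> (at (t - x)) h))) (at t)"
    if "\<And>y. \<phi> differentiable (at y)" for t \<phi>
  proof -
    have "((\<lambda>t. t - x) has_derivative (\<lambda>h. h)) (at t)"
      by (auto intro!: derivative_eq_intros)
    from has_derivative_compose[OF this] that[of "t - x", unfolded frechet_derivative_works]
    have "((\<lambda>t. \<phi> (t - x)) has_derivative (\<lambda>h. frechet_derivative \<phi> (at (t - x)) h)) (at t)"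
      by blast
    then show ?thesis by (rule has_derivative_cnj)
  qed
  have pd: "partial_deriv i (\<lambda>t. cnj (\<phi> (t - x))) = (\<lambda>t. cnj (partial_deriv i \<phi> (t - x)))"
    if "\<And>y. \<phi> differentiable (at y)" for i \<phi>
    by (rule ext) (simp add: partial_deriv_eq[OF D[OF that]] partial_deriv_eq_frechet that)
  have "differentiable_upto m \<phi> \<Longrightarrow> differentiable_upto m (\<lambda>t. cnj (\<phi> (t - x)))" for m \<phi>
  proof (induction m arbitrary: \<phi>)
    case 0
    then have "\<And>y. \<phi> differentiable (at y)" by (auto simp: differentiable_on_def)
    from D[OF this] show ?case by (auto simp: differentiable_on_def differentiable_def)
  next
    case (Suc m)
    then have *: "\<And>y. \<phi> differentiable (at y)" by (auto simp: differentiable_on_def)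
    have "(\<lambda>t. cnj (\<phi> (t - x))) differentiable_on UNIV"
      using D[OF *] by (auto simp: differentiable_on_def differentiable_def)
    with Suc pd[OF *] show ?case by auto
  qed
  then show "smooth (\<lambda>t. cnj (\<phi> (t - x)))"
    using assms by (simp add: smooth_iff_differentiable_upto)
  show "partial_deriv i (\<lambda>t. cnj (\<phi> (t - x))) = (\<lambda>t. cnj (partial_deriv i \<phi> (t - x)))"
    using assms by (intro pd smooth_imp_differentiable)
qed

lemma partial_derivs_add:
  assumes "smooth \<phi>" "smooth \<psi>"
  shows "partial_derivs \<beta> (\<lambda>x. \<phi> x + \<psi> x) = (\<lambda>x. partial_derivs \<beta> \<phi> x + partial_derivs \<beta> \<psi> x)"
  by (induction \<beta>)
    (auto simp: partial_derivs_Cons partial_deriv_add smooth_imp_differentiable smooth_partial_derivs assms)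

text \<open>The complement of a closed set is open, so every derivative at a point off
  \<open>S\<close> is computed from zeros only.\<close>

lemma partial_derivs_eq_0_outside:
  assumes "\<And>x. x \<notin> S \<Longrightarrow> \<phi> x = 0" "closed S" "x \<notin> S"
  shows "partial_derivs \<beta> \<phi> x = 0"
  using assms(3)
proof (induction \<beta> arbitrary: x)
  case Nil
  then show ?case using assms by simp
next
  case (Cons i \<beta>)
  have "(partial_derivs \<beta> \<phi> has_derivative (\<lambda>h. 0)) (at x)"
  proof (rule has_derivative_transform_within_open)
    show "((\<lambda>x. 0 :: complex) has_derivative (\<lambda>h. 0)) (at x)" by simp
    show "open (- S)" "x \<in> - S" using assms(2) Cons.prems by auto
    show "\<And>y. y \<in> - S \<Longrightarrow> 0 = partial_derivs \<beta> \<phi> y" using Cons.IH by simp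
  qed
  from partial_deriv_eq[OF this] show ?case by (simp add: partial_derivs_Cons)
qed

lemma schwartz_of_compact_support:
  assumes "smooth \<phi>" "compact S" "\<And>x. x \<notin> S \<Longrightarrow> \<phi> x = 0"
  shows "\<phi> \<in> schwartz"
proof -
  have "bounded (range (\<lambda>x. (1 + norm x) ^ k *\<^sub>R partial_derivs \<beta> \<phi> x))" for k \<beta>
  proof -
    have "continuous_on S (\<lambda>x. (1 + norm x) ^ k *\<^sub>R partial_derivs \<beta> \<phi> x)"
      using smooth_partial_derivs[OF assms(1)] by (intro continuous_intros smooth_imp_continuous_on)
    then have "bounded ((\<lambda>x. (1 + norm x) ^ k *\<^sub>R partial_derivs \<beta> \<phi> x) ` S)"
      using assms(2) compact_continuous_image compact_imp_bounded by blast
    moreover have "range (\<lambda>x. (1 + norm x) ^ k *\<^sub>R partial_derivs \<beta> \<phi> x) \<subseteq>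
        insert 0 ((\<lambda>x. (1 + norm x) ^ k *\<^sub>R partial_derivs \<beta> \<phi> x) ` S)"
    proof (rule image_subsetI)
      fix x
      show "(1 + norm x) ^ k *\<^sub>R partial_derivs \<beta> \<phi> x \<in>
        insert 0 ((\<lambda>x. (1 + norm x) ^ k *\<^sub>R partial_derivs \<beta> \<phi> x) ` S)"
        using partial_derivs_eq_0_outside[where \<phi> = \<phi>, OF assms(3) compact_imp_closed[OF assms(2)], of x \<beta>]
        by (cases "x \<in> S") simp_all
    qed
    ultimately show ?thesis
      by (meson bounded_insert bounded_subset)
  qed
  then show ?thesis using assms(1) by (simp add: schwartz_def)
qed

lemma schwartz_imp_smooth: "\<phi> \<in> schwartz \<Longrightarrow> smooth \<phi>"
  by (simp add: schwartz_def)

lemma schwartz_partial_deriv: "\<phi> \<in> schwartz \<Longrightarrow> partial_deriv i \<phi> \<in> schwartz"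
  unfolding schwartz_def using smooth_partial_deriv by (auto simp flip: partial_derivs_snoc)

lemma schwartz_bound:
  assumes "\<phi> \<in> schwartz"
  obtains C where "C > 0" "\<And>x. (1 + norm x) ^ k * norm (partial_derivs \<beta> \<phi> x) \<le> C"
proof -
  have "bounded (range (\<lambda>x. (1 + norm x) ^ k *\<^sub>R partial_derivs \<beta> \<phi> x))"
    using assms by (simp add: schwartz_def)
  then obtain C where "C > 0" "\<And>x. norm ((1 + norm x) ^ k *\<^sub>R partial_derivs \<beta> \<phi> x) \<le> C"
    by (auto simp: bounded_pos)
  then show ?thesis by (intro that[of C]) auto
qed

subsection \<open>Smooth bump functions\<close>

text \<open>These functions form a class closed under differentiation: with z = 1/y, the derivative
  of P(z) e^(-z) in y is z^2 (P - P')(z) e^(-z). So the derivatives of e^(-1/y) of all orders are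
  given by an explicit sequence of polynomials, as \<open>smooth_compose_real\<close>
  demands.\<close>

definition flat :: "real poly \<Rightarrow> real \<Rightarrow> real" where
  "flat P y = (if y \<le> 0 then 0 else poly P (1 / y) * exp (- (1 / y)))"

lemma poly_times_exp_neg_tendsto_0: "((\<lambda>z. poly P z * exp (- z)) \<longlongrightarrow> (0::real)) at_top"
proof -
  have "((\<lambda>z. \<Sum>i\<le>degree P. coeff P i * (z ^ i / exp z)) \<longlongrightarrow> (\<Sum>i\<le>degree P. coeff P i * 0)) at_top"
    by (intro tendsto_sum tendsto_mult tendsto_const tendsto_power_div_exp_0)
  then show ?thesis
    by (simp add: poly_altdef sum_distrib_right exp_minus divide_inverse mult.assoc)
qed

lemma flat_has_real_derivative:
  "(flat P has_real_derivative flat ([:0, 0, 1:] * (P - pderiv P)) y) (at y)"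
proof -
  consider "y > 0" | "y < 0" | "y = 0" by linarith
  then show ?thesis
  proof cases
    case 1
    have "((\<lambda>y. poly P (1 / y) * exp (- (1 / y))) has_real_derivative
        flat ([:0, 0, 1:] * (P - pderiv P)) y) (at y)"
      using 1 by (auto intro!: derivative_eq_intros simp: flat_def field_simps power2_eq_square)
    then show ?thesis
      using 1 by (rule_tac has_field_derivative_transform_within_open[where S = "{0<..}"]) (auto simp: flat_def)
  next
    case 2
    have "((\<lambda>y. 0) has_real_derivative flat ([:0, 0, 1:] * (P - pderiv P)) y) (at y)"
      using 2 by (simp add: flat_def)
    then show ?thesis
      using 2 by (rule_tac has_field_derivative_transform_within_open[where S = "{..<0}"]) (auto simp: flat_def)
  next
    case 3
    \<comment> \<open>For the right-hand difference quotient at 0, put h = 1/z: the quotient becomes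
      z P(z) e^(-z), hence the extra factor z.\<close>
    have "((\<lambda>z. poly ([:0, 1:] * P) z * exp (- z)) \<longlongrightarrow> 0) at_top"
      by (rule poly_times_exp_neg_tendsto_0)
    then have "((\<lambda>z. flat P (inverse z) / inverse z) \<longlongrightarrow> 0) at_top"
    proof (rule Lim_transform_eventually)
      show "\<forall>\<^sub>F z in at_top. poly ([:0, 1:] * P) z * exp (- z) = flat P (inverse z) / inverse z"
        using eventually_gt_at_top[of "0::real"]
        by eventually_elim (auto simp: flat_def field_simps)
    qed
    then have "((\<lambda>h. flat P h / h) \<longlongrightarrow> 0) (at_right 0)"
      by (simp add: filterlim_at_right_to_top)
    moreover have "((\<lambda>h. flat P h / h) \<longlongrightarrow> 0) (at_left 0)"
      by (rule Lim_transform_eventually[OF tendsto_const])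
        (auto simp: flat_def eventually_at_left_field intro!: exI[of _ "-1"])
    ultimately have "((\<lambda>h. flat P h / h) \<longlongrightarrow> 0) (at 0)"
      by (simp add: filterlim_split_at)
    then have "((\<lambda>h. (flat P (0 + h) - flat P 0) / h) \<longlongrightarrow> 0) (at 0)"
      by (simp add: flat_def)
    then show ?thesis
      using 3 by (simp add: DERIV_def flat_def)
  qed
qed

lemma bump_function:
  fixes a :: "real^'n::finite"
  assumes "\<rho> > 0"
  obtains \<psi> :: "real^'n \<Rightarrow> real" where
    "(\<lambda>t. of_real (\<psi> t)) \<in> schwartz" "\<And>t. 0 \<le> \<psi> t" "\<And>t. \<psi> t \<le> 1"
    "\<And>t. dist a t \<le> \<rho> / 2 \<Longrightarrow> \<psi> t = 1" "\<And>t. dist a t \<ge> \<rho> \<Longrightarrow> \<psi> t = 0"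
proof -
  define Q where "Q = (\<lambda>k. ((\<lambda>P. [:0, 0, 1:] * (P - pderiv P)) ^^ k) ([:1:] :: real poly))"
  define E where "E = (\<lambda>k. flat (Q k))"
  have dE: "(E k has_real_derivative E (Suc k) y) (at y)" for k y
    unfolding E_def using flat_has_real_derivative[of "Q k" y] by (simp add: Q_def)
  have E0: "E 0 y = (if y \<le> 0 then 0 else exp (- (1 / y)))" for y
    by (simp add: E_def Q_def flat_def)
  have E_mono: "E 0 x \<le> E 0 y" if "x \<le> y" for x y
    using that by (auto simp: E0 field_simps)
  define u where "u = (\<lambda>t. (dist a t)\<^sup>2 - \<rho>\<^sup>2 / 4)"
  \<comment> \<open>\<open>c\<close> is the value of \<open>E 0 (u t)\<close> on the sphere of
    radius \<rho>, as \<rho>^2 - \<rho>^2/4 = 3 \<rho>^2/4. So \<open>E 0 (u t)\<close> is 0 on the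
    inner ball and at least \<open>c\<close> from radius \<rho> on; applying \<open>E 0\<close> to
    the difference with \<open>c\<close> makes the function constant at both ends.\<close>
  define c where "c = E 0 (3 * \<rho>\<^sup>2 / 4)"
  have c: "c > 0"
    using assms by (simp add: c_def E0)
  have u_eq: "u t = (\<Sum>i\<in>UNIV. (a $ i - t $ i) * (a $ i - t $ i)) - \<rho>\<^sup>2 / 4" for t
    unfolding u_def dist_norm power2_norm_eq_inner inner_vec_def by simp
  have s1: "smooth (\<lambda>t. of_real (u t))"
  proof -
    have "smooth (\<lambda>t. (\<Sum>i\<in>UNIV. (of_real (a $ i) + (-1) * of_real (t $ i)) * (of_real (a $ i) + (-1) * of_real (t $ i)))
        + of_real (- (\<rho>\<^sup>2 / 4)))"
      by (intro smooth_add smooth_sum smooth_mult smooth_const smooth_component)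
    then show ?thesis by (simp add: u_eq)
  qed
  have "smooth (\<lambda>t. of_real c + (-1) * of_real (E 0 (u t)))"
    by (intro smooth_add smooth_mult smooth_const smooth_compose_real[of E] dE s1)
  then have s2: "smooth (\<lambda>t. of_real (c - E 0 (u t)))"
    by simp
  define \<psi> where "\<psi> = (\<lambda>t. E 0 (c - E 0 (u t)) / E 0 c)"
  have "smooth (\<lambda>t. of_real (1 / E 0 c) * of_real (E 0 (c - E 0 (u t))))"
    by (intro smooth_mult smooth_const smooth_compose_real[of E] dE s2)
  then have s3: "smooth (\<lambda>t. of_real (\<psi> t))"
    by (simp add: \<psi>_def)
  have zero: "\<psi> t = 0" if "dist a t \<ge> \<rho>" for t
  proof -
    have "(dist a t)\<^sup>2 \<ge> \<rho>\<^sup>2"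
      using that assms by (intro power_mono) auto
    then have "c \<le> E 0 (u t)"
      unfolding c_def by (intro E_mono) (simp add: u_def)
    then show ?thesis by (simp add: \<psi>_def E0)
  qed
  have one: "\<psi> t = 1" if "dist a t \<le> \<rho> / 2" for t
  proof -
    have "(dist a t)\<^sup>2 \<le> (\<rho> / 2)\<^sup>2"
      using that by (intro power_mono) auto
    then have "E 0 (u t) = 0"
      by (simp add: E0 u_def power_divide)
    then show ?thesis using c by (simp add: \<psi>_def E0)
  qed
  have "E 0 x \<ge> 0" for x by (simp add: E0)
  moreover from this have "E 0 (c - E 0 (u t)) \<le> E 0 c" for t
    by (intro E_mono) simp
  ultimately have "0 \<le> \<psi> t" "\<psi> t \<le> 1" for t
    using c by (auto simp: \<psi>_def E0[of c])
  moreover have "(\<lambda>t. of_real (\<psi> t)) \<in> schwartz"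
    using s3 zero by (rule_tac schwartz_of_compact_support[of _ "cball a \<rho>"]) (auto simp: not_le intro: order.strict_implies_order)
  ultimately show ?thesis
    using zero one that by blast
qed

subsection \<open>Decay of Schwartz functions\<close>

text \<open>A product over the coordinates rather than a function of the norm: its integral factors
  into one-dimensional ones, and its reciprocal is a polynomial, which acts under the Fourier
  transform as a product of one-variable differential operators.\<close>

definition weight :: "real^'n::finite \<Rightarrow> real" where
  "weight x = (\<Prod>i\<in>UNIV. 1 / (1 + (x $ i)\<^sup>2))"

lemma weight_pos: "0 < weight x"
  by (auto simp: weight_def intro!: prod_pos add_pos_nonneg)

lemma weight_le_1: "weight x \<le> 1"
  by (auto simp: weight_def add_pos_nonneg intro!: prod_le_1)

lemma continuous_on_weight: "continuous_on A (weight :: real^'n::finite \<Rightarrow> real)"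
  unfolding weight_def by (intro continuous_intros ballI) (auto simp: add_nonneg_eq_0_iff)

lemma weight_measurable [measurable]: "weight \<in> borel_measurable borel"
  by (intro borel_measurable_continuous_onI continuous_on_weight)

lemma Basis_vec_axis: "(Basis :: (real^'n::finite) set) = range (\<lambda>i. axis i 1)"
  by (auto simp: Basis_vec_def)

lemma integrable_weight: "integrable lborel (weight :: real^'n::finite \<Rightarrow> real)"
proof -
  let ?f = "\<lambda>x::real. 1 / (1 + x\<^sup>2)"
  have "integrable lborel ?f"
    using integrable_inverse_1_plus_square by (simp add: set_integrable_def inverse_eq_divide)
  then have fin: "(\<integral>\<^sup>+x. ennreal (?f x) \<partial>lborel) < \<infinity>"
    using integrable_iff_bounded[of lborel ?f] by auto
  have inj: "inj (\<lambda>i::'n. axis i (1::real))"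
    by (auto simp: inj_on_def axis_eq_axis)
  have eq: "ennreal (weight x) = (\<Prod>b\<in>Basis. ennreal (?f (x \<bullet> b)))" for x :: "real^'n"
    unfolding Basis_vec_axis weight_def
    by (subst prod.reindex[OF inj]) (simp add: prod_ennreal inner_axis)
  have "(\<integral>\<^sup>+x. ennreal (weight x) \<partial>(lborel :: (real^'n) measure)) =
      (\<integral>\<^sup>+x. (\<Prod>b\<in>Basis. ennreal (?f (x \<bullet> b))) \<partial>(lborel :: (real^'n) measure))"
    by (simp only: eq)
  also have "\<dots> = (\<Prod>b\<in>(Basis::(real^'n) set). (\<integral>\<^sup>+x. ennreal (?f x) \<partial>lborel))"
    by (subst nn_integral_lborel_prod) auto
  also have "\<dots> < \<infinity>"
    using fin by (simp add: power_less_top_ennreal)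
  finally show ?thesis
    by (intro integrableI_bounded) (auto simp: weight_pos less_imp_le)
qed

text \<open>Each of the n factors 1 + x_i^2 is at most (1 + |x|)^2; this is the origin of the
  exponent 2n in the decay estimates.\<close>

lemma weight_ge: "1 \<le> (1 + norm x) ^ (2 * CARD('n)) * weight (x :: real^'n::finite)"
proof -
  have "1 + (x $ i)\<^sup>2 \<le> (1 + norm x)\<^sup>2" for i
  proof -
    have "(x $ i)\<^sup>2 \<le> (norm x)\<^sup>2"
      using component_le_norm_cart[of x i] by (metis abs_ge_zero power2_abs power_mono)
    then show ?thesis using norm_ge_zero[of x] by (simp only: power2_sum one_power2 mult_1_right)
  qed
  then have "(\<Prod>i\<in>UNIV. 1 + (x $ i)\<^sup>2) \<le> (\<Prod>i\<in>(UNIV::'n set). (1 + norm x)\<^sup>2)"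
    by (intro prod_mono) (auto simp: add_nonneg_nonneg)
  also have "\<dots> = (1 + norm x) ^ (2 * CARD('n))"
    by (simp add: power_mult)
  finally have "(\<Prod>i\<in>UNIV. 1 + (x $ i)\<^sup>2) \<le> (1 + norm x) ^ (2 * CARD('n))" .
  moreover have "(\<Prod>i\<in>UNIV. 1 + (x $ i)\<^sup>2) > 0"
    by (auto intro!: prod_pos add_pos_nonneg)
  moreover have "weight x = 1 / (\<Prod>i\<in>UNIV. 1 + (x $ i)\<^sup>2)"
    by (simp add: weight_def prod_dividef)
  ultimately show ?thesis
    by (simp add: field_simps)
qed

lemma le_weight:
  fixes x :: "real^'n::finite"
  assumes "(1 + norm x) ^ (2 * CARD('n)) * r \<le> C" "0 \<le> C"
  shows "r \<le> C * weight x"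
proof (cases "r \<le> 0")
  case True
  then show ?thesis using assms weight_pos[of x] by (meson mult_nonneg_nonneg order.trans less_imp_le)
next
  case False
  have "r * 1 \<le> r * ((1 + norm x) ^ (2 * CARD('n)) * weight x)"
    using weight_ge[of x] False by (intro mult_left_mono) auto
  also have "\<dots> = ((1 + norm x) ^ (2 * CARD('n)) * r) * weight x"
    by (simp add: ac_simps)
  also have "\<dots> \<le> C * weight x"
    using assms weight_pos[of x] by (intro mult_right_mono) auto
  finally show ?thesis by simp
qed

lemma schwartz_le_weight:
  assumes "\<phi> \<in> schwartz"
  obtains C where "C > 0" "\<And>x. norm (\<phi> x) \<le> C * weight x"
proof -
  obtain C where "C > 0" "\<And>x. (1 + norm x) ^ (2 * CARD('a)) * norm (partial_derivs [] \<phi> x) \<le> C"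
    using schwartz_bound[OF assms, where k = "2 * CARD('a)" and \<beta> = "[]"] by blast
  then show ?thesis
    by (intro that[of C]) (auto intro!: le_weight)
qed

lemma schwartz_continuous_on: "\<phi> \<in> schwartz \<Longrightarrow> continuous_on A \<phi>"
  by (simp add: schwartz_imp_smooth smooth_imp_continuous_on)

lemma schwartz_measurable: "\<phi> \<in> schwartz \<Longrightarrow> \<phi> \<in> borel_measurable borel"
  by (intro borel_measurable_continuous_onI schwartz_continuous_on)

lemma integrable_le_weight:
  fixes f :: "real^'n::finite \<Rightarrow> complex"
  assumes "f \<in> borel_measurable borel" "\<And>x. norm (f x) \<le> C * weight x"
  shows "integrable lborel f"
  by (rule Bochner_Integration.integrable_bound[where f = "\<lambda>x. C * weight x"])
     (use assms integrable_weight in \<open>auto intro: order.trans[OF _ abs_ge_self]\<close>)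

lemma schwartz_integrable: "\<phi> \<in> schwartz \<Longrightarrow> integrable lborel \<phi>"
  by (metis schwartz_le_weight integrable_le_weight schwartz_measurable)

subsection \<open>Fourier transforms\<close>

definition fourier :: "(real^'n::finite \<Rightarrow> complex) \<Rightarrow> real^'n \<Rightarrow> complex" where
  "fourier \<phi> w = (\<integral>t. \<phi> t * cis (- (2 * pi * (w \<bullet> t))) \<partial>lborel)"

lemma cis_measurable [measurable]: "cis \<in> borel_measurable borel"
  by (intro borel_measurable_continuous_onI continuous_intros)

lemma cnj_measurable [measurable]: "cnj \<in> borel_measurable borel"
  by (intro borel_measurable_continuous_onI continuous_intros)

lemma integrable_mult_bounded:
  fixes f k :: "'a \<Rightarrow> complex"
  assumes "integrable M f" "k \<in> borel_measurable M" "\<And>x. norm (k x) \<le> B"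
  shows "integrable M (\<lambda>x. f x * k x)"
proof (rule Bochner_Integration.integrable_bound[where f = "\<lambda>x. B * norm (f x)"])
  show "AE x in M. norm (f x * k x) \<le> norm (B * norm (f x))"
    using assms(3) by (intro AE_I2) (auto simp: norm_mult abs_mult mult.commute[of _ "norm (f _)"]
        intro!: mult_left_mono intro: order.trans[OF _ abs_ge_self])
qed (use assms in auto)

lemma fourier_integrable:
  "integrable lborel \<phi> \<Longrightarrow> integrable lborel (\<lambda>t. \<phi> t * cis (- (2 * pi * (w \<bullet> t))))"
  by (rule integrable_mult_bounded[where B = 1]) simp_all

lemma fourier_add:
  "integrable lborel \<phi> \<Longrightarrow> integrable lborel \<psi> \<Longrightarrow> fourier (\<lambda>t. \<phi> t + \<psi> t) w = fourier \<phi> w + fourier \<psi> w"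
  by (simp add: fourier_def ring_distribs fourier_integrable)

lemma fourier_cmult: "fourier (\<lambda>t. c * \<phi> t) w = c * fourier \<phi> w"
  by (simp add: fourier_def mult.assoc)

lemma norm_fourier_le: "integrable lborel \<phi> \<Longrightarrow> norm (fourier \<phi> w) \<le> (\<integral>t. norm (\<phi> t) \<partial>lborel)"
  unfolding fourier_def
  by (rule order.trans[OF integral_norm_bound]) (simp add: norm_mult)

lemma integral_translate:
  fixes f :: "real^'n::finite \<Rightarrow> complex"
  assumes "f \<in> borel_measurable borel"
  shows "(\<integral>t. f (t + a) \<partial>lborel) = (\<integral>t. f t \<partial>lborel)"
proof -
  have "(\<integral>t. f t \<partial>lborel) = (\<integral>t. f t \<partial>distr lborel borel ((+) a))"
    by (simp add: lborel_distr_plus)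
  also have "\<dots> = (\<integral>t. f (a + t) \<partial>lborel)"
    using assms by (subst integral_distr) auto
  finally show ?thesis by (simp add: add.commute)
qed

lemma nn_integral_translate:
  fixes f :: "real^'n::finite \<Rightarrow> ennreal"
  assumes "f \<in> borel_measurable borel"
  shows "(\<integral>\<^sup>+t. f (t + a) \<partial>lborel) = (\<integral>\<^sup>+t. f t \<partial>lborel)"
proof -
  have "(\<integral>\<^sup>+t. f t \<partial>lborel) = (\<integral>\<^sup>+t. f t \<partial>distr lborel borel ((+) a))"
    by (simp add: lborel_distr_plus)
  also have "\<dots> = (\<integral>\<^sup>+t. f (a + t) \<partial>lborel)"
    using assms by (subst nn_integral_distr) auto
  finally show ?thesis by (simp add: add.commute)
qed

text \<open>Instead of integrating by parts, the derivative is the limit of difference quotients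
  under the integral. Translation invariance evaluates each quotient as (e^(2 pi i w_i h) - 1)/h
  times the transform.\<close>

lemma fourier_partial_deriv:
  fixes \<phi> :: "real^'n::finite \<Rightarrow> complex"
  assumes \<phi>: "\<phi> \<in> schwartz"
  shows "fourier (partial_deriv i \<phi>) w = 2 * pi * \<i> * (w $ i) * fourier \<phi> w"
proof -
  let ?e = "axis i 1 :: real^'n"
  let ?k = "\<lambda>t. cis (- (2 * pi * (w \<bullet> t)))"
  \<comment> \<open>A sequence, since dominated convergence is sequential; steps of length at most 1
    keep the majorant uniform.\<close>
  define h where "h = (\<lambda>m. 1 / real (Suc m))"
  have h: "0 < h m" "h m \<le> 1" for m by (auto simp: h_def)
  have h_lim: "h \<longlonglongrightarrow> 0"
    unfolding h_def using LIMSEQ_inverse_real_of_nat by (simp add: inverse_eq_divide)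
  have h_at: "filterlim h (at 0) sequentially"
    using h h_lim by (auto simp: filterlim_at less_imp_neq[symmetric])
  define s where "s = (\<lambda>m t. (\<phi> (t + h m *\<^sub>R ?e) - \<phi> t) / of_real (h m) * ?k t)"
  obtain C where C: "C > 0" "\<And>x. (1 + norm x) ^ (2 * CARD('n)) * norm (partial_deriv i \<phi> x) \<le> C"
    using schwartz_bound[OF \<phi>, where k = "2 * CARD('n)" and \<beta> = "[i]"] by (auto simp: partial_derivs_Cons)
  have diff: "\<phi> differentiable (at y)" for y
    using \<phi> schwartz_imp_smooth smooth_imp_differentiable by blast
  have bound: "norm (s m t) \<le> 2 ^ (2 * CARD('n)) * C * weight t" for m t
  proof -
    have "\<exists>y\<in>{0<..<h m}. norm (\<phi> (t + h m *\<^sub>R ?e) - \<phi> (t + 0 *\<^sub>R ?e))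
        \<le> norm ((h m - 0) *\<^sub>R partial_deriv i \<phi> (t + y *\<^sub>R ?e))"
    proof (rule mvt_general)
      show "continuous_on {0..h m} (\<lambda>y. \<phi> (t + y *\<^sub>R ?e))"
        by (rule continuous_on_compose2[OF schwartz_continuous_on[OF \<phi>, of UNIV]])
          (intro continuous_intros subset_UNIV)+
      show "((\<lambda>y. \<phi> (t + y *\<^sub>R ?e)) has_derivative (\<lambda>h. h *\<^sub>R partial_deriv i \<phi> (t + x *\<^sub>R ?e))) (at x)" for x
        using partial_deriv_line[OF diff, of t i x] by (simp add: has_vector_derivative_def)
    qed (use h in auto)
    then obtain y where y: "0 < y" "y < h m"
      and le: "norm (\<phi> (t + h m *\<^sub>R ?e) - \<phi> t) \<le> h m * norm (partial_deriv i \<phi> (t + y *\<^sub>R ?e))"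
      using h[of m] by auto
    \<comment> \<open>The intermediate point of the mean value inequality is within distance 1 of
      \<open>t\<close>, so 1 + |t| is at most twice the corresponding quantity there. The decay of
      the derivative is thus inherited at the cost of 2^(2n).\<close>
    have "norm t \<le> norm (t + y *\<^sub>R ?e) + norm (y *\<^sub>R ?e)"
      by (metis add_diff_cancel_right' norm_triangle_ineq4)
    then have "norm t \<le> norm (t + y *\<^sub>R ?e) + 1"
      using y h[of m] by simp
    moreover have "1 + a \<le> 2 * (1 + b)" if "a \<le> b + 1" "0 \<le> b" for a b :: real
      using that by simp
    ultimately have "1 + norm t \<le> 2 * (1 + norm (t + y *\<^sub>R ?e))"
      using norm_ge_zero by blast
    then have "(1 + norm t) ^ (2 * CARD('n)) \<le> (2 * (1 + norm (t + y *\<^sub>R ?e))) ^ (2 * CARD('n))"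
      by (intro power_mono) auto
    then have "(1 + norm t) ^ (2 * CARD('n)) * norm (partial_deriv i \<phi> (t + y *\<^sub>R ?e))
        \<le> 2 ^ (2 * CARD('n)) * ((1 + norm (t + y *\<^sub>R ?e)) ^ (2 * CARD('n)) * norm (partial_deriv i \<phi> (t + y *\<^sub>R ?e)))"
      unfolding power_mult_distrib mult.assoc[symmetric] by (rule mult_right_mono) simp
    also have "\<dots> \<le> 2 ^ (2 * CARD('n)) * C"
      using C by (intro mult_left_mono) auto
    finally have "norm (partial_deriv i \<phi> (t + y *\<^sub>R ?e)) \<le> 2 ^ (2 * CARD('n)) * C * weight t"
      using C by (intro le_weight) auto
    moreover have "norm (s m t) \<le> norm (partial_deriv i \<phi> (t + y *\<^sub>R ?e))"
      using le h[of m] by (simp add: s_def norm_mult norm_divide divide_le_eq mult.commute)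
    ultimately show ?thesis by linarith
  qed
  have lim: "(\<lambda>m. s m t) \<longlonglongrightarrow> partial_deriv i \<phi> t * ?k t" for t
  proof -
    let ?f = "\<lambda>y. \<phi> (t + y *\<^sub>R ?e)"
    have "(?f has_vector_derivative partial_deriv i \<phi> t) (at 0)"
      using partial_deriv_line[OF diff, of t i 0] by simp
    then have "((\<lambda>y. norm (?f y - ?f 0 - y *\<^sub>R partial_deriv i \<phi> t) / norm y) \<longlongrightarrow> 0) (at 0)"
      unfolding has_vector_derivative_def has_derivative_at by simp
    from filterlim_compose[OF this h_at]
    have "(\<lambda>m. norm (?f (h m) - \<phi> t - h m *\<^sub>R partial_deriv i \<phi> t) / norm (h m)) \<longlonglongrightarrow> 0"
      by simp
    moreover have "norm (?f (h m) - \<phi> t - h m *\<^sub>R partial_deriv i \<phi> t) / norm (h m) =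
        norm ((?f (h m) - \<phi> t) / of_real (h m) - partial_deriv i \<phi> t)" for m
    proof -
      have "?f (h m) - \<phi> t - h m *\<^sub>R partial_deriv i \<phi> t =
          of_real (h m) * ((?f (h m) - \<phi> t) / of_real (h m) - partial_deriv i \<phi> t)"
        using h[of m] by (simp add: field_simps scaleR_conv_of_real)
      then show ?thesis
        using h[of m] by (simp only: norm_mult norm_of_real) simp
    qed
    ultimately have "(\<lambda>m. (?f (h m) - \<phi> t) / of_real (h m) - partial_deriv i \<phi> t) \<longlonglongrightarrow> 0"
      by (simp add: tendsto_norm_zero_iff)
    then have "(\<lambda>m. (?f (h m) - \<phi> t) / of_real (h m)) \<longlonglongrightarrow> partial_deriv i \<phi> t"
      by (simp add: LIM_zero_iff)
    then show ?thesis
      unfolding s_def by (intro tendsto_mult tendsto_const)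
  qed
  have meas: "\<phi> \<in> borel_measurable borel" "partial_deriv i \<phi> \<in> borel_measurable borel"
    by (intro schwartz_measurable schwartz_partial_deriv \<phi>)+
  have meas': "(\<lambda>t. \<phi> (t + a)) \<in> borel_measurable borel" for a
    using meas(1) by measurable
  have "(\<lambda>m. \<integral>t. s m t \<partial>lborel) \<longlonglongrightarrow> fourier (partial_deriv i \<phi>) w"
    unfolding fourier_def
  proof (rule integral_dominated_convergence[where w = "\<lambda>t. 2 ^ (2 * CARD('n)) * C * weight t"])
    show "integrable lborel (\<lambda>t. 2 ^ (2 * CARD('n)) * C * weight (t :: real^'n))"
      by (intro integrable_mult_right integrable_weight)
    show "s m \<in> borel_measurable lborel" for m
      unfolding s_def using meas meas' by (simp add: borel_measurable_times)
  qed (use bound lim meas in \<open>auto intro!: borel_measurable_times\<close>)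
  moreover have "(\<integral>t. s m t \<partial>lborel) = (cis (2 * pi * (w $ i) * h m) - 1) / of_real (h m) * fourier \<phi> w" for m
  proof -
    let ?g = "\<lambda>t. cis (2 * pi * (w $ i) * h m) * (\<phi> t * ?k t)"
    have sh: "\<phi> (t + h m *\<^sub>R ?e) * ?k t = ?g (t + h m *\<^sub>R ?e)" for t
      by (simp add: cis_mult inner_add_right inner_axis algebra_simps)
    have int: "integrable lborel (\<lambda>t. \<phi> t * ?k t)"
      by (intro fourier_integrable schwartz_integrable \<phi>)
    have "integrable lborel ?g"
      using int by simp
    then have int2: "integrable lborel (\<lambda>t. ?g (t + h m *\<^sub>R ?e))"
      using integrable_distr_eq[of "(+) (h m *\<^sub>R ?e)" lborel borel ?g] borel_measurable_integrable[OF \<open>integrable lborel ?g\<close>]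
      by (simp only: lborel_distr_plus) (simp add: add.commute)
    have "(\<integral>t. s m t \<partial>lborel) = (\<integral>t. (?g (t + h m *\<^sub>R ?e) - \<phi> t * ?k t) / of_real (h m) \<partial>lborel)"
      unfolding s_def sh[symmetric] by (simp add: field_simps)
    also have "\<dots> = ((\<integral>t. ?g (t + h m *\<^sub>R ?e) \<partial>lborel) - fourier \<phi> w) / of_real (h m)"
      unfolding fourier_def using int int2 by simp
    also have "(\<integral>t. ?g (t + h m *\<^sub>R ?e) \<partial>lborel) = (\<integral>t. ?g t \<partial>lborel)"
      using meas by (intro integral_translate) (auto intro!: borel_measurable_times)
    also have "\<dots> = cis (2 * pi * (w $ i) * h m) * fourier \<phi> w"
      by (simp add: fourier_def)
    finally show ?thesis by (simp add: field_simps)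
  qed
  moreover have "(\<lambda>m. (cis (2 * pi * (w $ i) * h m) - 1) / of_real (h m) * fourier \<phi> w) \<longlonglongrightarrow>
      2 * pi * \<i> * (w $ i) * fourier \<phi> w"
  proof -
    let ?c = "2 * pi * \<i> * (w $ i)"
    have "((\<lambda>z. exp (?c * z)) has_field_derivative ?c) (at 0)"
      by (auto intro!: derivative_eq_intros)
    then have "((\<lambda>z. (exp (?c * z) - 1) / z) \<longlongrightarrow> ?c) (at 0)"
      by (simp add: DERIV_def)
    moreover have "filterlim (\<lambda>m. complex_of_real (h m)) (at 0) sequentially"
      using h tendsto_of_real[OF h_lim, where 'a = complex] by (auto simp: filterlim_at less_imp_neq[symmetric])
    ultimately have "(\<lambda>m. (exp (?c * of_real (h m)) - 1) / of_real (h m)) \<longlonglongrightarrow> ?c"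
      by (rule filterlim_compose)
    moreover have "exp (?c * of_real (h m)) = cis (2 * pi * (w $ i) * h m)" for m
      by (simp add: cis_conv_exp algebra_simps)
    ultimately show ?thesis
      by (intro tendsto_mult tendsto_const) simp
  qed
  ultimately show ?thesis
    by (simp add: LIMSEQ_unique)
qed

text \<open>Made for the products of a Schwartz function with a conjugated window translated by x.
  Decay in the parameter x has to survive a Fourier transform in t, so both decays are required
  jointly and for all t-derivatives.\<close>

definition decaying_family :: "(real^'n::finite \<Rightarrow> real^'n \<Rightarrow> complex) \<Rightarrow> bool" where
  "decaying_family \<Phi> \<longleftrightarrow> (\<forall>x. smooth (\<Phi> x)) \<and>
     (\<forall>\<beta> k. \<exists>C. \<forall>x t. (1 + norm x) ^ k * (1 + norm t) ^ k * norm (partial_derivs \<beta> (\<Phi> x) t) \<le> C)"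

lemma decaying_family_imp_schwartz:
  assumes "decaying_family \<Phi>"
  shows "\<Phi> x \<in> schwartz"
proof -
  have "bounded (range (\<lambda>t. (1 + norm t) ^ k *\<^sub>R partial_derivs \<beta> (\<Phi> x) t))" for k \<beta>
  proof -
    obtain C where C: "\<And>x t. (1 + norm x) ^ k * (1 + norm t) ^ k * norm (partial_derivs \<beta> (\<Phi> x) t) \<le> C"
      using assms unfolding decaying_family_def by blast
    have "norm ((1 + norm t) ^ k *\<^sub>R partial_derivs \<beta> (\<Phi> x) t) \<le> C" for t
    proof -
      have "1 * ((1 + norm t) ^ k * norm (partial_derivs \<beta> (\<Phi> x) t)) \<le>
          (1 + norm x) ^ k * ((1 + norm t) ^ k * norm (partial_derivs \<beta> (\<Phi> x) t))"
        by (intro mult_right_mono) auto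
      then show ?thesis using C[of x t] by (simp add: mult.assoc)
    qed
    then show ?thesis by (auto simp: bounded_iff)
  qed
  then show ?thesis
    using assms by (simp add: schwartz_def decaying_family_def)
qed

lemma decaying_family_partial_deriv:
  "decaying_family \<Phi> \<Longrightarrow> decaying_family (\<lambda>x. partial_deriv i (\<Phi> x))"
  unfolding decaying_family_def using smooth_partial_deriv by (auto simp flip: partial_derivs_snoc)

lemma decaying_family_add:
  assumes "decaying_family \<Phi>" "decaying_family \<Psi>"
  shows "decaying_family (\<lambda>x t. \<Phi> x t + \<Psi> x t)"
  unfolding decaying_family_def
proof (intro conjI allI)
  show "smooth (\<lambda>t. \<Phi> x t + \<Psi> x t)" for x
    using assms by (intro smooth_add) (auto simp: decaying_family_def)
  fix \<beta> :: "'a list" and k :: nat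
  obtain C where C: "\<And>x t. (1 + norm x) ^ k * (1 + norm t) ^ k * norm (partial_derivs \<beta> (\<Phi> x) t) \<le> C"
    using assms unfolding decaying_family_def by blast
  obtain D where D: "\<And>x t. (1 + norm x) ^ k * (1 + norm t) ^ k * norm (partial_derivs \<beta> (\<Psi> x) t) \<le> D"
    using assms unfolding decaying_family_def by blast
  have "(1 + norm x) ^ k * (1 + norm t) ^ k * norm (partial_derivs \<beta> (\<lambda>t. \<Phi> x t + \<Psi> x t) t) \<le> C + D" for x t
  proof -
    have "(1 + norm x) ^ k * (1 + norm t) ^ k * norm (partial_derivs \<beta> (\<lambda>t. \<Phi> x t + \<Psi> x t) t) \<le>
      (1 + norm x) ^ k * (1 + norm t) ^ k * (norm (partial_derivs \<beta> (\<Phi> x) t) + norm (partial_derivs \<beta> (\<Psi> x) t))"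
      using assms by (intro mult_left_mono) (auto simp: decaying_family_def partial_derivs_add norm_triangle_ineq)
    then show ?thesis using C[of x t] D[of x t] by (simp add: distrib_left)
  qed
  then show "\<exists>C. \<forall>x t. (1 + norm x) ^ k * (1 + norm t) ^ k * norm (partial_derivs \<beta> (\<lambda>t. \<Phi> x t + \<Psi> x t) t) \<le> C"
    by blast
qed

lemma partial_derivs_cmult:
  assumes "smooth \<phi>"
  shows "partial_derivs \<beta> (\<lambda>x. c * \<phi> x) = (\<lambda>x. c * partial_derivs \<beta> \<phi> x)"
  by (induction \<beta>)
    (auto simp: partial_derivs_Cons partial_deriv_mult smooth_imp_differentiable smooth_partial_derivs assms)

lemma decaying_family_cmult:
  assumes "decaying_family \<Phi>"
  shows "decaying_family (\<lambda>x t. c * \<Phi> x t)"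
  unfolding decaying_family_def
proof (intro conjI allI)
  show "smooth (\<lambda>t. c * \<Phi> x t)" for x
    using assms by (intro smooth_mult smooth_const) (auto simp: decaying_family_def)
  fix \<beta> :: "'a list" and k :: nat
  obtain C where C: "\<And>x t. (1 + norm x) ^ k * (1 + norm t) ^ k * norm (partial_derivs \<beta> (\<Phi> x) t) \<le> C"
    using assms unfolding decaying_family_def by blast
  have "(1 + norm x) ^ k * (1 + norm t) ^ k * norm (partial_derivs \<beta> (\<lambda>t. c * \<Phi> x t) t) \<le> norm c * C" for x t
  proof -
    have sm: "smooth (\<Phi> x)" using assms by (simp add: decaying_family_def)
    have "(1 + norm x) ^ k * (1 + norm t) ^ k * norm (partial_derivs \<beta> (\<lambda>t. c * \<Phi> x t) t) =
      norm c * ((1 + norm x) ^ k * (1 + norm t) ^ k * norm (partial_derivs \<beta> (\<Phi> x) t))"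
      unfolding partial_derivs_cmult[OF sm] norm_mult by (simp only: ac_simps)
    also have "\<dots> \<le> norm c * C"
      by (rule mult_left_mono[OF C[of x t] norm_ge_zero[of c]])
    finally show ?thesis .
  qed
  then show "\<exists>C. \<forall>x t. (1 + norm x) ^ k * (1 + norm t) ^ k * norm (partial_derivs \<beta> (\<lambda>t. c * \<Phi> x t) t) \<le> C"
    by blast
qed

text \<open>Decay in x is paid for by the two factors, as 1 + |x| is at most (1 + |t|) (1 + |t -
  x|). Hence decay of order 2k is asked of \<eta>: k powers for t itself and k for x. The induction
  varies both functions, because the product rule moves derivatives to either of them.\<close>

lemma decaying_family_mult_reflect:
  assumes "\<eta> \<in> schwartz" "g \<in> schwartz"
  shows "decaying_family (\<lambda>x t. \<eta> t * cnj (g (t - x)))"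
proof -
  have "\<exists>C. \<forall>x t. (1 + norm x) ^ k * (1 + norm t) ^ k * norm (partial_derivs \<beta> (\<lambda>t. \<eta> t * cnj (g (t - x))) t) \<le> C"
    if "\<eta> \<in> schwartz" "g \<in> schwartz" for \<beta> :: "'a list" and k \<eta> g
    using that
  proof (induction \<beta> arbitrary: \<eta> g rule: rev_induct)
    case Nil
    obtain C where C: "C > 0" "\<And>t. (1 + norm t) ^ (2 * k) * norm (\<eta> t) \<le> C"
      using schwartz_bound[OF Nil(1), where k = "2 * k" and \<beta> = "[]"] by auto
    obtain D where D: "D > 0" "\<And>t. (1 + norm t) ^ k * norm (g t) \<le> D"
      using schwartz_bound[OF Nil(2), where k = k and \<beta> = "[]"] by auto
    have "(1 + norm x) ^ k * (1 + norm t) ^ k * norm (\<eta> t * cnj (g (t - x))) \<le> C * D" for x t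
    proof -
      have "norm x \<le> norm t + norm (t - x)"
        using norm_triangle_ineq4[of t "t - x"] by simp
      moreover have "0 \<le> norm t * norm (t - x)"
        by simp
      ultimately have "1 + norm x \<le> (1 + norm t) * (1 + norm (t - x))"
        unfolding ring_distribs by linarith
      then have "(1 + norm x) ^ k \<le> (1 + norm t) ^ k * (1 + norm (t - x)) ^ k"
        unfolding power_mult_distrib[symmetric] by (intro power_mono) auto
      then have "(1 + norm x) ^ k * (1 + norm t) ^ k * norm (\<eta> t * cnj (g (t - x))) \<le>
         ((1 + norm t) ^ k * (1 + norm (t - x)) ^ k) * (1 + norm t) ^ k * norm (\<eta> t * cnj (g (t - x)))"
        by (intro mult_right_mono) auto
      also have "\<dots> = ((1 + norm t) ^ (2 * k) * norm (\<eta> t)) * ((1 + norm (t - x)) ^ k * norm (g (t - x)))"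
      proof -
        have "(1 + norm t) ^ (2 * k) = (1 + norm t) ^ k * (1 + norm t) ^ k"
          by (simp only: mult_2 power_add)
        then show ?thesis by (simp only: norm_mult complex_mod_cnj ac_simps)
      qed
      also have "\<dots> \<le> C * D"
        using C D(1) D(2)[of "t - x"] by (intro mult_mono) auto
      finally show ?thesis .
    qed
    then show ?case by auto
  next
    case (snoc i \<beta>)
    have sm: "smooth \<eta>" "smooth (\<lambda>t. cnj (g (t - x)))"
        "smooth (partial_deriv i \<eta>)" "smooth (\<lambda>t. cnj (partial_deriv i g (t - x)))" for x
      using snoc.prems by (auto simp: schwartz_imp_smooth smooth_reflect_translate smooth_partial_deriv)
    have pd: "partial_deriv i (\<lambda>t. cnj (g (t - x))) = (\<lambda>t. cnj (partial_deriv i g (t - x)))" for x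
      by (intro smooth_reflect_translate(2) schwartz_imp_smooth snoc.prems)
    have eq: "partial_derivs (\<beta> @ [i]) (\<lambda>t. \<eta> t * cnj (g (t - x))) t =
       partial_derivs \<beta> (\<lambda>t. partial_deriv i \<eta> t * cnj (g (t - x))) t +
       partial_derivs \<beta> (\<lambda>t. \<eta> t * cnj (partial_deriv i g (t - x))) t" for x t
      using sm snoc.prems pd
      by (simp add: partial_derivs_snoc partial_deriv_mult smooth_imp_differentiable partial_derivs_add smooth_mult)
    obtain C where C: "\<And>x t. (1 + norm x) ^ k * (1 + norm t) ^ k *
        norm (partial_derivs \<beta> (\<lambda>t. partial_deriv i \<eta> t * cnj (g (t - x))) t) \<le> C"
      using snoc.IH[OF schwartz_partial_deriv snoc.prems(2), OF snoc.prems(1)] by blast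
    obtain D where D: "\<And>x t. (1 + norm x) ^ k * (1 + norm t) ^ k *
        norm (partial_derivs \<beta> (\<lambda>t. \<eta> t * cnj (partial_deriv i g (t - x))) t) \<le> D"
      using snoc.IH[OF snoc.prems(1) schwartz_partial_deriv, OF snoc.prems(2)] by blast
    have "(1 + norm x) ^ k * (1 + norm t) ^ k *
        norm (partial_derivs (\<beta> @ [i]) (\<lambda>t. \<eta> t * cnj (g (t - x))) t) \<le> C + D" for x t
    proof -
      have "(1 + norm x) ^ k * (1 + norm t) ^ k *
        norm (partial_derivs (\<beta> @ [i]) (\<lambda>t. \<eta> t * cnj (g (t - x))) t) \<le>
        (1 + norm x) ^ k * (1 + norm t) ^ k *
         (norm (partial_derivs \<beta> (\<lambda>t. partial_deriv i \<eta> t * cnj (g (t - x))) t) +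
          norm (partial_derivs \<beta> (\<lambda>t. \<eta> t * cnj (partial_deriv i g (t - x))) t))"
        unfolding eq by (intro mult_left_mono norm_triangle_ineq) auto
      then show ?thesis using C[of x t] D[of x t] by (simp add: distrib_left)
    qed
    then show ?case by blast
  qed
  then show ?thesis
    using assms unfolding decaying_family_def
    by (auto intro!: smooth_mult simp: schwartz_imp_smooth smooth_reflect_translate)
qed

text \<open>Multiplying a transform by 1 + w_i^2 amounts to applying the identity minus the second
  i-th derivative over 4 pi^2 to the family, which remains decaying. Doing this once per coordinate
  produces \<open>1 / weight w\<close>; what is left is bounded by an integral over t that still
  carries \<open>weight x\<close>.\<close>

lemma decaying_family_fourier_bound:
  fixes \<Phi> :: "real^'n::finite \<Rightarrow> real^'n \<Rightarrow> complex"
  assumes "decaying_family \<Phi>"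
  obtains C where "\<And>x w. norm (fourier (\<Phi> x) w) \<le> C * weight x * weight w" "C > 0"
proof -
  have "\<exists>\<Psi>. decaying_family \<Psi> \<and> (\<forall>x w. (\<Prod>i\<in>S. of_real (1 + (w $ i)\<^sup>2)) * fourier (\<Phi> x) w = fourier (\<Psi> x) w)"
    if "finite S" for S
    using that
  proof (induction S rule: finite_induct)
    case empty
    then show ?case using assms by auto
  next
    case (insert i S)
    then obtain \<Psi> where \<Psi>: "decaying_family \<Psi>"
      and eq: "\<And>x w. (\<Prod>i\<in>S. of_real (1 + (w $ i)\<^sup>2)) * fourier (\<Phi> x) w = fourier (\<Psi> x) w"
      by blast
    define \<Theta> where "\<Theta> = (\<lambda>x t. \<Psi> x t + (- 1 / (4 * pi\<^sup>2)) * partial_deriv i (partial_deriv i (\<Psi> x)) t)"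
    have "decaying_family \<Theta>"
      unfolding \<Theta>_def by (intro decaying_family_add decaying_family_cmult decaying_family_partial_deriv \<Psi>)
    moreover have "fourier (\<Theta> x) w = of_real (1 + (w $ i)\<^sup>2) * fourier (\<Psi> x) w" for x w
    proof -
      have sch: "\<Psi> x \<in> schwartz"
        using \<Psi> by (rule decaying_family_imp_schwartz)
      have "fourier (\<Theta> x) w = fourier (\<Psi> x) w + (- 1 / (4 * pi\<^sup>2)) * fourier (partial_deriv i (partial_deriv i (\<Psi> x))) w"
        unfolding \<Theta>_def fourier_cmult[symmetric] using sch
        by (intro fourier_add integrable_mult_right schwartz_integrable schwartz_partial_deriv)
      also have "\<dots> = of_real (1 + (w $ i)\<^sup>2) * fourier (\<Psi> x) w"
        using sch by (simp add: fourier_partial_deriv schwartz_partial_deriv field_simps power2_eq_square)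
      finally show ?thesis .
    qed
    ultimately show ?case
      using insert eq by (intro exI[of _ \<Theta>]) (auto simp: mult.assoc)
  qed
  from this[of UNIV] obtain \<Psi> where \<Psi>: "decaying_family \<Psi>"
    and eq: "\<And>x w. (\<Prod>i\<in>UNIV. of_real (1 + (w $ i)\<^sup>2)) * fourier (\<Phi> x) w = fourier (\<Psi> x) w"
    by auto
  have eq': "fourier (\<Phi> x) w = of_real (weight w) * fourier (\<Psi> x) w" for x w
  proof -
    have "complex_of_real (weight w) * (\<Prod>i\<in>UNIV. of_real (1 + (w $ i)\<^sup>2)) =
        of_real (\<Prod>i\<in>UNIV. (1 / (1 + (w $ i)\<^sup>2)) * (1 + (w $ i)\<^sup>2))"
      by (simp only: weight_def of_real_prod of_real_mult prod.distrib)
    also have "\<dots> = 1"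
      by (simp add: add_nonneg_eq_0_iff)
    finally show ?thesis
      unfolding eq[symmetric] by (simp flip: mult.assoc)
  qed
  let ?N = "2 * CARD('n)"
  obtain C where C: "\<And>x t. (1 + norm x) ^ ?N * (1 + norm t) ^ ?N * norm (\<Psi> x t) \<le> C"
    using \<Psi> unfolding decaying_family_def by (metis partial_derivs_Nil)
  have "0 \<le> C" using order.trans[OF norm_ge_zero, of "\<Psi> 0 0" C] C[of 0 0] by simp
  have le: "norm (\<Psi> x t) \<le> C * weight x * weight t" for x t
  proof -
    have "(1 + norm t) ^ ?N * norm (\<Psi> x t) \<le> C * weight x"
      using C[of x t] \<open>0 \<le> C\<close> by (intro le_weight) (simp_all add: mult.assoc)
    from le_weight[OF this] show ?thesis
      using \<open>0 \<le> C\<close> by (simp add: weight_pos less_imp_le)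
  qed
  define I where "I = (\<integral>t. weight (t :: real^'n) \<partial>lborel)"
  have "norm (fourier (\<Psi> x) w) \<le> C * weight x * I" for x w
  proof -
    have sch: "\<Psi> x \<in> schwartz"
      using \<Psi> by (rule decaying_family_imp_schwartz)
    have "norm (fourier (\<Psi> x) w) \<le> (\<integral>t. norm (\<Psi> x t) \<partial>lborel)"
      using sch by (intro norm_fourier_le schwartz_integrable)
    also have "\<dots> \<le> (\<integral>t. C * weight x * weight (t :: real^'n) \<partial>lborel)"
    proof (rule Bochner_Integration.integral_mono)
      show "integrable lborel (\<lambda>t. norm (\<Psi> x t))"
        by (intro integrable_norm schwartz_integrable sch)
    qed (auto intro: integrable_weight le)
    also have "\<dots> = C * weight x * I"
      by (simp add: I_def)
    finally show ?thesis .
  qed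
  then have "norm (fourier (\<Phi> x) w) \<le> C * I * weight x * weight w" for x w
    using mult_left_mono[of "norm (fourier (\<Psi> x) w)" "C * weight x * I" "weight w"] weight_pos[of w]
    by (simp add: eq' norm_mult algebra_simps)
  \<comment> \<open>The added 1 makes the constant strictly positive even for the zero
    family.\<close>
  also have "C * I * weight x * weight w \<le> (C * I + 1) * weight x * weight w" for x w :: "real^'n"
    using weight_pos[of x] weight_pos[of w] by (simp add: algebra_simps)
  finally have "norm (fourier (\<Phi> x) w) \<le> (C * I + 1) * weight x * weight w" for x w .
  moreover have "0 \<le> I"
    by (auto simp: I_def weight_pos less_imp_le)
  ultimately show ?thesis
    using \<open>0 \<le> C\<close> by (intro that[of "C * I + 1"]) (auto simp: add_nonneg_pos)
qed

lemma weight_nonneg [simp]: "0 \<le> weight x"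
  by (simp add: weight_pos less_imp_le)

lemma integrable_translate:
  fixes f :: "real^'n::finite \<Rightarrow> complex"
  assumes "integrable lborel f"
  shows "integrable lborel (\<lambda>t. f (t + a))"
  using assms integrable_distr_eq[of "(+) a" lborel borel f] borel_measurable_integrable[OF assms]
  by (simp only: lborel_distr_plus) (simp add: add.commute)

section \<open>Bounded functions as tempered distributions\<close>

lemma schwartz_diff:
  assumes "\<phi> \<in> schwartz" "\<psi> \<in> schwartz"
  shows "(\<lambda>x. \<psi> x - \<phi> x) \<in> schwartz"
proof -
  have sm: "smooth \<psi>" "smooth (\<lambda>x. (-1) * \<phi> x)"
    by (rule schwartz_imp_smooth[OF assms(2)]) (intro smooth_mult smooth_const schwartz_imp_smooth assms(1))
  have "smooth (\<lambda>x. \<psi> x + (-1) * \<phi> x)"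
    by (intro smooth_add sm)
  moreover have "bounded (range (\<lambda>x. (1 + norm x) ^ k *\<^sub>R partial_derivs \<beta> (\<lambda>x. \<psi> x + (-1) * \<phi> x) x))" for k \<beta>
  proof -
    have "(\<lambda>x. (1 + norm x) ^ k *\<^sub>R partial_derivs \<beta> (\<lambda>x. \<psi> x + (-1) * \<phi> x) x) =
       (\<lambda>x. (1 + norm x) ^ k *\<^sub>R partial_derivs \<beta> \<psi> x - (1 + norm x) ^ k *\<^sub>R partial_derivs \<beta> \<phi> x)"
      using assms unfolding partial_derivs_add[OF sm]
      by (simp only: partial_derivs_cmult[OF schwartz_imp_smooth]) (simp add: algebra_simps)
    moreover have "bounded (range (\<lambda>x. (1 + norm x) ^ k *\<^sub>R partial_derivs \<beta> \<psi> x))"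
      "bounded (range (\<lambda>x. (1 + norm x) ^ k *\<^sub>R partial_derivs \<beta> \<phi> x))"
      using assms by (auto simp: schwartz_def)
    ultimately show ?thesis
      by (simp only:) (rule bounded_minus_comp)
  qed
  ultimately show ?thesis
    by (simp add: schwartz_def)
qed

lemma schwartz_seminorm_bound:
  fixes \<phi> :: "real^'n::finite \<Rightarrow> complex"
  assumes "\<phi> \<in> schwartz"
  shows "norm (\<phi> x) \<le> schwartz_seminorm (2 * CARD('n)) [] \<phi> * weight x"
proof -
  let ?N = "2 * CARD('n)"
  obtain C where C: "\<And>x. (1 + norm x) ^ ?N * norm (partial_derivs [] \<phi> x) \<le> C"
    using schwartz_bound[OF assms] by blast
  have "(1 + norm x) ^ ?N * norm (\<phi> x) \<le> schwartz_seminorm ?N [] \<phi>" for x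
    unfolding schwartz_seminorm_def
    using C by (intro cSUP_upper2[of _ _ x]) (auto simp: bdd_above_def)
  moreover from this[of 0] have "0 \<le> schwartz_seminorm ?N [] \<phi>"
    using order.trans[OF norm_ge_zero[of "\<phi> 0"]] by simp
  ultimately show ?thesis
    by (intro le_weight)
qed

text \<open>The pairing is at most K times the integral of \<open>weight\<close> times one seminorm
  without derivatives, so a single subbasic set of the topology around \<phi> is mapped into any
  prescribed ball.\<close>

lemma tempered_distribution_bounded:
  fixes f :: "real^'n::finite \<Rightarrow> complex"
  assumes f: "f \<in> borel_measurable borel" and K: "\<And>t. norm (f t) \<le> K"
  shows "\<phi> \<in> schwartz \<Longrightarrow> integrable lborel (\<lambda>t. f t * \<phi> t)"
    and "tempered_distribution (\<lambda>\<phi>. \<integral>t. f t * \<phi> t \<partial>lborel)"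
proof -
  let ?u = "\<lambda>\<phi>. \<integral>t. f t * \<phi> t \<partial>lborel"
  show int: "integrable lborel (\<lambda>t. f t * \<phi> t)" if "\<phi> \<in> schwartz" for \<phi>
    using integrable_mult_bounded[OF schwartz_integrable[OF that], of f K] f K
    by (simp add: mult.commute)
  let ?N = "2 * CARD('n)"
  define I where "I = (\<integral>t. weight (t :: real^'n) \<partial>lborel)"
  have "0 \<le> I"
    by (auto simp: I_def weight_pos less_imp_le)
  have "0 \<le> K"
    using order.trans[OF norm_ge_zero K] .
  have le: "norm (?u \<phi>) \<le> K * I * schwartz_seminorm ?N [] \<phi>" if \<phi>: "\<phi> \<in> schwartz" for \<phi>
  proof -
    have "norm (?u \<phi>) \<le> (\<integral>t. norm (f t * \<phi> t) \<partial>lborel)"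
      by simp
    also have "\<dots> \<le> (\<integral>t. K * (schwartz_seminorm ?N [] \<phi> * weight (t :: real^'n)) \<partial>lborel)"
    proof (rule Bochner_Integration.integral_mono)
      show "integrable lborel (\<lambda>t. norm (f t * \<phi> t))"
        by (intro integrable_norm int \<phi>)
      show "norm (f t * \<phi> t) \<le> K * (schwartz_seminorm ?N [] \<phi> * weight t)" for t
        unfolding norm_mult using K schwartz_seminorm_bound[OF \<phi>] \<open>0 \<le> K\<close> by (intro mult_mono) auto
    qed (intro integrable_mult_right integrable_weight)
    also have "\<dots> = K * I * schwartz_seminorm ?N [] \<phi>"
      by (simp add: I_def)
    finally show ?thesis .
  qed
  have cont: "continuous_map schwartz_topology euclidean ?u"
    unfolding continuous_map
  proof (intro conjI allI impI)
    fix U :: "complex set"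
    assume "openin euclidean U"
    then have U: "open U" by simp
    show "openin schwartz_topology {\<phi> \<in> topspace schwartz_topology. ?u \<phi> \<in> U}"
    proof (subst openin_subopen, intro ballI)
      fix \<phi>
      assume "\<phi> \<in> {\<phi> \<in> topspace schwartz_topology. ?u \<phi> \<in> U}"
      then have \<phi>: "\<phi> \<in> schwartz" "?u \<phi> \<in> U"
        by (auto simp: schwartz_topology_def)
      obtain e where e: "e > 0" "ball (?u \<phi>) e \<subseteq> U"
        using U \<phi> openE by blast
      define d where "d = e / (K * I + 1)"
      have "K * I + 1 > 0" using \<open>0 \<le> K\<close> \<open>0 \<le> I\<close> by (simp add: add_nonneg_pos)
      then have "d > 0" using e by (simp add: d_def)
      let ?T = "{\<psi> \<in> schwartz. schwartz_seminorm ?N [] (\<lambda>x. \<psi> x - \<phi> x) < d}"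
      have "?T \<in> {{\<psi> \<in> schwartz. schwartz_seminorm k \<beta> (\<lambda>x. \<psi> x - \<phi> x) < e} | k \<beta> \<phi> e. \<phi> \<in> schwartz \<and> e > 0}"
        using \<phi> \<open>d > 0\<close> by blast
      then have T: "openin schwartz_topology ?T"
        unfolding schwartz_topology_def by (rule topology_generated_by_Basis)
      moreover have "\<phi> \<in> ?T"
        using \<phi> \<open>d > 0\<close> by (simp add: schwartz_seminorm_def)
      moreover have "?T \<subseteq> {\<phi> \<in> topspace schwartz_topology. ?u \<phi> \<in> U}"
      proof
        fix \<psi> assume \<psi>: "\<psi> \<in> ?T"
        have d: "(\<lambda>x. \<psi> x - \<phi> x) \<in> schwartz"
          using \<phi> \<psi> by (auto intro: schwartz_diff)
        have "?u \<psi> - ?u \<phi> = ?u (\<lambda>x. \<psi> x - \<phi> x)"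
          using int \<phi> \<psi> by (simp add: right_diff_distrib)
        then have "norm (?u \<psi> - ?u \<phi>) \<le> K * I * schwartz_seminorm ?N [] (\<lambda>x. \<psi> x - \<phi> x)"
          using le[OF d] by simp
        also have "\<dots> \<le> K * I * d"
          using \<psi> \<open>0 \<le> K\<close> \<open>0 \<le> I\<close> by (intro mult_left_mono) auto
        also have "\<dots> < e"
          using e \<open>K * I + 1 > 0\<close> by (simp add: d_def field_simps)
        finally have "?u \<psi> \<in> ball (?u \<phi>) e"
          by (simp add: dist_norm norm_minus_commute)
        moreover have "\<psi> \<in> topspace schwartz_topology"
          using openin_subset[OF T] \<psi> by blast
        ultimately show "\<psi> \<in> {\<phi> \<in> topspace schwartz_topology. ?u \<phi> \<in> U}"
          using e by auto
      qed
      ultimately show "\<exists>T. openin schwartz_topology T \<and> \<phi> \<in> T \<and> T \<subseteq> {\<phi> \<in> topspace schwartz_topology. ?u \<phi> \<in> U}"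
        by blast
    qed
  qed simp
  show "tempered_distribution ?u"
    unfolding tempered_distribution_def
  proof (intro conjI ballI allI)
    show "?u (\<lambda>x. \<phi> x + \<psi> x) = ?u \<phi> + ?u \<psi>" if "\<phi> \<in> schwartz" "\<psi> \<in> schwartz" for \<phi> \<psi>
      using int that by (simp add: distrib_left)
    show "?u (\<lambda>x. c * \<phi> x) = c * ?u \<phi>" if "\<phi> \<in> schwartz" for c \<phi>
      by (simp add: mult.left_commute)
  qed (rule cont)
qed

subsection \<open>Dominated functions and their multipliers\<close>

locale window =
  fixes g :: "real^'n::finite \<Rightarrow> complex"
  assumes g_schwartz: "g \<in> schwartz"
    and g_nonzero: "g \<noteq> (\<lambda>x. 0)"
begin

definition V :: "(real^'n \<Rightarrow> complex) \<Rightarrow> real^'n \<Rightarrow> real^'n \<Rightarrow> complex" where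
  "V f x w = fourier (\<lambda>t. f t * cnj (g (t - x))) w"

lemma stft_eq_V: "stft g (\<lambda>\<phi>. \<integral>t. f t * \<phi> t \<partial>lborel) x w = V f x w"
  by (simp add: stft_def V_def fourier_def modulate_def translate_def cis_cnj ac_simps)

lemma g_measurable [measurable]: "g \<in> borel_measurable borel"
  by (intro schwartz_measurable g_schwartz)

lemma integrable_g_translate: "integrable lborel (\<lambda>t. cnj (g (t - x)))"
  using integrable_translate[OF schwartz_integrable[OF g_schwartz], of "- x"] by simp

lemma integrable_mult_g:
  assumes "f \<in> borel_measurable borel" "\<And>t. norm (f t) \<le> K"
  shows "integrable lborel (\<lambda>t. f t * cnj (g (t - x)))"
  using integrable_mult_bounded[OF integrable_g_translate, of f K] assms by (simp add: mult.commute)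

lemma V_measurable:
  assumes [measurable]: "f \<in> borel_measurable borel"
  shows "(\<lambda>y. V f (fst y) (snd y)) \<in> borel_measurable (borel \<Otimes>\<^sub>M borel)"
  unfolding V_def fourier_def by measurable

lemma V_measurable_fst:
  assumes [measurable]: "f \<in> borel_measurable borel"
  shows "(\<lambda>x. V f x w) \<in> borel_measurable borel"
  unfolding V_def fourier_def by measurable

text \<open>The product majorant bounds the norm of \<open>M\<^bsup>p,1\<^esup>\<close> for all \<open>p\<close> at once, and countable
  subadditivity holds pointwise, without Minkowski's inequality.\<close>

definition dominated :: "(real^'n \<Rightarrow> complex) \<Rightarrow> real \<Rightarrow> bool" where
  "dominated f K \<longleftrightarrow> continuous_on UNIV f \<and> (\<forall>t. norm (f t) \<le> K) \<and>
     (\<exists>\<gamma>\<in>borel_measurable borel. (\<integral>\<^sup>+w. \<gamma> w \<partial>lborel) \<le> ennreal K \<and>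
        (\<forall>x w. ennreal (norm (V f x w)) \<le> ennreal (weight x) * \<gamma> w))"

lemma dominated_continuous_on: "dominated f K \<Longrightarrow> continuous_on A f"
  using continuous_on_subset by (auto simp: dominated_def)

lemma dominated_measurable: "dominated f K \<Longrightarrow> f \<in> borel_measurable borel"
  by (intro borel_measurable_continuous_onI dominated_continuous_on)

lemma dominated_bound: "dominated f K \<Longrightarrow> norm (f t) \<le> K"
  by (simp add: dominated_def)

lemma dominated_nonneg: "dominated f K \<Longrightarrow> 0 \<le> K"
  using dominated_bound norm_ge_zero order.trans by blast

lemma dominated_mono: "dominated f K \<Longrightarrow> K \<le> K' \<Longrightarrow> dominated f K'"
  unfolding dominated_def by (meson ennreal_leI order.trans)

text \<open>The transform of a Schwartz function is bounded by a product of a function of x and one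
  of w, which is exactly the shape of a majorant. The bumps used later enter the class here.\<close>

lemma schwartz_imp_dominated:
  assumes "\<phi> \<in> schwartz"
  obtains K where "dominated \<phi> K"
proof -
  obtain C where C: "\<And>x w. norm (V \<phi> x w) \<le> C * weight x * weight w" "C > 0"
    using decaying_family_fourier_bound[OF decaying_family_mult_reflect[OF assms g_schwartz]]
    unfolding V_def by metis
  obtain D where D: "D > 0" "\<And>x. norm (\<phi> x) \<le> D * weight x"
    using schwartz_le_weight[OF assms] by blast
  define I where "I = (\<integral>t. weight (t :: real^'n) \<partial>lborel)"
  have "dominated \<phi> (max D (C * I))"
    unfolding dominated_def
  proof (intro conjI allI bexI[of _ "\<lambda>w. ennreal (C * weight w)"])
    show "continuous_on UNIV \<phi>" by (rule schwartz_continuous_on[OF assms])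
    show "norm (\<phi> t) \<le> max D (C * I)" for t
      using order.trans[OF D(2)[of t] mult_left_mono[OF weight_le_1[of t], of D]] D(1) by simp
    have "(\<integral>\<^sup>+w. ennreal (C * weight (w :: real^'n)) \<partial>lborel) = ennreal (\<integral>w. C * weight (w :: real^'n) \<partial>lborel)"
      using C(2) by (intro nn_integral_eq_integral integrable_mult_right integrable_weight) auto
    then show "(\<integral>\<^sup>+w. ennreal (C * weight (w :: real^'n)) \<partial>lborel) \<le> ennreal (max D (C * I))"
      by (simp add: I_def ennreal_leI)
    show "ennreal (norm (V \<phi> x w)) \<le> ennreal (weight x) * ennreal (C * weight w)" for x w
      using C(1)[of x w] C(2) weight_pos[of x] weight_pos[of w]
      by (simp add: ennreal_mult[symmetric] less_imp_le ac_simps ennreal_leI)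
  qed simp
  then show ?thesis by (rule that)
qed

lemma dominated_cmult:
  assumes "dominated f K"
  shows "dominated (\<lambda>t. c * f t) (norm c * K)"
proof -
  obtain \<gamma> where \<gamma>: "\<gamma> \<in> borel_measurable borel" "(\<integral>\<^sup>+w. \<gamma> w \<partial>lborel) \<le> ennreal K"
    "\<And>x w. ennreal (norm (V f x w)) \<le> ennreal (weight x) * \<gamma> w"
    using assms unfolding dominated_def by blast
  show ?thesis
    unfolding dominated_def
  proof (intro conjI allI bexI[of _ "\<lambda>w. ennreal (norm c) * \<gamma> w"])
    show "continuous_on UNIV (\<lambda>t. c * f t)"
      by (intro continuous_intros dominated_continuous_on[OF assms])
    show "norm (c * f t) \<le> norm c * K" for t
      by (simp add: norm_mult mult_left_mono dominated_bound[OF assms])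
    show "(\<integral>\<^sup>+w. ennreal (norm c) * \<gamma> w \<partial>lborel) \<le> ennreal (norm c * K)"
      using \<gamma> by (simp add: nn_integral_cmult ennreal_mult' mult_left_mono)
    have "V (\<lambda>t. c * f t) x w = c * V f x w" for x w
      unfolding V_def fourier_cmult[symmetric] by (simp add: mult.assoc)
    then show "ennreal (norm (V (\<lambda>t. c * f t) x w)) \<le> ennreal (weight x) * (ennreal (norm c) * \<gamma> w)" for x w
      using mult_left_mono[OF \<gamma>(3)[of x w], of "ennreal (norm c)"] by (simp add: norm_mult ennreal_mult' ac_simps)
  qed (use \<gamma> in measurable)
qed

text \<open>This is the completeness on which the later constructions rest. The transform of the
  series is the series of transforms, because the integrals of the terms are bounded by K j times
  the L1 norm of the window; the majorants then add up pointwise in w.\<close>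

lemma dominated_suminf:
  assumes f: "\<And>j::nat. dominated (f j) (K j)" and K: "summable K"
  shows "dominated (\<lambda>t. \<Sum>j. f j t) (\<Sum>j. K j)"
proof -
  have "\<exists>\<gamma>\<in>borel_measurable borel. (\<integral>\<^sup>+w. \<gamma> w \<partial>lborel) \<le> ennreal (K j) \<and>
        (\<forall>x w. ennreal (norm (V (f j) x w)) \<le> ennreal (weight x) * \<gamma> w)" for j
    using f unfolding dominated_def by blast
  then obtain \<gamma> where \<gamma> [measurable]: "\<And>j. \<gamma> j \<in> borel_measurable borel"
    and \<gamma>K: "\<And>j. (\<integral>\<^sup>+w. \<gamma> j w \<partial>lborel) \<le> ennreal (K j)"
    and \<gamma>V: "\<And>j x w. ennreal (norm (V (f j) x w)) \<le> ennreal (weight x) * \<gamma> j w"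
    by metis
  have K0: "0 \<le> K j" for j
    using f dominated_nonneg by blast
  have sumf: "summable (\<lambda>j. norm (f j t))" for t
    using f dominated_bound by (intro summable_comparison_test'[OF K, of 0]) auto
  have meas [measurable]: "f j \<in> borel_measurable borel" for j
    using f dominated_measurable by blast
  have V_sum: "(\<lambda>j. V (f j) x w) sums V (\<lambda>t. \<Sum>j. f j t) x w" for x w
  proof -
    let ?k = "\<lambda>t. cnj (g (t - x)) * cis (- (2 * pi * (w \<bullet> t)))"
    have eq: "V h x w = (\<integral>t. h t * ?k t \<partial>lborel)" for h
      by (simp add: V_def fourier_def mult.assoc)
    have suminf_eq: "(\<Sum>j. f j t) * ?k t = (\<Sum>j. f j t * ?k t)" for t
      using summable_norm_cancel[OF sumf] by (rule suminf_mult2)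
    have k_norm: "norm (f j t * ?k t) \<le> K j * norm (cnj (g (t - x)))" for j t
      by (simp add: norm_mult mult_right_mono dominated_bound[OF f])
    have int: "integrable lborel (\<lambda>t. f j t * ?k t)" for j
      using fourier_integrable[OF integrable_mult_g[OF meas dominated_bound[OF f], of j x], of w]
      by (simp add: mult.assoc)
    show ?thesis
      unfolding eq suminf_eq
    proof (rule sums_integral)
      show "AE t in lborel. summable (\<lambda>j. norm (f j t * ?k t))"
        unfolding norm_mult by (intro AE_I2 summable_mult2 sumf)
      show "summable (\<lambda>j. \<integral>t. norm (f j t * ?k t) \<partial>lborel)"
      proof (rule summable_comparison_test')
        show "summable (\<lambda>j. K j * (\<integral>t. norm (cnj (g (t - x))) \<partial>lborel))"
          by (intro summable_mult2 K)
        show "norm (\<integral>t. norm (f j t * ?k t) \<partial>lborel) \<le> K j * (\<integral>t. norm (cnj (g (t - x))) \<partial>lborel)"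
          if "j \<ge> 0" for j
        proof -
          have "(\<integral>t. norm (f j t * ?k t) \<partial>lborel) \<le> (\<integral>t. K j * norm (cnj (g (t - x))) \<partial>lborel)"
            by (rule Bochner_Integration.integral_mono)
               (intro integrable_norm integrable_mult_right int integrable_g_translate k_norm)+
          then show ?thesis by simp
        qed
      qed
    qed (rule int)
  qed
  show ?thesis
    unfolding dominated_def
  proof (intro conjI allI bexI[of _ "\<lambda>w. \<Sum>j. \<gamma> j w"])
    have "uniform_limit UNIV (\<lambda>n t. \<Sum>j<n. f j t) (\<lambda>t. \<Sum>j. f j t) sequentially"
      using f dominated_bound by (intro Weierstrass_m_test[OF _ K]) auto
    then show "continuous_on UNIV (\<lambda>t. \<Sum>j. f j t)"
      by (rule uniform_limit_theorem[rotated])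
         (auto intro!: always_eventually continuous_on_sum dominated_continuous_on[OF f])
    show "norm (\<Sum>j. f j t) \<le> (\<Sum>j. K j)" for t
      using summable_norm[OF sumf[of t]] suminf_le[OF _ sumf[of t] K] dominated_bound[OF f]
      by (meson order.trans)
    have "(\<integral>\<^sup>+w. (\<Sum>j. \<gamma> j w) \<partial>lborel) = (\<Sum>j. \<integral>\<^sup>+w. \<gamma> j w \<partial>lborel)"
      by (intro nn_integral_suminf) measurable
    also have "\<dots> \<le> (\<Sum>j. ennreal (K j))"
      by (intro suminf_le \<gamma>K) auto
    also have "\<dots> = ennreal (\<Sum>j. K j)"
      using K0 K by (rule suminf_ennreal2)
    finally show "(\<integral>\<^sup>+w. (\<Sum>j. \<gamma> j w) \<partial>lborel) \<le> ennreal (\<Sum>j. K j)" .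
    show "ennreal (norm (V (\<lambda>t. \<Sum>j. f j t) x w)) \<le> ennreal (weight x) * (\<Sum>j. \<gamma> j w)" for x w
    proof -
      let ?S = "ennreal (weight x) * (\<Sum>j. \<gamma> j w)"
      have "(\<lambda>n. norm (\<Sum>j<n. V (f j) x w)) \<longlonglongrightarrow> norm (V (\<lambda>t. \<Sum>j. f j t) x w)"
        using V_sum[of x w] by (intro tendsto_norm) (simp add: sums_def)
      then have "(\<lambda>n. ennreal (norm (\<Sum>j<n. V (f j) x w))) \<longlonglongrightarrow> ennreal (norm (V (\<lambda>t. \<Sum>j. f j t) x w))"
        by (rule tendsto_ennrealI)
      moreover have "ennreal (norm (\<Sum>j<n. V (f j) x w)) \<le> ?S" for n
      proof -
        have "ennreal (norm (\<Sum>j<n. V (f j) x w)) \<le> ennreal (\<Sum>j<n. norm (V (f j) x w))"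
          by (intro ennreal_leI norm_sum)
        also have "\<dots> = (\<Sum>j<n. ennreal (norm (V (f j) x w)))"
          by (simp add: sum_ennreal)
        also have "\<dots> \<le> (\<Sum>j<n. ennreal (weight x) * \<gamma> j w)"
          by (intro sum_mono \<gamma>V)
        also have "\<dots> \<le> ?S"
          unfolding sum_distrib_left[symmetric] by (intro mult_left_mono sum_le_suminf) auto
        finally show ?thesis .
      qed
      ultimately show ?thesis
        by (intro LIMSEQ_le_const2[where X = "\<lambda>n. ennreal (norm (\<Sum>j<n. V (f j) x w))"]) blast+
    qed
  qed measurable
qed

lemma dominated_0: "dominated (\<lambda>t. 0) 0"
proof -
  obtain K where "dominated g K"
    using schwartz_imp_dominated[OF g_schwartz] .
  from dominated_cmult[OF this, of 0] show ?thesis by simp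
qed

lemma dominated_add:
  assumes "dominated f K" "dominated h L"
  shows "dominated (\<lambda>t. f t + h t) (K + L)"
proof -
  \<comment> \<open>A sum of two is a series with two nonzero terms, so the estimate for series
    applies as it stands.\<close>
  let ?F = "\<lambda>j t. if j = (0::nat) then f t else if j = 1 then h t else 0"
  let ?K = "\<lambda>j. if j = (0::nat) then K else if j = 1 then L else 0"
  have *: "(\<Sum>j. if j = (0::nat) then a else if j = 1 then b else 0) = a + b"
    "summable (\<lambda>j. if j = (0::nat) then a else if j = 1 then b else 0)" for a b :: "'b::real_normed_vector"
  proof -
    have "(\<lambda>j. if j = (0::nat) then a else if j = 1 then b else 0) sums
        (\<Sum>j\<in>{0,1}. if j = (0::nat) then a else if j = 1 then b else 0)"
      by (rule sums_finite) auto
    then show "(\<Sum>j. if j = (0::nat) then a else if j = 1 then b else 0) = a + b"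
      "summable (\<lambda>j. if j = (0::nat) then a else if j = 1 then b else 0)"
      by (auto simp: sums_iff)
  qed
  have "dominated (?F j) (?K j)" for j
    using assms dominated_0 by auto
  from dominated_suminf[OF this *(2)] show ?thesis
    by (simp add: *(1))
qed

text \<open>A modulation only translates the transform in w. The factor \<open>weight x\<close> is
  untouched and the integral of the majorant is translation invariant, so characters cost
  nothing.\<close>

lemma dominated_modulate:
  assumes "dominated f K"
  shows "dominated (\<lambda>t. cis (2 * pi * (k \<bullet> t)) * f t) K"
proof -
  obtain \<gamma> where \<gamma>: "\<gamma> \<in> borel_measurable borel" "(\<integral>\<^sup>+w. \<gamma> w \<partial>lborel) \<le> ennreal K"
    "\<And>x w. ennreal (norm (V f x w)) \<le> ennreal (weight x) * \<gamma> w"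
    using assms unfolding dominated_def by blast
  have V: "V (\<lambda>t. cis (2 * pi * (k \<bullet> t)) * f t) x w = V f x (w - k)" for x w
  proof -
    have eq: "cis (2 * pi * (k \<bullet> t)) * cis (- (2 * pi * (w \<bullet> t))) = cis (- (2 * pi * ((w - k) \<bullet> t)))" for t
      by (simp add: cis_mult inner_diff_left algebra_simps)
    have "cis (2 * pi * (k \<bullet> t)) * f t * cnj (g (t - x)) * cis (- (2 * pi * (w \<bullet> t))) =
        f t * cnj (g (t - x)) * cis (- (2 * pi * ((w - k) \<bullet> t)))" for t
    proof -
      have "cis (2 * pi * (k \<bullet> t)) * f t * cnj (g (t - x)) * cis (- (2 * pi * (w \<bullet> t))) =
          f t * cnj (g (t - x)) * (cis (2 * pi * (k \<bullet> t)) * cis (- (2 * pi * (w \<bullet> t))))"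
        by (simp only: ac_simps)
      then show ?thesis by (simp only: eq)
    qed
    then show ?thesis
      by (simp only: V_def fourier_def)
  qed
  show ?thesis
    unfolding dominated_def
  proof (intro conjI allI bexI[of _ "\<lambda>w. \<gamma> (w - k)"])
    show "continuous_on UNIV (\<lambda>t. cis (2 * pi * (k \<bullet> t)) * f t)"
      by (intro continuous_intros dominated_continuous_on[OF assms])
    show "norm (cis (2 * pi * (k \<bullet> t)) * f t) \<le> K" for t
      by (simp add: norm_mult dominated_bound[OF assms])
    show "(\<integral>\<^sup>+w. \<gamma> (w - k) \<partial>lborel) \<le> ennreal K"
      using nn_integral_translate[OF \<gamma>(1), of "- k"] \<gamma>(2) by simp
    show "ennreal (norm (V (\<lambda>t. cis (2 * pi * (k \<bullet> t)) * f t) x w)) \<le> ennreal (weight x) * \<gamma> (w - k)" for x w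
      unfolding V by (rule \<gamma>(3))
  qed (use \<gamma>(1) in measurable)
qed

text \<open>Cosines and nonzero constants do not decay in x and so cannot be dominated; they are
  measured by their action on dominated functions. Being an operator bound, \<kappa> adds under sums
  and multiplies under products.\<close>

definition multiplier :: "(real^'n \<Rightarrow> complex) \<Rightarrow> real \<Rightarrow> bool" where
  "multiplier q \<kappa> \<longleftrightarrow> 0 \<le> \<kappa> \<and> (\<forall>f K. dominated f K \<longrightarrow> dominated (\<lambda>t. q t * f t) (\<kappa> * K))"

lemma multiplierD: "multiplier q \<kappa> \<Longrightarrow> dominated f K \<Longrightarrow> dominated (\<lambda>t. q t * f t) (\<kappa> * K)"
  by (simp add: multiplier_def)

lemma multiplier_mono: "multiplier q \<kappa> \<Longrightarrow> \<kappa> \<le> \<kappa>' \<Longrightarrow> multiplier q \<kappa>'"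
  unfolding multiplier_def by (meson dominated_mono dominated_nonneg mult_right_mono order.trans)

lemma multiplier_const: "multiplier (\<lambda>t. c) (norm c)"
  by (simp add: multiplier_def dominated_cmult)

lemma multiplier_character: "multiplier (\<lambda>t. cis (2 * pi * (k \<bullet> t))) 1"
  by (simp add: multiplier_def dominated_modulate)

lemma multiplier_add: "multiplier q \<kappa> \<Longrightarrow> multiplier r l \<Longrightarrow> multiplier (\<lambda>t. q t + r t) (\<kappa> + l)"
  by (auto simp: multiplier_def distrib_right intro: dominated_add)

lemma multiplier_mult: "multiplier q \<kappa> \<Longrightarrow> multiplier r l \<Longrightarrow> multiplier (\<lambda>t. q t * r t) (\<kappa> * l)"
  by (auto simp: multiplier_def mult.assoc)

text \<open>The exponential series is summed inside the class of dominated functions, applied to one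
  \<open>f\<close> at a time.\<close>

lemma multiplier_exp:
  assumes "multiplier q \<kappa>"
  shows "multiplier (\<lambda>t. exp (q t)) (exp \<kappa>)"
  unfolding multiplier_def
proof (intro conjI allI impI)
  fix f K assume f: "dominated f K"
  have pow: "dominated (\<lambda>t. q t ^ m * f t) (\<kappa> ^ m * K)" for m
  proof (induction m)
    case (Suc m)
    from multiplierD[OF assms this] show ?case by (simp add: mult.assoc)
  qed (use f in simp)
  have "dominated (\<lambda>t. q t ^ m /\<^sub>R fact m * f t) (\<kappa> ^ m /\<^sub>R fact m * K)" for m
    using dominated_cmult[OF pow[of m], of "1 / fact m"]
    by (simp add: norm_divide scaleR_conv_of_real divide_inverse norm_inverse ac_simps)
  moreover have "summable (\<lambda>m. \<kappa> ^ m /\<^sub>R fact m * K)"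
    by (intro summable_mult2 summable_exp_generic)
  ultimately have "dominated (\<lambda>t. \<Sum>m. q t ^ m /\<^sub>R fact m * f t) (\<Sum>m. \<kappa> ^ m /\<^sub>R fact m * K)"
    by (rule dominated_suminf)
  then show "dominated (\<lambda>t. exp (q t) * f t) (exp \<kappa> * K)"
    by (simp only: suminf_mult2[OF summable_exp_generic, symmetric] exp_def)
qed simp

lemma multiplier_cos: "multiplier (\<lambda>t. of_real (cos (2 * pi * (k \<bullet> t)))) 1"
proof -
  have "multiplier (\<lambda>t. (1 / 2) * (cis (2 * pi * (k \<bullet> t)) + cis (2 * pi * ((- k) \<bullet> t)))) (norm (1 / 2 :: complex) * (1 + 1))"
    by (intro multiplier_mult multiplier_add multiplier_const multiplier_character)
  moreover have "(1 / 2) * (cis (2 * pi * (k \<bullet> t)) + cis (2 * pi * ((- k) \<bullet> t))) = of_real (cos (2 * pi * (k \<bullet> t)))" for t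
    by (simp add: complex_eq_iff)
  ultimately show ?thesis by simp
qed

text \<open>The phase \<theta> enters only through unimodular constants when the sine is split into
  two exponentials, each contributing e/2. Therefore the bound does not depend on \<theta>.\<close>

lemma multiplier_sin_add:
  assumes "multiplier (\<lambda>t. of_real (f t)) 1"
  shows "multiplier (\<lambda>t. of_real (sin (\<theta> + f t))) (exp 1)"
proof -
  let ?a = "cis \<theta> / (2 * \<i>)" and ?b = "- cis (- \<theta>) / (2 * \<i>)"
  have 1: "multiplier (\<lambda>t. c * of_real (f t)) 1" if "norm c = 1" for c
    using multiplier_mult[OF multiplier_const assms, of c] that by simp
  have "multiplier (\<lambda>t. ?a * exp (\<i> * of_real (f t)) + ?b * exp ((- \<i>) * of_real (f t)))
      (norm ?a * exp 1 + norm ?b * exp 1)"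
    by (intro multiplier_add multiplier_mult multiplier_const multiplier_exp 1) auto
  moreover have "norm ?a * exp 1 + norm ?b * exp 1 = exp (1::real)"
    by (simp add: norm_divide norm_mult)
  moreover have "?a * exp (\<i> * of_real (f t)) + ?b * exp ((- \<i>) * of_real (f t)) = of_real (sin (\<theta> + f t))" for t
  proof -
    have "exp (\<i> * of_real (f t)) = cis (f t)" "exp ((- \<i>) * of_real (f t)) = cis (- f t)"
      by (simp_all add: cis_conv_exp)
    then have "?a * exp (\<i> * of_real (f t)) + ?b * exp ((- \<i>) * of_real (f t)) =
        (cis (\<theta> + f t) - cis (- (\<theta> + f t))) / (2 * \<i>)"
      by (simp only: minus_add_distrib cis_mult[symmetric]) (simp add: field_simps)
    also have "\<dots> = of_real (sin (\<theta> + f t))"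
      using sin_minus[of "\<theta> + f t"] cos_minus[of "\<theta> + f t"]
      by (simp add: complex_eq_iff Re_divide Im_divide power2_eq_square)
    finally show ?thesis .
  qed
  ultimately show ?thesis by simp
qed

text \<open>For fixed w the transform is at most c times \<open>weight\<close>, whose L^p norms are
  bounded simultaneously for all p: \<open>weight\<close> is at most 1, so its q-th power is at most
  \<open>weight\<close> itself.\<close>

lemma dominated_imp_modulation_function:
  assumes f: "dominated f K" and p: "1 \<le> p"
  shows "f \<in> modulation_functions g p"
proof -
  obtain \<gamma> where \<gamma> [measurable]: "\<gamma> \<in> borel_measurable borel"
    and \<gamma>K: "(\<integral>\<^sup>+w. \<gamma> w \<partial>lborel) \<le> ennreal K"
    and \<gamma>V: "\<And>x w. ennreal (norm (V f x w)) \<le> ennreal (weight x) * \<gamma> w"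
    using f unfolding dominated_def by blast
  have meas [measurable]: "f \<in> borel_measurable borel"
    using f by (rule dominated_measurable)
  \<comment> \<open>The summand 1 ensures that I is at least 1. This covers the supremum norm and
    allows the root \<open>I powr (1 / q)\<close> to be replaced by I.\<close>
  define I where "I = 1 + (\<integral>t. weight (t :: real^'n) \<partial>lborel)"
  have I: "I \<ge> 1"
    by (auto simp: I_def weight_pos less_imp_le)
  have Lp: "Lp_norm p (\<lambda>x. V f x w) \<le> ennreal I * \<gamma> w" for w
  proof (cases "\<gamma> w = \<infinity>")
    case True
    then show ?thesis using I by (simp add: ennreal_mult_top)
  next
    case False
    define c where "c = enn2real (\<gamma> w)"
    have c: "0 \<le> c" "\<gamma> w = ennreal c"
      using False by (auto simp: c_def less_top)
    have le: "norm (V f x w) \<le> weight x * c" for x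
      using \<gamma>V[of x w] c weight_pos[of x] by (simp add: ennreal_mult[symmetric] less_imp_le)
    show ?thesis
    proof (cases "p = \<infinity>")
      case True
      have "norm (V f x w) \<le> I * c" for x
        using le[of x] mult_right_mono[of "weight x" I c] weight_le_1[of x] I c(1) by simp
      then have "esssup lborel (\<lambda>x. ennreal (norm (V f x w))) \<le> ennreal (I * c)"
        using V_measurable_fst[OF meas, of w] by (intro esssup_I) (auto intro!: ennreal_leI)
      then show ?thesis
        using True c I by (simp add: Lp_norm_def ennreal_mult)
    next
      case False
      define q where "q = enn2real p"
      have q: "1 \<le> q"
        using p False unfolding q_def by (metis enn2real_1 enn2real_mono top.not_eq_extremum infinity_ennreal_def)
      let ?N = "\<integral>\<^sup>+x. ennreal (norm (V f x w) powr q) \<partial>lborel"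
      have "norm (V f x w) powr q \<le> c powr q * weight x" for x
      proof -
        have "norm (V f x w) powr q \<le> (weight x * c) powr q"
          using le[of x] q by (intro powr_mono2) auto
        also have "\<dots> = weight x powr q * c powr q"
          using weight_pos[of x] c by (simp add: powr_mult)
        also have "weight x powr q \<le> weight x powr 1"
          using weight_pos[of x] weight_le_1[of x] q by (intro powr_mono') auto
        then have "weight x powr q * c powr q \<le> weight x * c powr q"
          using weight_pos[of x] by (intro mult_right_mono) auto
        finally show ?thesis by (simp add: mult.commute)
      qed
      then have "?N \<le> (\<integral>\<^sup>+x. ennreal (c powr q * weight (x :: real^'n)) \<partial>lborel)"
        by (intro nn_integral_mono ennreal_leI)
      also have "\<dots> = ennreal (\<integral>x. c powr q * weight (x :: real^'n) \<partial>lborel)"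
        by (intro nn_integral_eq_integral integrable_mult_right integrable_weight) auto
      also have "\<dots> \<le> ennreal (c powr q * I)"
        by (intro ennreal_leI) (simp add: I_def distrib_left)
      finally have N: "?N \<le> ennreal (c powr q * I)" .
      then have "?N \<noteq> \<infinity>"
        by (auto simp: top_unique)
      moreover have "enn2real ?N powr (1 / q) \<le> I * c"
      proof -
        have "enn2real ?N \<le> c powr q * I"
          using enn2real_mono[OF N] I by simp
        then have "enn2real ?N powr (1 / q) \<le> (c powr q * I) powr (1 / q)"
          using q by (intro powr_mono2) auto
        also have "\<dots> = c * I powr (1 / q)"
          using c I q by (simp add: powr_mult powr_powr)
        also have "I powr (1 / q) \<le> I powr 1"
          using I q by (intro powr_mono) auto
        then have "c * I powr (1 / q) \<le> c * I"
          using I c by (intro mult_left_mono) auto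
        finally show ?thesis by (simp add: mult.commute)
      qed
      ultimately show ?thesis
        using False c I by (simp add: Lp_norm_def q_def[symmetric] ennreal_leI flip: ennreal_mult)
    qed
  qed
  have "modulation_norm g p (\<lambda>\<phi>. \<integral>t. f t * \<phi> t \<partial>lborel) \<le> (\<integral>\<^sup>+w. ennreal I * \<gamma> w \<partial>lborel)"
    unfolding modulation_norm_def stft_eq_V by (intro nn_integral_mono Lp)
  also have "\<dots> = ennreal I * (\<integral>\<^sup>+w. \<gamma> w \<partial>lborel)"
    by (simp add: nn_integral_cmult)
  also have "\<dots> \<le> ennreal I * ennreal K"
    by (intro mult_left_mono \<gamma>K) simp
  also have "\<dots> < \<infinity>"
    by (simp add: ennreal_mult_less_top)
  finally show ?thesis
    using tempered_distribution_bounded[OF meas dominated_bound[OF f]] dominated_continuous_on[OF f]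
    by (simp add: modulation_functions_def modulation_space_def)
qed

end

subsection \<open>Trigonometric polynomials with integer frequencies\<close>

definition integer_vector :: "real^'n::finite \<Rightarrow> bool" where
  "integer_vector k \<longleftrightarrow> (\<forall>i. k $ i \<in> \<int>)"

text \<open>D bounds the coefficients one by one and not their sum, which is the quantity dual to
  integrability in w. R records the size of the spectrum, so that a new frequency can be chosen far
  outside it.\<close>

definition trig_poly :: "real \<Rightarrow> real \<Rightarrow> (real^'n::finite \<Rightarrow> complex) \<Rightarrow> bool" where
  "trig_poly D R T \<longleftrightarrow> (\<exists>c. finite {k. c k \<noteq> 0} \<and> (\<forall>k. norm (c k) \<le> D) \<and>
     (\<forall>k. c k \<noteq> 0 \<longrightarrow> integer_vector k \<and> norm k \<le> R) \<and>
     T = (\<lambda>t. \<Sum>k | c k \<noteq> 0. c k * cis (2 * pi * (k \<bullet> t))))"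

lemma trig_polyI:
  assumes "finite S" "\<And>k. norm (c k) \<le> D" "\<And>k. c k \<noteq> 0 \<Longrightarrow> k \<in> S"
    "\<And>k. c k \<noteq> 0 \<Longrightarrow> integer_vector k \<and> norm k \<le> R"
    "\<And>t. T t = (\<Sum>k\<in>S. c k * cis (2 * pi * (k \<bullet> t)))"
  shows "trig_poly D R T"
  unfolding trig_poly_def
proof (intro exI[of _ c] conjI allI)
  show "finite {k. c k \<noteq> 0}"
    using assms by (auto intro: finite_subset[of _ S])
  show "T = (\<lambda>t. \<Sum>k | c k \<noteq> 0. c k * cis (2 * pi * (k \<bullet> t)))"
    using assms by (intro ext) (auto intro!: sum.mono_neutral_right)
qed (use assms in auto)

lemma trig_polyE:
  assumes "trig_poly D R T"
  obtains c S where "finite S" "\<And>k. norm (c k) \<le> D" "\<And>k. k \<in> S \<longleftrightarrow> c k \<noteq> 0"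
    "\<And>k. k \<in> S \<Longrightarrow> integer_vector k" "\<And>k. k \<in> S \<Longrightarrow> norm k \<le> R"
    "\<And>t. T t = (\<Sum>k\<in>S. c k * cis (2 * pi * (k \<bullet> t)))"
proof -
  obtain c where "finite {k. c k \<noteq> 0} \<and> (\<forall>k. norm (c k) \<le> D) \<and>
     (\<forall>k. c k \<noteq> 0 \<longrightarrow> integer_vector k \<and> norm k \<le> R) \<and>
     T = (\<lambda>t. \<Sum>k | c k \<noteq> 0. c k * cis (2 * pi * (k \<bullet> t)))"
    using assms unfolding trig_poly_def by blast
  then show ?thesis
    by (intro that[of "{k. c k \<noteq> 0}" c]) auto
qed

lemma trig_poly_mono: "trig_poly D R T \<Longrightarrow> D \<le> D' \<Longrightarrow> R \<le> R' \<Longrightarrow> trig_poly D' R' T"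
  by (erule trig_polyE) (rule trig_polyI, auto, (meson order.trans)+)

lemma trig_poly_const: "trig_poly (norm c) 0 (\<lambda>t :: real^'n::finite. c)"
proof (rule trig_polyI[of "{0}" "\<lambda>k. if k = 0 then c else 0"])
  fix k :: "real^'n"
  assume "(if k = 0 then c else 0) \<noteq> 0"
  then have "k = 0" by meson
  then show "k \<in> {0}" "integer_vector k \<and> norm k \<le> 0"
    by (simp_all add: integer_vector_def)
qed simp_all

lemma trig_poly_add:
  assumes "trig_poly D R T" "trig_poly D' R T'"
  shows "trig_poly (D + D') R (\<lambda>t. T t + T' t)"
proof -
  obtain c S where c: "finite S" "\<And>k. norm (c k) \<le> D" "\<And>k. k \<in> S \<longleftrightarrow> c k \<noteq> 0"
    "\<And>k. k \<in> S \<Longrightarrow> integer_vector k" "\<And>k. k \<in> S \<Longrightarrow> norm k \<le> R"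
    "\<And>t. T t = (\<Sum>k\<in>S. c k * cis (2 * pi * (k \<bullet> t)))"
    using assms(1) by (rule trig_polyE) blast
  obtain c' S' where c': "finite S'" "\<And>k. norm (c' k) \<le> D'" "\<And>k. k \<in> S' \<longleftrightarrow> c' k \<noteq> 0"
    "\<And>k. k \<in> S' \<Longrightarrow> integer_vector k" "\<And>k. k \<in> S' \<Longrightarrow> norm k \<le> R"
    "\<And>t. T' t = (\<Sum>k\<in>S'. c' k * cis (2 * pi * (k \<bullet> t)))"
    using assms(2) by (rule trig_polyE) blast
  show ?thesis
  proof (rule trig_polyI[of "S \<union> S'" "\<lambda>k. c k + c' k"])
    show "norm (c k + c' k) \<le> D + D'" for k
      using c(2)[of k] c'(2)[of k] norm_triangle_ineq[of "c k" "c' k"] by linarith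
    show "k \<in> S \<union> S'" if "c k + c' k \<noteq> 0" for k
      using that c(3) c'(3) by auto
    then show "integer_vector k \<and> norm k \<le> R" if "c k + c' k \<noteq> 0" for k
      using that c(4,5) c'(4,5) by blast
    show "T t + T' t = (\<Sum>k\<in>S \<union> S'. (c k + c' k) * cis (2 * pi * (k \<bullet> t)))" for t
    proof -
      have "(\<Sum>k\<in>S. c k * cis (2 * pi * (k \<bullet> t))) = (\<Sum>k\<in>S \<union> S'. c k * cis (2 * pi * (k \<bullet> t)))"
        using c c' by (intro sum.mono_neutral_left) auto
      moreover have "(\<Sum>k\<in>S'. c' k * cis (2 * pi * (k \<bullet> t))) = (\<Sum>k\<in>S \<union> S'. c' k * cis (2 * pi * (k \<bullet> t)))"
        using c c' by (intro sum.mono_neutral_left) auto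
      ultimately show ?thesis
        by (simp add: c(6) c'(6) distrib_right sum.distrib)
    qed
  qed (use c c' in auto)
qed

lemma trig_poly_cmult:
  assumes "trig_poly D R T"
  shows "trig_poly (norm a * D) R (\<lambda>t. a * T t)"
proof -
  obtain c S where c: "finite S" "\<And>k. norm (c k) \<le> D" "\<And>k. k \<in> S \<longleftrightarrow> c k \<noteq> 0"
    "\<And>k. k \<in> S \<Longrightarrow> integer_vector k" "\<And>k. k \<in> S \<Longrightarrow> norm k \<le> R"
    "\<And>t. T t = (\<Sum>k\<in>S. c k * cis (2 * pi * (k \<bullet> t)))"
    using assms(1) by (rule trig_polyE) blast
  show ?thesis
    by (rule trig_polyI[of S "\<lambda>k. a * c k"])
      (use c in \<open>auto simp: norm_mult mult_left_mono sum_distrib_left mult.assoc\<close>)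
qed

lemma integer_vector_add: "integer_vector k \<Longrightarrow> integer_vector m \<Longrightarrow> integer_vector (k + m)"
  by (simp add: integer_vector_def)

lemma integer_vector_minus: "integer_vector k \<Longrightarrow> integer_vector (- k)"
  by (simp add: integer_vector_def)

lemma trig_poly_shift_coeffs:
  assumes "finite S" "\<And>t. T t = (\<Sum>k\<in>S. c k * cis (2 * pi * (k \<bullet> t)))"
  shows "cis (2 * pi * (m \<bullet> t)) * T t = (\<Sum>k\<in>(\<lambda>k. k + m) ` S. c (k - m) * cis (2 * pi * (k \<bullet> t)))"
proof -
  have "cis (2 * pi * (m \<bullet> t)) * cis (2 * pi * (k \<bullet> t)) = cis (2 * pi * ((k + m) \<bullet> t))" for k
    by (simp add: cis_mult inner_add_left algebra_simps)
  then have eq: "cis (2 * pi * (m \<bullet> t)) * (c k * cis (2 * pi * (k \<bullet> t))) = c k * cis (2 * pi * ((k + m) \<bullet> t))" for k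
    by (metis mult.left_commute)
  show ?thesis
    unfolding assms(2) sum_distrib_left eq by (subst sum.reindex) simp_all
qed

lemma trig_poly_shift:
  assumes "trig_poly D R T" "integer_vector m"
  shows "trig_poly D (R + norm m) (\<lambda>t. cis (2 * pi * (m \<bullet> t)) * T t)"
proof -
  obtain c S where c: "finite S" "\<And>k. norm (c k) \<le> D" "\<And>k. k \<in> S \<longleftrightarrow> c k \<noteq> 0"
    "\<And>k. k \<in> S \<Longrightarrow> integer_vector k" "\<And>k. k \<in> S \<Longrightarrow> norm k \<le> R"
    "\<And>t. T t = (\<Sum>k\<in>S. c k * cis (2 * pi * (k \<bullet> t)))"
    using assms(1) by (rule trig_polyE) blast
  show ?thesis
  proof (rule trig_polyI[of "(\<lambda>k. k + m) ` S" "\<lambda>k. c (k - m)"])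
    fix k assume k: "c (k - m) \<noteq> 0"
    then have "k - m \<in> S" using c(3) by simp
    then show "k \<in> (\<lambda>k. k + m) ` S" by force
    show "integer_vector k \<and> norm k \<le> R + norm m"
      using c(4,5)[OF \<open>k - m \<in> S\<close>] integer_vector_add[OF _ assms(2), of "k - m"] norm_triangle_ineq[of "k - m" m]
      by simp
  qed (use c trig_poly_shift_coeffs[OF c(1,6)] in auto)
qed

lemma trig_poly_sum:
  assumes "finite I" "\<And>i. i \<in> I \<Longrightarrow> trig_poly (D i) R (T i)" "0 \<le> R"
  shows "trig_poly (\<Sum>i\<in>I. D i) R (\<lambda>t. \<Sum>i\<in>I. T i t)"
  using assms(1,2)
proof (induction I rule: finite_induct)
  case empty
  then show ?case using trig_poly_mono[OF trig_poly_const[of 0], of 0 R] assms(3) by simp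
qed (auto intro: trig_poly_add)

text \<open>The frequencies of the three summands are disjoint, so no coefficient grows.\<close>

lemma trig_poly_riesz:
  assumes T: "trig_poly 1 R T" and m: "integer_vector m" "norm m > 2 * R"
  shows "trig_poly 1 (R + norm m) (\<lambda>t. T t * (1 - 2 * \<i> * cos (2 * pi * (m \<bullet> t))))"
proof -
  obtain c S where c: "finite S" "\<And>k. norm (c k) \<le> 1" "\<And>k. k \<in> S \<longleftrightarrow> c k \<noteq> 0"
    "\<And>k. k \<in> S \<Longrightarrow> integer_vector k" "\<And>k. k \<in> S \<Longrightarrow> norm k \<le> R"
    "\<And>t. T t = (\<Sum>k\<in>S. c k * cis (2 * pi * (k \<bullet> t)))"
    using T by (rule trig_polyE) blast
  let ?S = "S \<union> (\<lambda>k. k + m) ` S \<union> (\<lambda>k. k + (- m)) ` S"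
  let ?c = "\<lambda>k. c k - \<i> * c (k - m) - \<i> * c (k + m)"
  \<comment> \<open>If two of the three translates of the spectrum met, two frequencies of
    \<open>T\<close> would be at distance |m| or 2|m|, but any two of them are at distance at most
    2R < |m|.\<close>
  have far: "\<not> (c k \<noteq> 0 \<and> c (k - m) \<noteq> 0)" "\<not> (c k \<noteq> 0 \<and> c (k + m) \<noteq> 0)"
    "\<not> (c (k - m) \<noteq> 0 \<and> c (k + m) \<noteq> 0)" for k
  proof -
    have *: False if "u \<in> S" "v \<in> S" "norm m \<le> norm (u - v)" for u v
      using norm_triangle_ineq4[of u v] c(5)[OF that(1)] c(5)[OF that(2)] that m by simp
    show "\<not> (c k \<noteq> 0 \<and> c (k - m) \<noteq> 0)"
      using *[of k "k - m"] c(3) by auto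
    show "\<not> (c k \<noteq> 0 \<and> c (k + m) \<noteq> 0)"
      using *[of "k + m" k] c(3) by auto
    show "\<not> (c (k - m) \<noteq> 0 \<and> c (k + m) \<noteq> 0)"
      using *[of "k + m" "k - m"] c(3) by (auto simp flip: scaleR_2)
  qed
  show ?thesis
  proof (rule trig_polyI[of ?S ?c])
    show "norm (?c k) \<le> 1" for k
    proof (cases "c k = 0")
      case True
      then show ?thesis
        using far(3)[of k] c(2)[of "k - m"] c(2)[of "k + m"] by (cases "c (k - m) = 0") (auto simp: norm_mult)
    next
      case False
      then show ?thesis using far(1,2)[of k] c(2)[of k] by auto
    qed
    fix k assume "?c k \<noteq> 0"
    then have "c k \<noteq> 0 \<or> c (k - m) \<noteq> 0 \<or> c (k + m) \<noteq> 0"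
      by auto
    then have k: "k \<in> S \<or> k - m \<in> S \<or> k + m \<in> S"
      using c(3) by auto
    then show "k \<in> ?S"
      by (auto simp: image_iff intro: bexI[of _ "k - m"] bexI[of _ "k + m"])
    have "0 \<le> R" using k c(5) norm_ge_zero order.trans by blast
    show "integer_vector k \<and> norm k \<le> R + norm m"
      using k
    proof (elim disjE)
      assume "k \<in> S"
      then show ?thesis using c(4,5)[of k] by (auto intro: add_increasing2)
    next
      assume "k - m \<in> S"
      then show ?thesis
        using c(4,5)[of "k - m"] integer_vector_add[OF _ m(1), of "k - m"] norm_triangle_ineq[of "k - m" m] by simp
    next
      assume "k + m \<in> S"
      then show ?thesis
        using c(4,5)[of "k + m"] integer_vector_add[OF _ integer_vector_minus[OF m(1)], of "k + m"] norm_triangle_ineq4[of "k + m" m]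
        by simp
    qed
  next
    fix t
    have 0: "T t = (\<Sum>k\<in>?S. c k * cis (2 * pi * (k \<bullet> t)))"
      unfolding c(6) using c(1,3) by (intro sum.mono_neutral_left) auto
    have sh: "cis (2 * pi * (l \<bullet> t)) * T t = (\<Sum>k\<in>?S. c (k - l) * cis (2 * pi * (k \<bullet> t)))"
      if "(\<lambda>k. k + l) ` S \<subseteq> ?S" for l
      unfolding trig_poly_shift_coeffs[OF c(1,6)]
    proof (intro sum.mono_neutral_left that ballI)
      fix k assume "k \<in> ?S - (\<lambda>k. k + l) ` S"
      then have "k - l \<notin> S" by force
      then show "c (k - l) * cis (2 * pi * (k \<bullet> t)) = 0" using c(3) by simp
    qed (use c(1) in simp)
    have "T t * (1 - 2 * \<i> * cos (2 * pi * (m \<bullet> t))) =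
        T t - \<i> * (cis (2 * pi * (m \<bullet> t)) * T t) - \<i> * (cis (2 * pi * ((- m) \<bullet> t)) * T t)"
    proof -
      have "2 * complex_of_real (cos (2 * pi * (m \<bullet> t))) = cis (2 * pi * (m \<bullet> t)) + cis (2 * pi * ((- m) \<bullet> t))"
        by (simp add: complex_eq_iff)
      then have "2 * \<i> * complex_of_real (cos (2 * pi * (m \<bullet> t))) = \<i> * (cis (2 * pi * (m \<bullet> t)) + cis (2 * pi * ((- m) \<bullet> t)))"
        by (metis mult.assoc mult.commute)
      then show ?thesis by (simp only:) (simp add: algebra_simps)
    qed
    also have "\<dots> = (\<Sum>k\<in>?S. ?c k * cis (2 * pi * (k \<bullet> t)))"
    proof -
      have "(\<Sum>k\<in>?S. ?c k * cis (2 * pi * (k \<bullet> t))) = (\<Sum>k\<in>?S. c k * cis (2 * pi * (k \<bullet> t)))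
          - \<i> * (\<Sum>k\<in>?S. c (k - m) * cis (2 * pi * (k \<bullet> t))) - \<i> * (\<Sum>k\<in>?S. c (k + m) * cis (2 * pi * (k \<bullet> t)))"
        by (simp only: sum_subtractf sum_distrib_left left_diff_distrib mult.assoc)
      moreover have "(\<lambda>k. k + m) ` S \<subseteq> ?S" "(\<lambda>k. k + (- m)) ` S \<subseteq> ?S"
        by blast+
      ultimately show ?thesis
        using sh[of m] sh[of "- m"] unfolding 0[symmetric] by (simp only: diff_minus_eq_add)
    qed
    finally show "T t * (1 - 2 * \<i> * cos (2 * pi * (m \<bullet> t))) = (\<Sum>k\<in>?S. ?c k * cis (2 * pi * (k \<bullet> t)))" .
  qed (use c(1) in auto)
qed

lemma trig_poly_continuous_on: "trig_poly D R T \<Longrightarrow> continuous_on A T"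
  by (erule trig_polyE) (simp add: fun_eq_iff[symmetric, of T], intro continuous_intros)

lemma trig_poly_bounded:
  assumes "trig_poly D R T"
  obtains B where "B > 0" "\<And>t. norm (T t) \<le> B"
proof -
  obtain c S where c: "finite S" "\<And>t. T t = (\<Sum>k\<in>S. c k * cis (2 * pi * (k \<bullet> t)))"
    using assms(1) by (rule trig_polyE) blast
  have "norm (T t) \<le> (\<Sum>k\<in>S. norm (c k)) + 1" for t
    unfolding c(2) by (rule order.trans[OF norm_sum]) (simp add: norm_mult)
  moreover have "0 < (\<Sum>k\<in>S. norm (c k)) + 1"
    by (intro add_nonneg_pos sum_nonneg) auto
  ultimately show ?thesis by (rule that[rotated])
qed

text \<open>A trigonometric polynomial in \<open>t\<close> with absolute coefficient sum 1, equal to 1 exactly on \<open>y + \<int>\<^bsup>n\<^esup>\<close>.\<close>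

definition peak :: "real^'n::finite \<Rightarrow> real^'n \<Rightarrow> real" where
  "peak y t = (\<Sum>i\<in>UNIV. (1 + cos (2 * pi * (t $ i - y $ i))) / 2) / CARD('n)"

text \<open>Spectra may overlap here, but the coefficients of the peak have absolute sum 1: each
  coordinate contributes 1/(2n) from the constant and 1/(4n) from each of two characters, together
  1/n. So coefficients at most 1 stay at most 1, and frequencies grow by at most 1.\<close>

lemma trig_poly_peak:
  fixes T :: "real^'n::finite \<Rightarrow> complex"
  assumes T: "trig_poly 1 R T" and R: "0 \<le> R"
  shows "trig_poly 1 (R + 1) (\<lambda>t. of_real (peak y t) * T t)"
proof -
  let ?n = "real CARD('n)"
  have tp: "trig_poly (1 / ?n) (R + 1) (\<lambda>t. of_real ((1 + cos (2 * pi * (t $ i - y $ i))) / 2 / ?n) * T t)" for i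
  proof -
    let ?e = "axis i 1 :: real^'n"
    have e: "integer_vector ?e" "integer_vector (- ?e)"
      by (auto simp: integer_vector_def axis_def)
    have sh: "trig_poly 1 (R + 1) (\<lambda>t. cis (2 * pi * (m \<bullet> t)) * T t)" if "m = ?e \<or> m = - ?e" for m
      using trig_poly_shift[OF T, of m] that e by auto
    let ?a = "\<lambda>s. cis s / of_real (4 * ?n)"
    have "trig_poly (norm (1 / of_real (2 * ?n) :: complex) * 1 +
        norm (?a (- (2 * pi * y $ i))) * 1 + norm (?a (2 * pi * y $ i)) * 1) (R + 1)
        (\<lambda>t. 1 / of_real (2 * ?n) * T t + ?a (- (2 * pi * y $ i)) * (cis (2 * pi * (?e \<bullet> t)) * T t)
          + ?a (2 * pi * y $ i) * (cis (2 * pi * ((- ?e) \<bullet> t)) * T t))"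
      by (intro trig_poly_add trig_poly_cmult sh trig_poly_mono[OF T]) auto
    moreover have "norm (1 / of_real (2 * ?n) :: complex) * 1 + norm (?a (- (2 * pi * y $ i))) * 1 + norm (?a (2 * pi * y $ i)) * 1 = 1 / ?n"
      by (simp add: norm_divide norm_mult field_simps)
    moreover have "1 / of_real (2 * ?n) * T t + ?a (- (2 * pi * y $ i)) * (cis (2 * pi * (?e \<bullet> t)) * T t)
          + ?a (2 * pi * y $ i) * (cis (2 * pi * ((- ?e) \<bullet> t)) * T t) =
          of_real ((1 + cos (2 * pi * (t $ i - y $ i))) / 2 / ?n) * T t" for t
    proof -
      let ?b = "2 * pi * (t $ i - y $ i)"
      have 1: "cis (- (2 * pi * y $ i)) * cis (2 * pi * (?e \<bullet> t)) = cis ?b"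
        "cis (2 * pi * y $ i) * cis (2 * pi * ((- ?e) \<bullet> t)) = cis (- ?b)"
        by (simp_all add: cis_mult inner_axis' algebra_simps)
      have 2: "cis ?b + cis (- ?b) = 2 * of_real (cos ?b)"
        by (simp add: complex_eq_iff)
      have "1 / of_real (2 * ?n) * T t + ?a (- (2 * pi * y $ i)) * (cis (2 * pi * (?e \<bullet> t)) * T t)
          + ?a (2 * pi * y $ i) * (cis (2 * pi * ((- ?e) \<bullet> t)) * T t) =
          (2 + cis (- (2 * pi * y $ i)) * cis (2 * pi * (?e \<bullet> t)) + cis (2 * pi * y $ i) * cis (2 * pi * ((- ?e) \<bullet> t)))
          / of_real (4 * ?n) * T t"
        by (simp add: field_simps)
      also have "\<dots> = (2 + 2 * of_real (cos ?b)) / of_real (4 * ?n) * T t"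
        unfolding 1 2[symmetric] by (simp add: add.assoc)
      also have "\<dots> = of_real ((1 + cos ?b) / 2 / ?n) * T t"
        by (simp add: field_simps)
      finally show ?thesis .
    qed
    ultimately show ?thesis by simp
  qed
  have "trig_poly (\<Sum>i\<in>(UNIV::'n set). 1 / ?n) (R + 1)
      (\<lambda>t. \<Sum>i\<in>UNIV. of_real ((1 + cos (2 * pi * (t $ i - y $ i))) / 2 / ?n) * T t)"
    using R by (intro trig_poly_sum tp) auto
  moreover have "(\<Sum>i\<in>UNIV. of_real ((1 + cos (2 * pi * (t $ i - y $ i))) / 2 / ?n) * T t) = of_real (peak y t) * T t" for t
    unfolding peak_def by (simp add: sum_distrib_right sum_divide_distrib)
  ultimately show ?thesis by simp
qed

lemma trig_poly_peak_power:
  fixes y :: "real^'n::finite"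
  shows "trig_poly 1 (real m) (\<lambda>t. of_real (peak y t ^ m))"
proof (induction m)
  case 0
  then show ?case using trig_poly_const[of 1] by simp
next
  case (Suc m)
  from trig_poly_peak[OF this, of y] show ?case by (simp add: add.commute)
qed

subsection \<open>Lower bounds for the modulation space norm\<close>

text \<open>On a set of finite measure this replaces Hoelder's inequality, in the form \<open>v \<le> 1 + v\<^sup>q\<close>.\<close>

lemma nn_integral_le_Lp_norm:
  fixes h :: "real^'n::finite \<Rightarrow> complex"
  assumes [measurable]: "h \<in> borel_measurable borel" "B \<in> sets borel"
    and B: "emeasure lborel B = ennreal b" "0 \<le> b" and p: "1 \<le> p"
  shows "(\<integral>\<^sup>+x. indicator B x * ennreal (norm (h x)) \<partial>lborel) \<le> ennreal (b + 1) * Lp_norm p h"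
proof (cases "p = \<infinity>")
  case True
  let ?s = "esssup lborel (\<lambda>x. ennreal (norm (h x)))"
  have "AE x in lborel. ennreal (norm (h x)) \<le> ?s"
    by (rule esssup_AE)
  then have "(\<integral>\<^sup>+x. indicator B x * ennreal (norm (h x)) \<partial>lborel) \<le> (\<integral>\<^sup>+x. indicator B x * ?s \<partial>lborel)"
    by (intro nn_integral_mono_AE) (auto elim!: eventually_mono intro: mult_left_mono)
  also have "\<dots> = emeasure lborel B * ?s"
    by (subst nn_integral_multc) auto
  also have "\<dots> \<le> ennreal (b + 1) * ?s"
    using B by (intro mult_right_mono) (auto intro: ennreal_leI)
  finally show ?thesis
    using True by (simp add: Lp_norm_def)
next
  case False
  define q where "q = enn2real p"
  have q: "1 \<le> q"
    using p False unfolding q_def by (metis enn2real_1 enn2real_mono top.not_eq_extremum infinity_ennreal_def)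
  let ?I = "\<integral>\<^sup>+x. ennreal (norm (h x) powr q) \<partial>lborel"
  show ?thesis
  proof (cases "?I = \<infinity>")
    case True
    then show ?thesis
      using False B by (simp add: Lp_norm_def q_def[symmetric] ennreal_mult_top)
  next
    case fin: False
    define J where "J = enn2real ?I"
    have J: "?I = ennreal J" "0 \<le> J"
      using fin by (auto simp: J_def less_top)
    \<comment> \<open>\<open>a\<close> is the L^q norm, so |h| / a has q-th power of integral 1. The
      inequality v <= 1 + v^q, scaled by \<open>a\<close> and integrated over B, gives a (b + 1).
      The case J = 0 is separated because of the division.\<close>
    define a where "a = J powr (1 / q)"
    have Lp: "Lp_norm p h = ennreal a"
      using False fin J by (simp add: Lp_norm_def q_def[symmetric] a_def)
    show ?thesis
    proof (cases "J = 0")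
      case True
      then have "AE x in lborel. ennreal (norm (h x) powr q) = 0"
        using J by (subst nn_integral_0_iff_AE[symmetric]) auto
      then have "AE x in lborel. indicator B x * ennreal (norm (h x)) = 0"
        by eventually_elim (auto simp: ennreal_eq_0_iff)
      then have "(\<integral>\<^sup>+x. indicator B x * ennreal (norm (h x)) \<partial>lborel) = 0"
        by (subst nn_integral_0_iff_AE) auto
      then show ?thesis by simp
    next
      case False
      then have a: "a > 0" and aq: "a powr q = J"
        using J q by (auto simp: a_def powr_powr)
      have pt: "norm (h x) \<le> a + a / J * norm (h x) powr q" for x
      proof (cases "norm (h x) \<le> a")
        case True
        moreover have "0 \<le> a / J * norm (h x) powr q"
          using a J by simp
        ultimately show ?thesis by linarith
      next
        case False
        define v where "v = norm (h x) / a"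
        have v: "v \<ge> 1" "norm (h x) = a * v"
          using a False by (auto simp: v_def)
        have "v \<le> v powr q"
          using v q powr_mono[of 1 q v] by simp
        then have "a * v \<le> a * v powr q"
          using a by simp
        also have "\<dots> = a / J * norm (h x) powr q"
          unfolding v(2) using a v aq by (subst powr_mult) (auto simp: field_simps)
        finally show ?thesis using a v by simp
      qed
      have "(\<integral>\<^sup>+x. indicator B x * ennreal (norm (h x)) \<partial>lborel) \<le>
          (\<integral>\<^sup>+x. ennreal a * indicator B x + ennreal (a / J) * ennreal (norm (h x) powr q) \<partial>lborel)"
      proof (intro nn_integral_mono)
        fix x
        have "ennreal (norm (h x)) \<le> ennreal a + ennreal (a / J) * ennreal (norm (h x) powr q)"
          using pt[of x] a J by (simp add: ennreal_leI flip: ennreal_plus ennreal_mult)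
        then show "indicator B x * ennreal (norm (h x)) \<le>
            ennreal a * indicator B x + ennreal (a / J) * ennreal (norm (h x) powr q)"
          by (auto split: split_indicator)
      qed
      also have "\<dots> = ennreal a * emeasure lborel B + ennreal (a / J) * ?I"
        by (simp add: nn_integral_add nn_integral_cmult)
      also have "\<dots> = ennreal (a * b + a / J * J)"
        unfolding B(1) J(1) using a J(2) B(2) by (subst ennreal_plus) (auto simp: ennreal_mult[symmetric])
      also have "\<dots> = ennreal (b + 1) * ennreal a"
        using a B(2) False by (simp add: algebra_simps flip: ennreal_mult)
      finally show ?thesis unfolding Lp .
    qed
  qed
qed

section \<open>The kernel dual to averaging the transform over a box\<close>

context window
begin

text \<open>The superposition of the conjugated, translated and modulated windows over (x, w) in B
  times Q. By Fubini, pairing a bounded function with it integrates the short time Fourier transform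
  over that set.\<close>

definition kernel :: "(real^'n) set \<Rightarrow> (real^'n) set \<Rightarrow> real^'n \<Rightarrow> complex" where
  "kernel B Q t = (\<integral>y. indicator (B \<times> Q) y *\<^sub>R (cnj (g (t - fst y)) * cis (- (2 * pi * (snd y \<bullet> t)))) \<partial>lborel)"

lemma fst_snd_measurable [measurable]:
  "(fst :: (real^'n) \<times> (real^'n) \<Rightarrow> _) \<in> borel_measurable borel"
  "(snd :: (real^'n) \<times> (real^'n) \<Rightarrow> _) \<in> borel_measurable borel"
  by (intro borel_measurable_continuous_onI continuous_intros)+

lemma Times_measurable:
  "B \<in> sets borel \<Longrightarrow> Q \<in> sets borel \<Longrightarrow> B \<times> Q \<in> sets (borel :: ((real^'n) \<times> (real^'n)) measure)"
  unfolding borel_prod[symmetric] by (rule pair_measureI)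

lemma emeasure_Times:
  "B \<in> sets borel \<Longrightarrow> Q \<in> sets borel \<Longrightarrow>
   emeasure (lborel :: ((real^'n) \<times> (real^'n)) measure) (B \<times> Q) = emeasure lborel B * emeasure lborel Q"
  unfolding lborel_prod[symmetric] by (rule lborel.emeasure_pair_measure_Times) auto

text \<open>By Tonelli with t innermost, the integral is at most M times the L1 norm of the window
  times the measure of B times Q.\<close>

lemma kernel_pair_integrable:
  assumes BQ [measurable]: "B \<in> sets borel" "Q \<in> sets borel"
    and fin: "emeasure lborel B < \<infinity>" "emeasure lborel Q < \<infinity>"
    and H [measurable]: "H \<in> borel_measurable borel" and M: "\<And>t. norm (H t) \<le> M"
  shows "integrable (lborel \<Otimes>\<^sub>M lborel) (\<lambda>(t, y). indicator (B \<times> Q) y *\<^sub>R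
     (H t * cnj (g (t - fst y)) * cis (- (2 * pi * (snd y \<bullet> t)))))"
proof (rule integrableI_bounded)
  note Times_measurable[OF BQ, measurable]
  let ?f = "\<lambda>(t, y). indicator (B \<times> Q) y *\<^sub>R (H t * cnj (g (t - fst y)) * cis (- (2 * pi * (snd y \<bullet> t))))"
  let ?G = "\<integral>\<^sup>+t. ennreal (norm (g t)) \<partial>lborel"
  show meas: "?f \<in> borel_measurable (lborel \<Otimes>\<^sub>M lborel)"
    by measurable
  have G: "?G < \<infinity>"
    using schwartz_integrable[OF g_schwartz] by (simp add: integrable_iff_bounded)
  have "(\<integral>\<^sup>+z. ennreal (norm (?f z)) \<partial>(lborel \<Otimes>\<^sub>M lborel)) =
      (\<integral>\<^sup>+y. \<integral>\<^sup>+t. ennreal (norm (?f (t, y))) \<partial>lborel \<partial>lborel)"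
    using meas by (subst lborel_pair.nn_integral_snd) auto
  also have "\<dots> \<le> (\<integral>\<^sup>+y. indicator (B \<times> Q) y * (ennreal M * ?G) \<partial>lborel)"
  proof (intro nn_integral_mono)
    fix y :: "(real^'n) \<times> (real^'n)"
    have "(\<integral>\<^sup>+t. ennreal (norm (?f (t, y))) \<partial>lborel) \<le>
        (\<integral>\<^sup>+t. indicator (B \<times> Q) y * (ennreal M * ennreal (norm (g (t - fst y)))) \<partial>lborel)"
    proof (intro nn_integral_mono)
      fix t
      have "norm (H t) * norm (g (t - fst y)) \<le> M * norm (g (t - fst y))"
        using M by (intro mult_right_mono) auto
      moreover have "0 \<le> M" using M norm_ge_zero order.trans by blast
      ultimately show "ennreal (norm (?f (t, y))) \<le> indicator (B \<times> Q) y * (ennreal M * ennreal (norm (g (t - fst y))))"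
        by (auto split: split_indicator simp: norm_mult ennreal_leI simp flip: ennreal_mult)
    qed
    also have "\<dots> = indicator (B \<times> Q) y * (ennreal M * (\<integral>\<^sup>+t. ennreal (norm (g (t + (- fst y)))) \<partial>lborel))"
      by (simp add: nn_integral_cmult)
    also have "(\<integral>\<^sup>+t. ennreal (norm (g (t + (- fst y)))) \<partial>lborel) = ?G"
      by (rule nn_integral_translate) measurable
    finally show "(\<integral>\<^sup>+t. ennreal (norm (?f (t, y))) \<partial>lborel) \<le> indicator (B \<times> Q) y * (ennreal M * ?G)" .
  qed
  also have "\<dots> = emeasure lborel (B \<times> Q) * (ennreal M * ?G)"
    by (subst nn_integral_multc) (auto intro!: nn_integral_indicator)
  also have "\<dots> < \<infinity>"
    using G fin by (simp add: emeasure_Times BQ ennreal_mult_less_top)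
  finally show "(\<integral>\<^sup>+z. ennreal (norm (?f z)) \<partial>(lborel \<Otimes>\<^sub>M lborel)) < \<infinity>" .
qed

lemma kernel_integrable:
  assumes "B \<in> sets borel" "Q \<in> sets borel" "emeasure lborel B < \<infinity>" "emeasure lborel Q < \<infinity>"
  shows "integrable lborel (kernel B Q)"
proof -
  have "integrable lborel (\<lambda>t. \<integral>y. indicator (B \<times> Q) y *\<^sub>R
     (1 * cnj (g (t - fst y)) * cis (- (2 * pi * (snd y \<bullet> t)))) \<partial>lborel)"
    using lborel_pair.integrable_fst'[OF kernel_pair_integrable[OF assms, of "\<lambda>t. 1" 1]] by simp
  then show ?thesis by (simp add: kernel_def[abs_def])
qed

lemma integral_mult_kernel:
  assumes BQ: "B \<in> sets borel" "Q \<in> sets borel" "emeasure lborel B < \<infinity>" "emeasure lborel Q < \<infinity>"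
    and H: "H \<in> borel_measurable borel" "\<And>t. norm (H t) \<le> M"
  shows "(\<integral>t. H t * kernel B Q t \<partial>lborel) = (\<integral>y. indicator (B \<times> Q) y *\<^sub>R V H (fst y) (snd y) \<partial>lborel)"
    and "integrable lborel (\<lambda>y. indicator (B \<times> Q) y *\<^sub>R V H (fst y) (snd y))"
proof -
  let ?f = "\<lambda>t y. indicator (B \<times> Q) y *\<^sub>R (H t * cnj (g (t - fst y)) * cis (- (2 * pi * (snd y \<bullet> t))))"
  note int = kernel_pair_integrable[OF BQ H]
  have 1: "H t * kernel B Q t = (\<integral>y. ?f t y \<partial>lborel)" for t
    unfolding kernel_def integral_mult_right_zero[symmetric] by (simp add: mult.assoc)
  have 2: "indicator (B \<times> Q) y *\<^sub>R V H (fst y) (snd y) = (\<integral>t. ?f t y \<partial>lborel)" for y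
    by (simp add: V_def fourier_def)
  show "(\<integral>t. H t * kernel B Q t \<partial>lborel) = (\<integral>y. indicator (B \<times> Q) y *\<^sub>R V H (fst y) (snd y) \<partial>lborel)"
    unfolding 1 2 by (rule lborel_pair.Fubini_integral[OF int, symmetric])
  show "integrable lborel (\<lambda>y. indicator (B \<times> Q) y *\<^sub>R V H (fst y) (snd y))"
    unfolding 2 by (rule lborel_pair.integrable_snd[OF int])
qed

lemma kernel_continuous_on:
  assumes "B \<in> sets borel" "Q \<in> sets borel" "emeasure lborel B < \<infinity>" "emeasure lborel Q < \<infinity>"
  shows "continuous_on A (kernel B Q)"
proof -
  note Times_measurable[OF assms(1,2), measurable]
  obtain C where C: "C > 0" "\<And>x. norm (g x) \<le> C"
    using schwartz_bound[OF g_schwartz, where k = 0 and \<beta> = "[]"] by auto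
  have gc: "isCont g x" for x
    using schwartz_continuous_on[OF g_schwartz, of UNIV] continuous_on_eq_continuous_at by blast
  have "isCont (kernel B Q) t" for t
    unfolding continuous_at_sequentially
  proof (intro allI impI)
    fix s :: "nat \<Rightarrow> real^'n" assume s: "s \<longlonglongrightarrow> t"
    show "(kernel B Q \<circ> s) \<longlonglongrightarrow> kernel B Q t"
      unfolding kernel_def o_def
    proof (rule integral_dominated_convergence[where w = "\<lambda>y. C * indicator (B \<times> Q) y"])
      have "emeasure lborel (B \<times> Q) < \<infinity>"
        using assms by (simp add: emeasure_Times ennreal_mult_less_top)
      then show "integrable lborel (\<lambda>y. C * indicator (B \<times> Q) y)"
        by (intro integrable_mult_right integrable_real_indicator) auto
      show "AE y in lborel. (\<lambda>i. indicator (B \<times> Q) y *\<^sub>R (cnj (g (s i - fst y)) * cis (- (2 * pi * (snd y \<bullet> s i))))) \<longlonglongrightarrow>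
          indicator (B \<times> Q) y *\<^sub>R (cnj (g (t - fst y)) * cis (- (2 * pi * (snd y \<bullet> t))))"
        by (intro AE_I2 tendsto_intros tendsto_cnj isCont_tendsto_compose[OF gc] isCont_tendsto_compose[of _ cis] s)
      show "AE y in lborel. norm (indicator (B \<times> Q) y *\<^sub>R (cnj (g (s i - fst y)) * cis (- (2 * pi * (snd y \<bullet> s i))))) \<le>
          C * indicator (B \<times> Q) y" for i
        using C by (intro AE_I2) (auto simp: norm_mult split: split_indicator)
    qed measurable
  qed
  then show ?thesis by (simp add: continuous_at_imp_continuous_on)
qed

text \<open>Multiplication by \<open>T\<close> replaces the transform at w by a combination of its
  values at w - k with coefficients at most 1. Integrated over the open unit cube, the terms live on
  the disjoint cubes Q - k, so their sum is at most one integral over all w. The resulting bound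
  depends on h and B but neither on R nor on the number of frequencies.\<close>

lemma modulation_function_pairing_bound:
  assumes h: "h \<in> modulation_functions g p" and p: "1 \<le> p" and M: "\<And>t. norm (h t) \<le> M"
    and B [measurable]: "B \<in> sets borel" and b: "emeasure lborel B = ennreal b" "0 \<le> b"
  obtains C where "\<And>R T. trig_poly 1 R T \<Longrightarrow> norm (\<integral>t. h t * T t * kernel B (box 0 1) t \<partial>lborel) \<le> C"
proof -
  let ?Q = "box 0 1 :: (real^'n) set"
  have h_cont: "continuous_on UNIV h"
    using h by (simp add: modulation_functions_def)
  then have [measurable]: "h \<in> borel_measurable borel"
    by (rule borel_measurable_continuous_onI)
  note V_measurable[of h, measurable]
  \<comment> \<open>The local L1 norm in x over B; it is controlled by the L^p norm because B has
    finite measure, and this is where p disappears from the argument.\<close>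
  define A where "A = (\<lambda>w. \<integral>\<^sup>+x. indicator B x * ennreal (norm (V h x w)) \<partial>lborel)"
  have [measurable]: "(\<lambda>y. indicator B (fst y) * ennreal (norm (V h (fst y) (snd y)))) \<in> borel_measurable (borel \<Otimes>\<^sub>M borel)"
    by measurable
  have A_meas [measurable]: "A \<in> borel_measurable borel"
  proof -
    have *: "(\<lambda>y. indicator B (snd y) * ennreal (norm (V h (snd y) (fst y)))) \<in> borel_measurable (borel \<Otimes>\<^sub>M borel)"
      using measurable_compose[OF measurable_pair_swap'[of borel borel] V_measurable[of h]]
      by (simp add: split_beta) measurable
    then have "(\<lambda>y. indicator B (snd y) * ennreal (norm (V h (snd y) (fst y)))) \<in> borel_measurable (borel \<Otimes>\<^sub>M lborel)"
      by simp
    from lborel.borel_measurable_nn_integral_fst[OF this] show ?thesis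
      by (simp add: A_def)
  qed
  have norm_fin: "(\<integral>\<^sup>+w. Lp_norm p (\<lambda>x. V h x w) \<partial>lborel) < \<infinity>"
    using h by (simp add: modulation_functions_def modulation_space_def modulation_norm_def stft_eq_V)
  have A_fin: "(\<integral>\<^sup>+w. A w \<partial>lborel) < \<infinity>"
  proof -
    have "A w * ennreal (1 / (b + 1)) \<le> Lp_norm p (\<lambda>x. V h x w)" for w
    proof -
      have "A w \<le> ennreal (b + 1) * Lp_norm p (\<lambda>x. V h x w)"
        unfolding A_def using b p by (intro nn_integral_le_Lp_norm V_measurable_fst) auto
      then have "A w * ennreal (1 / (b + 1)) \<le> ennreal (b + 1) * Lp_norm p (\<lambda>x. V h x w) * ennreal (1 / (b + 1))"
        by (intro mult_right_mono) auto
      also have "\<dots> = (ennreal (b + 1) * ennreal (1 / (b + 1))) * Lp_norm p (\<lambda>x. V h x w)"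
        by (simp add: ac_simps)
      also have "\<dots> = Lp_norm p (\<lambda>x. V h x w)"
      proof -
        have "ennreal (b + 1) * ennreal (1 / (b + 1)) = 1"
          using b by (simp del: ennreal_plus flip: ennreal_mult)
        then show ?thesis by simp
      qed
      finally show ?thesis .
    qed
    then have "(\<integral>\<^sup>+w. A w * ennreal (1 / (b + 1)) \<partial>lborel) \<le> (\<integral>\<^sup>+w. Lp_norm p (\<lambda>x. V h x w) \<partial>lborel)"
      by (intro nn_integral_mono)
    then have "(\<integral>\<^sup>+w. A w \<partial>lborel) * ennreal (1 / (b + 1)) < \<infinity>"
      using norm_fin by (simp add: nn_integral_multc le_less_trans)
    moreover have "ennreal (1 / (b + 1)) > 0"
      using b by simp
    ultimately show ?thesis
      by (auto simp: ennreal_mult_less_top)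
  qed
  have Qsets [measurable]: "?Q \<in> sets borel"
    by simp
  have fin: "emeasure lborel B < \<infinity>" "emeasure lborel ?Q < \<infinity>"
    using b emeasure_lborel_box_finite[of 0 "1 :: real^'n"] by auto
  have main: "ennreal (norm (\<integral>t. h t * T t * kernel B ?Q t \<partial>lborel)) \<le> (\<integral>\<^sup>+w. A w \<partial>lborel)"
    if T: "trig_poly 1 R T" for R T
  proof -
    obtain c S where c: "finite S" "\<And>k. norm (c k) \<le> 1" "\<And>k. k \<in> S \<longleftrightarrow> c k \<noteq> 0"
      "\<And>k. k \<in> S \<Longrightarrow> integer_vector k" "\<And>k. k \<in> S \<Longrightarrow> norm k \<le> R"
      "\<And>t. T t = (\<Sum>k\<in>S. c k * cis (2 * pi * (k \<bullet> t)))"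
      using T by (rule trig_polyE) blast
    obtain BT where BT: "BT > 0" "\<And>t. norm (T t) \<le> BT"
      using trig_poly_bounded[OF T] by blast
    have [measurable]: "T \<in> borel_measurable borel"
      using trig_poly_continuous_on[OF T] by (rule borel_measurable_continuous_onI)
    have hT: "norm (h t * T t) \<le> M * BT" for t
      unfolding norm_mult using M[of t] BT(2)[of t] order.trans[OF norm_ge_zero M[of t]] by (intro mult_mono) auto
    have VT: "V (\<lambda>t. h t * T t) x w = (\<Sum>k\<in>S. c k * V h x (w - k))" for x w
    proof -
      have int: "integrable lborel (\<lambda>t. h t * cnj (g (t - x)) * cis (- (2 * pi * (v \<bullet> t))))" for v
        using M by (intro fourier_integrable integrable_mult_g[of _ M]) auto
      have "cis (2 * pi * (k \<bullet> t)) * cis (- (2 * pi * (w \<bullet> t))) = cis (- (2 * pi * ((w - k) \<bullet> t)))" for t k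
        by (simp add: cis_mult inner_diff_left algebra_simps)
      then have "h t * T t * cnj (g (t - x)) * cis (- (2 * pi * (w \<bullet> t))) =
          (\<Sum>k\<in>S. c k * (h t * cnj (g (t - x)) * cis (- (2 * pi * ((w - k) \<bullet> t)))))" for t
        unfolding c(6) sum_distrib_left sum_distrib_right
        by (intro sum.cong refl) (metis (no_types, opaque_lifting) mult.assoc mult.left_commute)
      then have "V (\<lambda>t. h t * T t) x w =
          (\<integral>t. (\<Sum>k\<in>S. c k * (h t * cnj (g (t - x)) * cis (- (2 * pi * ((w - k) \<bullet> t))))) \<partial>lborel)"
        unfolding V_def fourier_def by simp
      also have "\<dots> = (\<Sum>k\<in>S. c k * V h x (w - k))"
        unfolding V_def fourier_def using int by (subst Bochner_Integration.integral_sum) auto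
      finally show ?thesis .
    qed
    have int: "integrable lborel (\<lambda>y. indicator (B \<times> ?Q) y *\<^sub>R V (\<lambda>t. h t * T t) (fst y) (snd y))"
      by (rule integral_mult_kernel(2)[OF B Qsets fin _ hT]) measurable
    have "ennreal (norm (\<integral>t. h t * T t * kernel B ?Q t \<partial>lborel)) =
        ennreal (norm (\<integral>y. indicator (B \<times> ?Q) y *\<^sub>R V (\<lambda>t. h t * T t) (fst y) (snd y) \<partial>lborel))"
      by (subst integral_mult_kernel(1)[OF B Qsets fin _ hT]) measurable
    also have "\<dots> \<le> (\<integral>\<^sup>+y. ennreal (norm (indicator (B \<times> ?Q) y *\<^sub>R V (\<lambda>t. h t * T t) (fst y) (snd y))) \<partial>lborel)"
      by (rule integral_norm_bound_ennreal[OF int])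
    also have "\<dots> \<le> (\<integral>\<^sup>+y. (\<Sum>k\<in>S. indicator ?Q (snd y) * (indicator B (fst y) * ennreal (norm (V h (fst y) (snd y - k))))) \<partial>lborel)"
    proof (intro nn_integral_mono)
      fix y :: "(real^'n) \<times> (real^'n)"
      have "norm (V (\<lambda>t. h t * T t) (fst y) (snd y)) \<le> (\<Sum>k\<in>S. norm (V h (fst y) (snd y - k)))"
        unfolding VT using c(2) by (intro order.trans[OF norm_sum] sum_mono) (auto simp: norm_mult intro: mult_left_le_one_le)
      then have "ennreal (norm (V (\<lambda>t. h t * T t) (fst y) (snd y))) \<le> (\<Sum>k\<in>S. ennreal (norm (V h (fst y) (snd y - k))))"
        by (simp add: sum_ennreal ennreal_leI)
      then show "ennreal (norm (indicator (B \<times> ?Q) y *\<^sub>R V (\<lambda>t. h t * T t) (fst y) (snd y))) \<le>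
         (\<Sum>k\<in>S. indicator ?Q (snd y) * (indicator B (fst y) * ennreal (norm (V h (fst y) (snd y - k)))))"
        by (cases y) (auto split: split_indicator)
    qed
    also have "\<dots> = (\<Sum>k\<in>S. \<integral>\<^sup>+w. indicator ?Q w * A (w - k) \<partial>lborel)"
    proof -
      have m: "(\<lambda>y. indicator ?Q (snd y) * (indicator B (fst y) * ennreal (norm (V h (fst y) (snd y - k))))) \<in>
          borel_measurable (lborel \<Otimes>\<^sub>M lborel)" for k
      proof -
        have "(\<lambda>y. V h (fst y) (snd y - k)) \<in> borel_measurable (borel \<Otimes>\<^sub>M borel)"
          unfolding V_def fourier_def by measurable
        then show ?thesis by measurable
      qed
      have "(\<integral>\<^sup>+y. indicator ?Q (snd y) * (indicator B (fst y) * ennreal (norm (V h (fst y) (snd y - k)))) \<partial>lborel) =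
          (\<integral>\<^sup>+w. indicator ?Q w * A (w - k) \<partial>lborel)" for k
      proof -
        have m1: "(\<lambda>x. indicator B x * ennreal (norm (V h x w))) \<in> borel_measurable lborel" for w
          using V_measurable_fst[of h w] by measurable
        show ?thesis
          unfolding lborel_prod[symmetric]
          by (subst lborel_pair.nn_integral_snd[symmetric, OF m]) (simp add: A_def nn_integral_cmult[OF m1])
      qed
      moreover have "(\<lambda>y. indicator ?Q (snd y) * (indicator B (fst y) * ennreal (norm (V h (fst y) (snd y - k))))) \<in>
          borel_measurable lborel" for k
        using m[of k] by (simp only: lborel_prod)
      ultimately show ?thesis
        by (subst nn_integral_sum) auto
    qed
    also have "\<dots> = (\<Sum>k\<in>S. \<integral>\<^sup>+w. indicator ?Q (w + k) * A w \<partial>lborel)"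
    proof (intro sum.cong refl)
      fix k
      have "(\<integral>\<^sup>+w. indicator ?Q w * A (w - k) \<partial>lborel) = (\<integral>\<^sup>+w. indicator ?Q (w + k) * A (w + k - k) \<partial>lborel)"
        by (rule nn_integral_translate[symmetric, where f = "\<lambda>w. indicator ?Q w * A (w - k)"]) measurable
      then show "(\<integral>\<^sup>+w. indicator ?Q w * A (w - k) \<partial>lborel) = (\<integral>\<^sup>+w. indicator ?Q (w + k) * A w \<partial>lborel)"
        by simp
    qed
    also have "\<dots> = (\<integral>\<^sup>+w. (\<Sum>k\<in>S. indicator ?Q (w + k) * A w) \<partial>lborel)"
      by (subst nn_integral_sum) auto
    also have "\<dots> \<le> (\<integral>\<^sup>+w. A w \<partial>lborel)"
    proof (intro nn_integral_mono)
      fix w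
      \<comment> \<open>Two points of the open unit cube differ by less than 1 in each coordinate,
        and distinct integer vectors do not.\<close>
      have uniq: "k = k'" if "k \<in> S" "k' \<in> S" "w + k \<in> ?Q" "w + k' \<in> ?Q" for k k'
      proof -
        have "k $ i = k' $ i" for i
        proof -
          have "k $ i - k' $ i \<in> \<int>" "\<bar>k $ i - k' $ i\<bar> < 1"
            using c(4)[OF that(1)] c(4)[OF that(2)] that(3,4)
            by (auto simp: integer_vector_def mem_box_cart abs_less_iff dest!: spec[of _ i])
          then have "k $ i - k' $ i = 0"
            using Ints_nonzero_abs_less1 by blast
          then show ?thesis by simp
        qed
        then show ?thesis by (simp add: vec_eq_iff)
      qed
      have "(\<Sum>k\<in>S. indicator ?Q (w + k) :: ennreal) \<le> 1"
      proof (cases "\<exists>k\<in>S. w + k \<in> ?Q")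
        case True
        then obtain k where k: "k \<in> S" "w + k \<in> ?Q" by blast
        have "(\<Sum>k\<in>S. indicator ?Q (w + k) :: ennreal) = (\<Sum>l\<in>{k}. indicator ?Q (w + l))"
          using c(1) k uniq by (intro sum.mono_neutral_right) (auto split: split_indicator)
        then show ?thesis using k by simp
      next
        case False
        then show ?thesis by simp
      qed
      then have "(\<Sum>k\<in>S. indicator ?Q (w + k)) * A w \<le> 1 * A w"
        by (intro mult_right_mono) auto
      then show "(\<Sum>k\<in>S. indicator ?Q (w + k) * A w) \<le> A w"
        by (simp add: sum_distrib_right)
    qed
    finally show ?thesis .
  qed
  show ?thesis
  proof (rule that[of "enn2real (\<integral>\<^sup>+w. A w \<partial>lborel)"])
    fix R and T :: "real^'n \<Rightarrow> complex" assume "trig_poly 1 R T"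
    from main[OF this] A_fin show "norm (\<integral>t. h t * T t * kernel B ?Q t \<partial>lborel) \<le> enn2real (\<integral>\<^sup>+w. A w \<partial>lborel)"
      by (metis enn2real_ennreal enn2real_mono infinity_ennreal_def norm_ge_zero)
  qed
qed

end

subsection \<open>Concentration\<close>

text \<open>On \<open>A\<close> the integrand has nonnegative real part and may be discarded except
  on \<open>A'\<close>, where f and u are both bounded below; off \<open>A\<close> it is at most
  q1^N |f|. With q1 < q2 the first contribution wins exponentially. It serves for Gaussians, for
  powers of a cosine and for powers of \<open>peak\<close>.\<close>

lemma integral_power_concentration:
  fixes f :: "'a::euclidean_space \<Rightarrow> complex" and u :: "'a \<Rightarrow> real"
  assumes f: "integrable lborel f" and u: "u \<in> borel_measurable borel" "\<And>t. 0 \<le> u t" "\<And>t. u t \<le> 1"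
    and A: "\<And>t. t \<in> A \<Longrightarrow> 0 \<le> Re (f t)"
    and out: "\<And>t. t \<notin> A \<Longrightarrow> f t = 0 \<or> u t \<le> q1"
    and A': "A' \<subseteq> A" "A' \<in> sets borel" "emeasure lborel A' = ennreal v" "0 \<le> v"
    and c: "\<And>t. t \<in> A' \<Longrightarrow> c \<le> Re (f t)" "0 \<le> c" and q2: "\<And>t. t \<in> A' \<Longrightarrow> q2 \<le> u t" "0 \<le> q2" and q1: "0 \<le> q1"
  shows "c * v * q2 ^ N - q1 ^ N * (\<integral>t. norm (f t) \<partial>lborel) \<le> Re (\<integral>t. f t * of_real (u t ^ N) \<partial>lborel)"
proof -
  have int: "integrable lborel (\<lambda>t. f t * of_real (u t ^ N))"
    using u by (intro integrable_mult_bounded[OF f, of _ 1]) (auto simp: norm_power intro!: power_le_one)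
  have intA: "integrable lborel (\<lambda>t. c * q2 ^ N * indicator A' t :: real)"
    using A' by (intro integrable_mult_right integrable_real_indicator) auto
  have intf: "integrable lborel (\<lambda>t. q1 ^ N * norm (f t))"
    using f by simp
  have m: "measure lborel A' = v"
    using A' by (simp add: measure_def)
  have "c * v * q2 ^ N - q1 ^ N * (\<integral>t. norm (f t) \<partial>lborel) =
      (\<integral>t. c * q2 ^ N * indicator A' t - q1 ^ N * norm (f t) \<partial>lborel)"
    using intA intf A' by (simp add: m)
  also have "\<dots> \<le> (\<integral>t. Re (f t * of_real (u t ^ N)) \<partial>lborel)"
  proof (rule Bochner_Integration.integral_mono)
    show "integrable lborel (\<lambda>t. c * q2 ^ N * indicator A' t - q1 ^ N * norm (f t))"
      by (rule Bochner_Integration.integrable_diff[OF intA intf])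
    show "integrable lborel (\<lambda>t. Re (f t * of_real (u t ^ N)))"
      by (rule integrable_Re[OF int])
    fix t
    have pw: "0 \<le> u t ^ N" "0 \<le> q1 ^ N * norm (f t)" using u q1 by auto
    show "c * q2 ^ N * indicator A' t - q1 ^ N * norm (f t) \<le> Re (f t * of_real (u t ^ N))"
    proof (cases "t \<in> A")
      case True
      have "c * q2 ^ N * indicator A' t \<le> Re (f t) * u t ^ N"
      proof (cases "t \<in> A'")
        case True
        have "c * q2 ^ N \<le> Re (f t) * u t ^ N"
          using c(1)[OF True] c(2) q2(1)[OF True] q2(2) by (intro mult_mono power_mono) auto
        then show ?thesis using True by simp
      next
        case False
        then show ?thesis using A[OF True] pw by simp
      qed
      then show ?thesis using pw by simp
    next
      case False
      then have "norm (f t) * u t ^ N \<le> norm (f t) * q1 ^ N"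
        using out[of t] u by (cases "f t = 0") (auto intro!: mult_left_mono power_mono)
      moreover have "- (norm (f t) * u t ^ N) \<le> Re (f t) * u t ^ N"
        using abs_Re_le_cmod[of "f t"] mult_right_mono[of "- norm (f t)" "Re (f t)" "u t ^ N"] pw by simp
      moreover have "t \<notin> A'" using False A' by blast
      ultimately show ?thesis by (simp add: mult.commute)
    qed
  qed
  also have "\<dots> = Re (\<integral>t. f t * of_real (u t ^ N) \<partial>lborel)"
    using int by (rule integral_Re)
  finally show ?thesis .
qed

lemma power_dominated_contradiction:
  fixes a q1 q2 C :: real
  assumes "0 \<le> q1" "q1 < q2" "0 < a" "\<And>N::nat. a * q2 ^ N \<le> q1 ^ N * C"
  shows False
proof -
  have "(\<lambda>N. (q1 / q2) ^ N * C) \<longlonglongrightarrow> 0 * C"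
    using assms by (intro tendsto_mult tendsto_const LIMSEQ_realpow_zero) auto
  moreover have "a \<le> (q1 / q2) ^ N * C" for N
    using assms(1-3) assms(4)[of N] by (simp add: power_divide field_simps)
  ultimately have "a \<le> 0 * C"
    by (intro LIMSEQ_le_const) auto
  then show False using assms by simp
qed

context window
begin

text \<open>For t near 0 and x near -a, where g a is not 0, the integrand is close to the conjugate
  of g a. The unimodular \<zeta> turns that value into r > 0, and the deviation is at most r/4 from
  the window plus r/4 from the character.\<close>

lemma kernel_positive:
  obtains B \<zeta> \<rho> c b where "B \<in> sets borel" "emeasure lborel B = ennreal b" "0 \<le> b" "norm \<zeta> = 1" "\<rho> > 0" "c > 0"
    "\<And>t. norm t \<le> \<rho> \<Longrightarrow> c \<le> Re (\<zeta> * kernel B (box 0 1) t)"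
proof -
  let ?Q = "box 0 1 :: (real^'n) set"
  obtain a where a: "g a \<noteq> 0" using g_nonzero by auto
  define r where "r = norm (g a)"
  have r: "r > 0" using a by (simp add: r_def)
  have "isCont g a"
    using schwartz_continuous_on[OF g_schwartz, of UNIV] continuous_on_eq_continuous_at by blast
  then obtain d1 where d1: "d1 > 0" "\<And>u. norm (u - a) < d1 \<Longrightarrow> norm (g u - g a) < r / 4"
    using r unfolding continuous_at_eps_delta dist_norm by (metis zero_less_divide_iff zero_less_numeral)
  have "isCont cis 0"
    using continuous_on_eq_continuous_at[OF open_UNIV, of cis] by (auto intro: continuous_intros)
  then obtain d2 where d2: "d2 > 0" "\<And>s. \<bar>s\<bar> < d2 \<Longrightarrow> norm (cis s - 1) < 1 / 4"
    unfolding continuous_at_eps_delta dist_norm by (metis cis_zero diff_zero real_norm_def zero_less_divide_1_iff zero_less_numeral)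
  \<comment> \<open>With |t| and |x + a| at most \<rho>, the argument of g is within 2\<rho> < d1 of
    a. On the unit cube |w| is at most n, so the phase 2 pi w.t is at most d2/2.\<close>
  define \<rho> where "\<rho> = min (d1 / 4) (d2 / (4 * pi * real CARD('n)))"
  have \<rho>: "\<rho> > 0" using d1 d2 by (simp add: \<rho>_def)
  define B where "B = cball (- a) \<rho>"
  define \<zeta> where "\<zeta> = g a / of_real r"
  have \<zeta>: "norm \<zeta> = 1" "\<zeta> * cnj (g a) = of_real r"
    using r by (simp_all add: \<zeta>_def norm_divide r_def complex_norm_square[symmetric] power2_eq_square)
  have B: "B \<in> sets borel" by (simp add: B_def)
  obtain b where b: "emeasure lborel B = ennreal b" "0 \<le> b"
    using emeasure_lborel_cball_finite[of "- a" \<rho>] unfolding B_def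
    by (metis ennreal_cases infinity_ennreal_def less_irrefl)
  have "b > 0"
    using content_cball_pos[OF \<rho>, of "- a"] b unfolding B_def[symmetric] measure_def by simp
  have Q: "?Q \<in> sets borel" "emeasure lborel ?Q = 1"
  proof -
    have "1 \<bullet> b = 1" if "b \<in> Basis" for b :: "real^'n"
      using that by (auto simp: Basis_vec_axis inner_axis)
    then show "emeasure lborel ?Q = 1"
      by (simp add: emeasure_lborel_box_eq)
  qed simp
  have m: "emeasure lborel (B \<times> ?Q) = ennreal b"
    using emeasure_Times[OF B Q(1)] b Q by simp
  have sets: "B \<times> ?Q \<in> sets borel"
    using Times_measurable[OF B Q(1)] .
  show ?thesis
  proof (rule that[of B b \<zeta> \<rho> "r / 2 * b"])
    show "r / 2 * b \<le> Re (\<zeta> * kernel B ?Q t)" if t: "norm t \<le> \<rho>" for t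
    proof -
      let ?k = "\<lambda>y. cnj (g (t - fst y)) * cis (- (2 * pi * (snd y \<bullet> t)))"
      have pt: "r / 2 \<le> Re (\<zeta> * ?k y)" if y: "y \<in> B \<times> ?Q" for y
      proof -
        obtain x w where xw: "y = (x, w)" "norm (x + a) \<le> \<rho>" "w \<in> ?Q"
          using y by (cases y) (auto simp: B_def dist_norm norm_minus_commute add.commute)
        have "norm (t - x - a) \<le> norm t + norm (x + a)"
          using norm_triangle_ineq4[of t "x + a"] by (simp add: algebra_simps)
        also have "\<dots> < d1"
          using t xw d1 \<rho> by (simp add: \<rho>_def)
        finally have 1: "norm (cnj (g (t - x)) - cnj (g a)) < r / 4"
          using d1(2) by (metis complex_cnj_diff complex_mod_cnj)
        have "norm w \<le> (\<Sum>i\<in>UNIV. \<bar>w $ i\<bar>)"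
          by (rule norm_le_l1_cart)
        also have "\<dots> \<le> (\<Sum>i\<in>(UNIV::'n set). 1)"
          using xw(3) by (intro sum_mono) (auto simp: mem_box_cart less_imp_le)
        finally have nw: "norm w \<le> real CARD('n)" by simp
        have "\<bar>w \<bullet> t\<bar> \<le> norm w * norm t"
          by (rule Cauchy_Schwarz_ineq2)
        also have "\<dots> \<le> real CARD('n) * (d2 / (4 * pi * real CARD('n)))"
          using nw t by (intro mult_mono) (auto simp: \<rho>_def)
        also have "\<dots> = d2 / (4 * pi)"
          by simp
        finally have "\<bar>w \<bullet> t\<bar> \<le> d2 / (4 * pi)" .
        then have "\<bar>- (2 * pi * (w \<bullet> t))\<bar> \<le> d2 / 2"
          by (simp add: abs_mult field_simps)
        then have 2: "norm (cis (- (2 * pi * (w \<bullet> t))) - 1) < 1 / 4"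
          using d2 by (intro d2(2)) linarith
        let ?c = "cis (- (2 * pi * (w \<bullet> t)))"
        have "\<zeta> * ?k y - of_real r = \<zeta> * ((cnj (g (t - x)) - cnj (g a)) * ?c + cnj (g a) * (?c - 1))"
          using \<zeta>(2) by (simp add: xw algebra_simps)
        then have "norm (\<zeta> * ?k y - of_real r) = norm ((cnj (g (t - x)) - cnj (g a)) * ?c + cnj (g a) * (?c - 1))"
          using \<zeta>(1) by (simp add: norm_mult)
        also have "\<dots> \<le> norm (cnj (g (t - x)) - cnj (g a)) * 1 + r * norm (?c - 1)"
          by (rule order.trans[OF norm_triangle_ineq]) (simp add: norm_mult r_def)
        also have "\<dots> \<le> r / 4 + r * (1 / 4)"
          using 1 2 r by (intro add_mono mult_left_mono) auto
        finally have "norm (\<zeta> * ?k y - of_real r) \<le> r / 2" by simp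
        moreover have "Re (of_real r - \<zeta> * ?k y) \<le> norm (\<zeta> * ?k y - of_real r)"
          using complex_Re_le_cmod[of "of_real r - \<zeta> * ?k y"] by (simp only: norm_minus_commute)
        ultimately show ?thesis by simp
      qed
      obtain C where C: "C > 0" "\<And>x. norm (g x) \<le> C"
        using schwartz_bound[OF g_schwartz, where k = 0 and \<beta> = "[]"] by auto
      have ind: "integrable lborel (\<lambda>y. indicator (B \<times> ?Q) y :: real)"
        using sets m by (intro integrable_real_indicator) auto
      have int: "integrable lborel (\<lambda>y. \<zeta> * (indicator (B \<times> ?Q) y *\<^sub>R ?k y))"
      proof (rule Bochner_Integration.integrable_bound[where f = "\<lambda>y. C * indicator (B \<times> ?Q) y"])
        show "(\<lambda>y. \<zeta> * (indicator (B \<times> ?Q) y *\<^sub>R ?k y)) \<in> borel_measurable lborel"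
          using sets by measurable
        show "AE y in lborel. norm (\<zeta> * (indicator (B \<times> ?Q) y *\<^sub>R ?k y)) \<le> norm (C * indicator (B \<times> ?Q) y)"
          using C \<zeta> by (intro AE_I2) (auto simp: norm_mult split: split_indicator)
      qed (use ind in simp)
      have "r / 2 * b = (\<integral>y. r / 2 * indicator (B \<times> ?Q) y \<partial>lborel)"
        using m sets b by (simp add: measure_def)
      also have "\<dots> \<le> (\<integral>y. Re (\<zeta> * (indicator (B \<times> ?Q) y *\<^sub>R ?k y)) \<partial>lborel)"
      proof (rule Bochner_Integration.integral_mono)
        show "r / 2 * indicator (B \<times> ?Q) y \<le> Re (\<zeta> * (indicator (B \<times> ?Q) y *\<^sub>R ?k y))" for y
          using pt[of y] by (cases "y \<in> B \<times> ?Q") (auto simp: indicator_def)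
      qed (use ind integrable_Re[OF int] in simp_all)
      also have "\<dots> = Re (\<zeta> * kernel B ?Q t)"
        by (simp only: integral_Re[OF int] kernel_def integral_mult_right_zero)
      finally show ?thesis .
    qed
  qed (use B b \<zeta> \<rho> r \<open>b > 0\<close> in auto)
qed

subsection \<open>Constants are not in the space for finite exponent\<close>

text \<open>Injectivity of the Fourier transform without an inversion formula. Multiplying by
  cosines keeps all the integrals zero, suitable powers of cosines tend to Gaussians, and high
  powers of a Gaussian centred at a point with g a nonzero detect that value.\<close>

lemma fourier_zero_imp_zero:
  assumes zero: "\<And>w. fourier (\<lambda>t. cnj (g t)) w = 0"
  shows False
proof -
  let ?G = "\<lambda>t. cnj (g t)"
  have G: "integrable lborel ?G"
    using integrable_g_translate[of 0] by simp
  \<comment> \<open>The real factors that leave the transform identically zero. Vanishing at every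
    w, not only at w = 0, is what makes the class stable under multiplication by cosines.\<close>
  define Z where "Z = {q :: real^'n \<Rightarrow> real. q \<in> borel_measurable borel \<and> (\<forall>t. \<bar>q t\<bar> \<le> 1) \<and>
      (\<forall>w. (\<integral>t. ?G t * of_real (q t) * cis (- (2 * pi * (w \<bullet> t))) \<partial>lborel) = 0)}"
  have one: "(\<lambda>t. 1) \<in> Z"
    using zero by (simp add: Z_def fourier_def)
  have step: "(\<lambda>t. q t * cos (s * (t $ i - y))) \<in> Z" if q: "q \<in> Z" for q s i y
  proof -
    have [measurable]: "q \<in> borel_measurable borel" and q1: "\<And>t. \<bar>q t\<bar> \<le> 1"
      and q0: "\<And>w. (\<integral>t. ?G t * of_real (q t) * cis (- (2 * pi * (w \<bullet> t))) \<partial>lborel) = 0"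
      using q by (auto simp: Z_def)
    have "(\<lambda>t::real^'n. cos (s * (t $ i - y))) \<in> borel_measurable borel"
      by (intro borel_measurable_continuous_onI continuous_intros)
    then have "(\<lambda>t. q t * cos (s * (t $ i - y))) \<in> borel_measurable borel"
      by measurable
    moreover have "\<bar>q t * cos (s * (t $ i - y))\<bar> \<le> 1" for t
      using mult_mono[OF q1[of t] abs_cos_le_one[of "s * (t $ i - y)"]] by (simp add: abs_mult)
    moreover have "(\<integral>t. ?G t * of_real (q t * cos (s * (t $ i - y))) * cis (- (2 * pi * (w \<bullet> t))) \<partial>lborel) = 0" for w
    proof -
      \<comment> \<open>A cosine of angular frequency s in coordinate i shifts w by s/(2 pi) in
        either direction along that axis.\<close>
      let ?v = "axis i (s / (2 * pi)) :: real^'n"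
      have int: "integrable lborel (\<lambda>t. ?G t * of_real (q t) * cis (- (2 * pi * (w \<bullet> t))))" for w
        using q1 by (intro fourier_integrable integrable_mult_bounded[OF G, of _ 1]) auto
      have c: "of_real (cos (s * (t $ i - y))) * cis (- (2 * pi * (w \<bullet> t))) =
          cis (- (s * y)) / 2 * cis (- (2 * pi * ((w - ?v) \<bullet> t))) + cis (s * y) / 2 * cis (- (2 * pi * ((w + ?v) \<bullet> t)))" for t
      proof -
        have "2 * complex_of_real (cos (s * (t $ i - y))) = cis (s * (t $ i - y)) + cis (- (s * (t $ i - y)))"
          by (simp add: complex_eq_iff)
        then have e: "of_real (cos (s * (t $ i - y))) = (cis (s * (t $ i - y)) + cis (- (s * (t $ i - y)))) / 2"
          by (simp add: field_simps)
        have i: "?v \<bullet> t = s * t $ i / (2 * pi)"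
          by (simp add: inner_axis')
        have "cis (s * (t $ i - y)) * cis (- (2 * pi * (w \<bullet> t))) = cis (- (s * y)) * cis (- (2 * pi * ((w - ?v) \<bullet> t)))"
          "cis (- (s * (t $ i - y))) * cis (- (2 * pi * (w \<bullet> t))) = cis (s * y) * cis (- (2 * pi * ((w + ?v) \<bullet> t)))"
        proof -
          have "2 * pi * ((w - ?v) \<bullet> t) = 2 * pi * (w \<bullet> t) - s * t $ i"
            "2 * pi * ((w + ?v) \<bullet> t) = 2 * pi * (w \<bullet> t) + s * t $ i"
            unfolding inner_diff_left inner_add_left i by (simp_all add: algebra_simps)
          then show "cis (s * (t $ i - y)) * cis (- (2 * pi * (w \<bullet> t))) = cis (- (s * y)) * cis (- (2 * pi * ((w - ?v) \<bullet> t)))"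
            "cis (- (s * (t $ i - y))) * cis (- (2 * pi * (w \<bullet> t))) = cis (s * y) * cis (- (2 * pi * ((w + ?v) \<bullet> t)))"
            by (simp_all only: cis_mult) (simp_all add: algebra_simps)
        qed
        then show ?thesis
          unfolding e by (simp add: add_divide_distrib distrib_right)
      qed
      have "(\<integral>t. ?G t * of_real (q t * cos (s * (t $ i - y))) * cis (- (2 * pi * (w \<bullet> t))) \<partial>lborel) =
         (\<integral>t. cis (- (s * y)) / 2 * (?G t * of_real (q t) * cis (- (2 * pi * ((w - ?v) \<bullet> t)))) +
           cis (s * y) / 2 * (?G t * of_real (q t) * cis (- (2 * pi * ((w + ?v) \<bullet> t)))) \<partial>lborel)"
      proof (intro Bochner_Integration.integral_cong refl)
        fix t
        have "?G t * of_real (q t * cos (s * (t $ i - y))) * cis (- (2 * pi * (w \<bullet> t))) =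
          ?G t * of_real (q t) * (of_real (cos (s * (t $ i - y))) * cis (- (2 * pi * (w \<bullet> t))))"
          by (simp add: mult.assoc)
        then show "?G t * of_real (q t * cos (s * (t $ i - y))) * cis (- (2 * pi * (w \<bullet> t))) =
          cis (- (s * y)) / 2 * (?G t * of_real (q t) * cis (- (2 * pi * ((w - ?v) \<bullet> t)))) +
           cis (s * y) / 2 * (?G t * of_real (q t) * cis (- (2 * pi * ((w + ?v) \<bullet> t))))"
          unfolding c by (simp add: distrib_left ac_simps)
      qed
      also have "\<dots> = 0"
        using int q0 by (subst Bochner_Integration.integral_add) auto
      finally show ?thesis .
    qed
    ultimately show ?thesis by (simp add: Z_def)
  qed
  have pow: "(\<lambda>t. q t * cos (s * (t $ i - y)) ^ m) \<in> Z" if "q \<in> Z" for q s i y m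
  proof (induction m)
    case (Suc m)
    from step[OF this, of s i y] show ?case by (simp add: ac_simps)
  qed (use that in simp)
  have prod: "(\<lambda>t. \<Prod>i\<in>I. cos (s * (t $ i - a $ i)) ^ m) \<in> Z" if "finite I" for I s m and a :: "real^'n"
    using that
  proof (induction I rule: finite_induct)
    case (insert i I)
    from pow[OF insert.IH, of s i "a $ i" m] insert.hyps show ?case
      by (simp add: mult.commute)
  qed (use one in simp)
  \<comment> \<open>As cos(y / sqrt m) is 1 - y^2/(2m) up to higher order, its 2m-th power tends to
    e^(-y^2).\<close>
  have lim_cos: "(\<lambda>m. cos (1 / sqrt (real m) * y) ^ (2 * m * N)) \<longlonglongrightarrow> exp (- (y\<^sup>2)) ^ N" for y :: real and N
  proof -
    have "(\<lambda>m. cos (1 / sqrt (real m) * y) ^ (2 * m)) \<longlonglongrightarrow> exp (- (y\<^sup>2))"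
    proof (cases "y = 0")
      case False
      have "(\<lambda>m. cos (y / sqrt (real m)) ^ (2 * m)) \<longlonglongrightarrow> exp (- (y * y))"
        using False by real_asymp
      then show ?thesis by (simp add: power2_eq_square)
    qed simp
    from tendsto_power[OF this, of N] show ?thesis
      by (simp add: power_mult)
  qed
  have gauss: "(\<integral>t. ?G t * of_real (exp (- ((norm (t - a))\<^sup>2)) ^ N) \<partial>lborel) = 0" for a N
  proof -
    let ?q = "\<lambda>m t. \<Prod>i\<in>UNIV. cos (1 / sqrt (real m) * (t $ i - a $ i)) ^ (2 * m * N)"
    have q: "?q m \<in> Z" for m
      by (rule prod) simp
    then have qm [measurable]: "?q m \<in> borel_measurable borel" and q1: "\<And>t. \<bar>?q m t\<bar> \<le> 1" for m
      by (auto simp: Z_def)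
    have q0: "(\<integral>t. ?G t * of_real (?q m t) \<partial>lborel) = 0" for m
    proof -
      have "(\<integral>t. ?G t * of_real (?q m t) * cis (- (2 * pi * (0 \<bullet> t))) \<partial>lborel) = 0"
        using q[of m] unfolding Z_def by blast
      then show ?thesis by simp
    qed
    have "(\<lambda>m. \<integral>t. ?G t * of_real (?q m t) \<partial>lborel) \<longlonglongrightarrow> (\<integral>t. ?G t * of_real (exp (- ((norm (t - a))\<^sup>2)) ^ N) \<partial>lborel)"
    proof (rule integral_dominated_convergence[where w = "\<lambda>t. norm (?G t)"])
      show "(\<lambda>t. ?G t * of_real (?q m t)) \<in> borel_measurable lborel" for m
        using qm[of m] by measurable
      show "(\<lambda>t. ?G t * of_real (exp (- ((norm (t - a))\<^sup>2)) ^ N)) \<in> borel_measurable lborel"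
        by measurable
      show "AE t in lborel. (\<lambda>m. ?G t * of_real (?q m t)) \<longlonglongrightarrow> ?G t * of_real (exp (- ((norm (t - a))\<^sup>2)) ^ N)"
      proof (intro AE_I2 tendsto_mult tendsto_const tendsto_of_real)
        fix t
        have "(\<lambda>m. ?q m t) \<longlonglongrightarrow> (\<Prod>i\<in>UNIV. exp (- ((t $ i - a $ i)\<^sup>2)) ^ N)"
          by (intro tendsto_prod lim_cos)
        also have "(\<Prod>i\<in>UNIV. exp (- ((t $ i - a $ i)\<^sup>2)) ^ N) = exp (- ((norm (t - a))\<^sup>2)) ^ N"
          unfolding prod_power_distrib[symmetric] exp_sum[OF finite, symmetric] sum_negf
            power2_norm_eq_inner inner_vec_def by (simp add: power2_eq_square)
        finally show "(\<lambda>m. ?q m t) \<longlonglongrightarrow> exp (- ((norm (t - a))\<^sup>2)) ^ N" .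
      qed
      show "AE t in lborel. norm (?G t * of_real (?q m t)) \<le> norm (?G t)" for m
        using q1[of m] by (intro AE_I2) (simp only: norm_mult norm_of_real mult_left_le norm_ge_zero)
    qed (use G in simp)
    then have "0 = (\<integral>t. ?G t * of_real (exp (- ((norm (t - a))\<^sup>2)) ^ N) \<partial>lborel)"
      unfolding q0 LIMSEQ_const_iff .
    then show ?thesis by (rule sym)
  qed
  obtain a where a: "g a \<noteq> 0" using g_nonzero by auto
  define r where "r = norm (g a)"
  have r: "r > 0" using a by (simp add: r_def)
  have "isCont g a"
    using schwartz_continuous_on[OF g_schwartz, of UNIV] continuous_on_eq_continuous_at by blast
  then obtain d where d: "d > 0" "\<And>u. norm (u - a) < d \<Longrightarrow> norm (g u - g a) < r / 2"
    using r unfolding continuous_at_eps_delta dist_norm by (metis zero_less_divide_iff zero_less_numeral)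
  define \<zeta> where "\<zeta> = g a / of_real r"
  have \<zeta>: "norm \<zeta> = 1" "\<zeta> * cnj (g a) = of_real r"
    using r by (simp_all add: \<zeta>_def norm_divide r_def complex_norm_square[symmetric] power2_eq_square)
  have pos: "r / 2 \<le> Re (\<zeta> * ?G t)" if "norm (t - a) < d" for t
  proof -
    have "norm (\<zeta> * ?G t - of_real r) = norm (\<zeta> * (cnj (g t - g a)))"
      using \<zeta>(2) by (simp add: algebra_simps)
    also have "\<dots> = norm (g t - g a)"
      by (simp only: norm_mult \<zeta>(1) complex_mod_cnj mult_1)
    finally have "norm (\<zeta> * ?G t - of_real r) \<le> r / 2"
      using d(2)[OF that] by simp
    moreover have "Re (of_real r - \<zeta> * ?G t) \<le> norm (\<zeta> * ?G t - of_real r)"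
      using complex_Re_le_cmod[of "of_real r - \<zeta> * ?G t"] by (simp only: norm_minus_commute)
    ultimately show ?thesis by simp
  qed
  obtain v where v: "emeasure lborel (ball a (d / 2)) = ennreal v" "0 \<le> v"
    using emeasure_lborel_ball_finite[of a "d / 2"]
    by (metis ennreal_cases infinity_ennreal_def less_irrefl)
  have "v > 0"
    using content_ball_pos[of "d / 2" a] d v unfolding measure_def by simp
  have "r / 2 * v * exp (- ((d / 2)\<^sup>2)) ^ N - exp (- (d\<^sup>2)) ^ N * (\<integral>t. norm (\<zeta> * ?G t) \<partial>lborel) \<le>
     Re (\<integral>t. (\<zeta> * ?G t) * of_real (exp (- ((norm (t - a))\<^sup>2)) ^ N) \<partial>lborel)" for N
  proof (rule integral_power_concentration[where A = "ball a d" and A' = "ball a (d / 2)"])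
    show "integrable lborel (\<lambda>t. \<zeta> * ?G t)" using G by simp
    show "0 \<le> Re (\<zeta> * ?G t)" if "t \<in> ball a d" for t
      using pos[of t] that r by (simp add: dist_norm norm_minus_commute)
    show "r / 2 \<le> Re (\<zeta> * ?G t)" if "t \<in> ball a (d / 2)" for t
      using pos[of t] that d(1) by (simp add: dist_norm norm_minus_commute)
    show "\<zeta> * ?G t = 0 \<or> exp (- ((norm (t - a))\<^sup>2)) \<le> exp (- (d\<^sup>2))" if "t \<notin> ball a d" for t
      using that d(1) by (auto simp: dist_norm norm_minus_commute intro!: power_mono)
    show "exp (- ((d / 2)\<^sup>2)) \<le> exp (- ((norm (t - a))\<^sup>2))" if "t \<in> ball a (d / 2)" for t
      using that power_mono[of "norm (t - a)" "d / 2" 2] by (simp add: dist_norm norm_minus_commute)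
  qed (use v r d in auto)
  moreover have "(\<integral>t. (\<zeta> * ?G t) * of_real (exp (- ((norm (t - a))\<^sup>2)) ^ N) \<partial>lborel) = 0" for N
    using gauss[of a N] by (simp add: mult.assoc)
  ultimately have "r / 2 * v * exp (- ((d / 2)\<^sup>2)) ^ N \<le> exp (- (d\<^sup>2)) ^ N * (\<integral>t. norm (\<zeta> * ?G t) \<partial>lborel)" for N
    by simp
  moreover have "exp (- (d\<^sup>2)) < exp (- ((d / 2)\<^sup>2))"
    using d by (simp add: power_divide)
  ultimately show False
    using r \<open>v > 0\<close> by (intro power_dominated_contradiction[of "exp (- (d\<^sup>2))" "exp (- ((d / 2)\<^sup>2))" "r / 2 * v"]) auto
qed

lemma fourier_continuous:
  fixes \<phi> :: "real^'n \<Rightarrow> complex"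
  assumes \<phi>: "integrable lborel \<phi>"
  shows "isCont (fourier \<phi>) w"
  unfolding continuous_at_sequentially
proof (intro allI impI)
  fix s :: "nat \<Rightarrow> real^'n" assume s: "s \<longlonglongrightarrow> w"
  note borel_measurable_integrable[OF \<phi>, measurable]
  show "(fourier \<phi> \<circ> s) \<longlonglongrightarrow> fourier \<phi> w"
    unfolding fourier_def o_def
  proof (rule integral_dominated_convergence[where w = "\<lambda>t. norm (\<phi> t)"])
    show "AE t in lborel. (\<lambda>i. \<phi> t * cis (- (2 * pi * (s i \<bullet> t)))) \<longlonglongrightarrow> \<phi> t * cis (- (2 * pi * (w \<bullet> t)))"
      by (intro AE_I2 tendsto_intros isCont_tendsto_compose[of _ cis] s)
  qed (use \<phi> in \<open>auto simp: norm_mult\<close>)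
qed

lemma const_not_modulation_function:
  assumes p: "1 \<le> p" "p < \<infinity>" and c: "c \<noteq> 0"
  shows "(\<lambda>x. c) \<notin> modulation_functions g p"
proof
  assume mem: "(\<lambda>x. c) \<in> modulation_functions g p"
  let ?G = "fourier (\<lambda>t. cnj (g t))"
  have V: "norm (V (\<lambda>x. c) x w) = norm c * norm (?G w)" for x w
  proof -
    let ?f = "\<lambda>s. c * cnj (g s) * cis (- (2 * pi * (w \<bullet> (s + x))))"
    have "V (\<lambda>x. c) x w = (\<integral>t. ?f (t + (- x)) \<partial>lborel)"
      by (simp add: V_def fourier_def)
    also have "\<dots> = (\<integral>t. ?f t \<partial>lborel)"
      by (rule integral_translate) measurable
    also have "\<dots> = (\<integral>t. c * cis (- (2 * pi * (w \<bullet> x))) * (cnj (g t) * cis (- (2 * pi * (w \<bullet> t)))) \<partial>lborel)"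
    proof (intro Bochner_Integration.integral_cong refl)
      fix t
      have "cis (- (2 * pi * (w \<bullet> (t + x)))) = cis (- (2 * pi * (w \<bullet> x))) * cis (- (2 * pi * (w \<bullet> t)))"
        by (simp add: cis_mult inner_add_right algebra_simps)
      then show "?f t = c * cis (- (2 * pi * (w \<bullet> x))) * (cnj (g t) * cis (- (2 * pi * (w \<bullet> t))))"
        by (simp add: ac_simps)
    qed
    also have "\<dots> = c * cis (- (2 * pi * (w \<bullet> x))) * ?G w"
      by (simp add: fourier_def)
    finally show ?thesis by (simp add: norm_mult)
  qed
  obtain w0 where w0: "?G w0 \<noteq> 0"
    using fourier_zero_imp_zero by blast
  \<comment> \<open>One point w0 would be negligible for the outer integral; continuity gives a ball
    of positive measure on which the L^p norm is infinite.\<close>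
  have "isCont ?G w0"
    using integrable_g_translate[of 0] by (intro fourier_continuous) simp
  then obtain d where d: "d > 0" "\<And>w. dist w0 w < d \<Longrightarrow> ?G w \<noteq> 0"
    using continuous_at_avoid[of w0 ?G 0] w0 by blast
  have "Lp_norm p (\<lambda>x. V (\<lambda>x. c) x w) = \<infinity>" if "w \<in> ball w0 d" for w
  proof -
    have "norm c * norm (?G w) > 0"
      using c d(2)[of w] that by simp
    then have "c \<noteq> 0" "?G w \<noteq> 0"
      by auto
    then have "(\<integral>\<^sup>+x. ennreal ((norm c * norm (?G w)) powr enn2real p) \<partial>(lborel :: (real^'n) measure)) = \<infinity>"
      by (simp add: ennreal_mult_top)
    then show ?thesis
      using p unfolding Lp_norm_def V by (simp add: less_top[symmetric])
  qed
  then have "(\<integral>\<^sup>+w. \<infinity> * indicator (ball w0 d) w \<partial>lborel) \<le> (\<integral>\<^sup>+w. Lp_norm p (\<lambda>x. V (\<lambda>x. c) x w) \<partial>lborel)"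
    by (intro nn_integral_mono) (auto split: split_indicator)
  moreover have "(\<integral>\<^sup>+w. \<infinity> * indicator (ball w0 d) w \<partial>lborel) = \<infinity>"
  proof -
    have "emeasure lborel (ball w0 d) \<noteq> 0"
      using content_ball_pos[OF d(1), of w0] unfolding measure_def by auto
    then show ?thesis
      by (subst nn_integral_cmult_indicator) (auto simp: ennreal_top_mult)
  qed
  moreover have "(\<integral>\<^sup>+w. Lp_norm p (\<lambda>x. V (\<lambda>x. c) x w) \<partial>lborel) < \<infinity>"
    using mem by (simp add: modulation_functions_def modulation_space_def modulation_norm_def flip: stft_eq_V)
  ultimately show False by simp
qed

end

subsection \<open>Periodic functions\<close>

text \<open>For an antiderivative \<Phi>, the increment \<Phi>(x + P) - \<Phi>(x) has derivative
  zero by periodicity, so it takes the same value at 0 and at a.\<close>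

lemma integral_periodic_shift:
  fixes f :: "real \<Rightarrow> complex"
  assumes f: "continuous_on UNIV f" and per: "\<And>x. f (x + P) = f x" and P: "0 < P"
  shows "integral {0..P} (\<lambda>s. f (s + a)) = integral {0..P} f"
proof -
  \<comment> \<open>The interval is enlarged by 1 at both ends so that every point in use is
    interior and the derivative there is two-sided.\<close>
  define c d where "c = min 0 a - 1" and "d = max 0 a + P + 1"
  obtain \<Phi> where \<Phi>: "\<And>x. x \<in> {c..d} \<Longrightarrow> (\<Phi> has_vector_derivative f x) (at x within {c..d})"
    using antiderivative_continuous[OF continuous_on_subset[OF f subset_UNIV], of c d] by blast
  have D: "(\<Phi> has_vector_derivative f x) (at x)" if "c < x" "x < d" for x
    using \<Phi>[of x] that by (simp add: at_within_Icc_at)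
  have D': "((\<lambda>x. \<Phi> (x + b)) has_vector_derivative f (x + b)) (at x)" if "c < x + b" "x + b < d" for x b
  proof -
    have "((\<lambda>x. x + b) has_vector_derivative 1) (at x)"
      by (auto intro!: derivative_eq_intros)
    from vector_diff_chain_at[OF this D[OF that]] show ?thesis by (simp add: o_def)
  qed
  let ?I = "{min 0 a..max 0 a}"
  have ex: "\<exists>k. \<forall>x\<in>?I. \<Phi> (x + P) - \<Phi> x = k"
  proof (rule has_derivative_zero_constant)
    fix x assume x: "x \<in> ?I"
    have "((\<lambda>x. \<Phi> (x + P) - \<Phi> x) has_vector_derivative f (x + P) - f x) (at x)"
      using x P by (intro has_vector_derivative_diff D D') (auto simp: c_def d_def)
    then show "((\<lambda>x. \<Phi> (x + P) - \<Phi> x) has_derivative (\<lambda>h. 0)) (at x within ?I)"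
      by (simp add: has_vector_derivative_def per has_derivative_at_withinI)
  qed simp
  have eq: "\<Phi> (a + P) - \<Phi> a = \<Phi> P - \<Phi> 0"
  proof -
    obtain k where "\<And>x. x \<in> ?I \<Longrightarrow> \<Phi> (x + P) - \<Phi> x = k"
      using ex by blast
    from this[of a] this[of 0] show ?thesis by simp
  qed
  have "(f has_integral \<Phi> P - \<Phi> 0) {0..P}"
    using P by (intro fundamental_theorem_of_calculus has_vector_derivative_at_within[OF D]) (auto simp: c_def d_def)
  moreover have "((\<lambda>s. f (s + a)) has_integral \<Phi> (P + a) - \<Phi> (0 + a)) {0..P}"
    using P by (intro fundamental_theorem_of_calculus[where f = "\<lambda>s. \<Phi> (s + a)"] has_vector_derivative_at_within[OF D'])
      (auto simp: c_def d_def)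
  ultimately show ?thesis
    using eq by (simp add: integral_unique add.commute)
qed

lemma lebesgue_integral_eq_integral:
  fixes f :: "real \<Rightarrow> complex"
  assumes "continuous_on {a..b} f"
  shows "integrable lborel (\<lambda>s. indicator {a..b} s *\<^sub>R f s)"
    and "(\<integral>s. indicator {a..b} s *\<^sub>R f s \<partial>lborel) = integral {a..b} f"
proof -
  have "set_integrable lborel {a..b} f"
    using borel_integrable_compact[of "{a..b}" f] assms
    by (simp add: set_integrable_def indicator_def if_distrib[of "\<lambda>r. r *\<^sub>R _"] cong: if_cong)
  then show "integrable lborel (\<lambda>s. indicator {a..b} s *\<^sub>R f s)"
    and "(\<integral>s. indicator {a..b} s *\<^sub>R f s \<partial>lborel) = integral {a..b} f"
    using set_borel_integral_eq_integral(2)[of "{a..b}" f]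
    by (auto simp: set_integrable_def set_lebesgue_integral_def)
qed

text \<open>Averaging the translates by \<open>s / m\<close>, \<open>0 \<le> s \<le> 1\<close>, replaces the oscillating factor by its mean.\<close>

lemma oscillation_weak_limit:
  fixes G :: "real^'n::finite \<Rightarrow> complex" and \<psi> :: "real \<Rightarrow> complex"
  assumes G: "continuous_on UNIV G" "\<And>t. norm t > r \<Longrightarrow> G t = 0"
    and \<psi>: "continuous_on UNIV \<psi>" "\<And>x. \<psi> (x + 1) = \<psi> x" "\<And>x. norm (\<psi> x) \<le> C"
  shows "(\<lambda>m. \<integral>t. G t * \<psi> (real m * (t $ i)) \<partial>lborel) \<longlonglongrightarrow> (\<integral>t. G t \<partial>lborel) * integral {0..1} \<psi>"
proof -
  let ?e = "axis i 1 :: real^'n"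
  note borel_measurable_continuous_onI[OF G(1), measurable] borel_measurable_continuous_onI[OF \<psi>(1), measurable]
  have [measurable]: "(\<lambda>t::real^'n. t $ i) \<in> borel_measurable borel"
    by (intro borel_measurable_continuous_onI continuous_intros)
  have "C \<ge> 0" using \<psi>(3) norm_ge_zero order.trans by blast
  obtain K where K: "K > 0" "\<And>t. norm (G t) \<le> K"
  proof -
    have "bounded (G ` cball 0 r)"
      by (intro compact_imp_bounded compact_continuous_image continuous_on_subset[OF G(1)]) auto
    then obtain K where K: "K > 0" "\<And>t. t \<in> cball 0 r \<Longrightarrow> norm (G t) \<le> K"
      by (auto simp: bounded_pos)
    have "norm (G t) \<le> K" for t
      using K G(2)[of t] by (cases "norm t > r") auto
    then show ?thesis using K that by blast
  qed
  \<comment> \<open>A translation by s/m with s in the unit interval moves points by at most 1, so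
    radius r + 1 contains all translated supports.\<close>
  define S where "S = cball (0 :: real^'n) (r + 1) \<times> {0..1::real}"
  have S [measurable]: "S \<in> sets (lborel \<Otimes>\<^sub>M lborel)"
    unfolding S_def by (intro pair_measureI) auto
  have "emeasure (lborel \<Otimes>\<^sub>M lborel) S < \<infinity>"
    unfolding S_def by (subst lborel.emeasure_pair_measure_Times)
      (auto simp: ennreal_mult_less_top emeasure_lborel_cball_finite[unfolded infinity_ennreal_def])
  then have intS: "integrable (lborel \<Otimes>\<^sub>M lborel) (\<lambda>z. B * indicator S z :: real)" for B
    using S by (intro integrable_mult_right integrable_real_indicator) auto
  have int_bound: "integrable (lborel \<Otimes>\<^sub>M lborel) f"
    if "f \<in> borel_measurable (lborel \<Otimes>\<^sub>M lborel)" "\<And>z. norm (f z) \<le> B * indicator S z"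
    for f :: "(real^'n) \<times> real \<Rightarrow> complex" and B
    by (rule Bochner_Integration.integrable_bound[OF intS[of B] that(1)])
      (intro AE_I2, simp only: real_norm_def, rule order.trans[OF that(2) abs_ge_self])
  \<comment> \<open>Translating by s/m turns m t_i into m t_i + s. \<open>D1\<close> integrates to
    the original integral for m at least 1; \<open>D2\<close>, with the translation dropped from G,
    integrates exactly to the limit. Continuity of G makes their difference negligible.\<close>
  define D1 where "D1 = (\<lambda>m (t, s). indicator {0..1} s *\<^sub>R (G (t + (s / real m) *\<^sub>R ?e) * \<psi> (real m * (t $ i) + s)))"
  define D2 where "D2 = (\<lambda>m (t, s). indicator {0..1} s *\<^sub>R (G t * \<psi> (real m * (t $ i) + s)))"
  have meas: "D1 m \<in> borel_measurable (lborel \<Otimes>\<^sub>M lborel)" "D2 m \<in> borel_measurable (lborel \<Otimes>\<^sub>M lborel)" for m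
    unfolding D1_def D2_def by measurable
  have D1_bound: "norm (D1 m z) \<le> K * C * indicator S z" for m z
  proof (cases z)
    case (Pair t s)
    show ?thesis
    proof (cases "s \<in> {0..1} \<and> norm t > r + 1")
      case True
      \<comment> \<open>The bound is wanted for m = 0 as well, where division by zero yields
        0.\<close>
      have "s / real m \<le> 1"
      proof (cases "m = 0")
        case False
        have "s / real m \<le> 1 / 1" using True False by (intro frac_le) auto
        then show ?thesis by simp
      qed simp
      then have "norm ((s / real m) *\<^sub>R ?e) \<le> 1"
        using True by simp
      then have "norm (t + (s / real m) *\<^sub>R ?e) > r"
        using True norm_triangle_ineq4[of "t + (s / real m) *\<^sub>R ?e" "(s / real m) *\<^sub>R ?e"] by simp
      then show ?thesis using G(2) Pair K(1) \<open>C \<ge> 0\<close> by (simp add: D1_def S_def)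
    next
      case False
      then show ?thesis
        using Pair K \<psi>(3) \<open>C \<ge> 0\<close>
        by (auto simp: D1_def S_def norm_mult split: split_indicator intro!: mult_mono)
    qed
  qed
  have D2_bound: "norm (D2 m z) \<le> K * C * indicator S z" for m z
  proof (cases z)
    case (Pair t s)
    show ?thesis
    proof (cases "norm t > r + 1")
      case True
      then show ?thesis using G(2)[of t] Pair K(1) \<open>C \<ge> 0\<close> by (simp add: D2_def S_def)
    next
      case False
      then show ?thesis
        using Pair K \<psi>(3) \<open>C \<ge> 0\<close>
        by (auto simp: D2_def S_def norm_mult split: split_indicator intro!: mult_mono)
    qed
  qed
  note int1 = int_bound[OF meas(1) D1_bound] and int2 = int_bound[OF meas(2) D2_bound]
  have "(\<lambda>m. \<integral>z. D1 m z - D2 m z \<partial>(lborel \<Otimes>\<^sub>M lborel)) \<longlonglongrightarrow> (\<integral>z. 0 \<partial>((lborel :: (real^'n) measure) \<Otimes>\<^sub>M (lborel :: real measure)))"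
  proof (rule integral_dominated_convergence[where w = "\<lambda>z. 2 * (K * C) * indicator S z"])
    show "AE z in lborel \<Otimes>\<^sub>M lborel. norm (D1 m z - D2 m z) \<le> 2 * (K * C) * indicator S z" for m
    proof (intro AE_I2)
      fix z
      have "2 * (K * C) * indicator S z = K * C * indicator S z + K * C * indicator S z"
        by simp
      then show "norm (D1 m z - D2 m z) \<le> 2 * (K * C) * indicator S z"
        using norm_triangle_ineq4[of "D1 m z" "D2 m z"] D1_bound[of m z] D2_bound[of m z] by linarith
    qed
    show "AE z in lborel \<Otimes>\<^sub>M lborel. (\<lambda>m. D1 m z - D2 m z) \<longlonglongrightarrow> 0"
    proof (intro AE_I2)
      fix z :: "(real^'n) \<times> real"
      obtain t s where z: "z = (t, s)" by (cases z)
      have "(\<lambda>m. t + (s / real m) *\<^sub>R ?e) \<longlonglongrightarrow> t + 0 *\<^sub>R ?e"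
        by (intro tendsto_intros lim_const_over_n)
      moreover have "isCont G t"
        using G(1) continuous_on_eq_continuous_at by blast
      ultimately have "(\<lambda>m. G (t + (s / real m) *\<^sub>R ?e)) \<longlonglongrightarrow> G t"
        by (intro isCont_tendsto_compose[of _ G]) auto
      then have lim: "(\<lambda>m. norm (G (t + (s / real m) *\<^sub>R ?e) - G t) * C) \<longlonglongrightarrow> 0"
        by (intro tendsto_mult_left_zero tendsto_norm_zero) (simp add: LIM_zero)
      have le: "norm (D1 m z - D2 m z) \<le> norm (G (t + (s / real m) *\<^sub>R ?e) - G t) * C" for m
      proof -
        have "D1 m z - D2 m z = indicator {0..1} s *\<^sub>R ((G (t + (s / real m) *\<^sub>R ?e) - G t) * \<psi> (real m * (t $ i) + s))"
          by (simp add: D1_def D2_def z algebra_simps)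
        then have "norm (D1 m z - D2 m z) \<le> norm ((G (t + (s / real m) *\<^sub>R ?e) - G t) * \<psi> (real m * (t $ i) + s))"
          by (simp split: split_indicator)
        also have "\<dots> \<le> norm (G (t + (s / real m) *\<^sub>R ?e) - G t) * C"
          unfolding norm_mult by (intro mult_left_mono \<psi>(3)) auto
        finally show ?thesis .
      qed
      show "(\<lambda>m. D1 m z - D2 m z) \<longlonglongrightarrow> 0"
        by (rule Lim_null_comparison[OF _ lim]) (intro always_eventually allI le)
    qed
  qed (use intS meas in \<open>auto intro: borel_measurable_diff\<close>)
  then have lim0: "(\<lambda>m. (\<integral>z. D1 m z \<partial>(lborel \<Otimes>\<^sub>M lborel)) - (\<integral>z. D2 m z \<partial>(lborel \<Otimes>\<^sub>M lborel))) \<longlonglongrightarrow> 0"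
    by (simp add: Bochner_Integration.integral_diff[OF int1 int2])
  have E1: "(\<integral>z. D1 m z \<partial>(lborel \<Otimes>\<^sub>M lborel)) = (\<integral>t. G t * \<psi> (real m * (t $ i)) \<partial>lborel)" if "m \<ge> 1" for m
  proof -
    let ?h = "\<lambda>t. G t * \<psi> (real m * (t $ i))"
    have "(\<integral>z. D1 m z \<partial>(lborel \<Otimes>\<^sub>M lborel)) = (\<integral>s. \<integral>t. D1 m (t, s) \<partial>lborel \<partial>lborel)"
      using lborel_pair.integral_snd[of "\<lambda>t s. D1 m (t, s)"] int1[of m] by simp
    also have "\<dots> = (\<integral>s. indicator {0..1::real} s *\<^sub>R (\<integral>t. ?h t \<partial>lborel) \<partial>lborel)"
    proof (intro Bochner_Integration.integral_cong refl)
      fix s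
      have "D1 m (t, s) = indicator {0..1} s *\<^sub>R ?h (t + (s / real m) *\<^sub>R ?e)" for t
        using that by (simp add: D1_def axis_def distrib_left)
      moreover have "(\<integral>t. ?h (t + (s / real m) *\<^sub>R ?e) \<partial>lborel) = (\<integral>t. ?h t \<partial>lborel)"
        by (rule integral_translate) measurable
      ultimately show "(\<integral>t. D1 m (t, s) \<partial>lborel) = indicator {0..1} s *\<^sub>R (\<integral>t. ?h t \<partial>lborel)"
        by simp
    qed
    also have "\<dots> = (\<integral>t. ?h t \<partial>lborel)"
      by (subst lebesgue_integral_eq_integral) (auto intro: continuous_intros)
    finally show ?thesis .
  qed
  have E2: "(\<integral>z. D2 m z \<partial>(lborel \<Otimes>\<^sub>M lborel)) = (\<integral>t. G t \<partial>lborel) * integral {0..1} \<psi>" for m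
  proof -
    have "(\<integral>z. D2 m z \<partial>(lborel \<Otimes>\<^sub>M lborel)) = (\<integral>t. \<integral>s. D2 m (t, s) \<partial>lborel \<partial>lborel)"
      using lborel_pair.integral_fst'[OF int2] by simp
    also have "\<dots> = (\<integral>t. G t * integral {0..1} \<psi> \<partial>lborel)"
    proof (intro Bochner_Integration.integral_cong refl)
      fix t
      let ?k = "\<lambda>s. \<psi> (s + real m * (t $ i))"
      have "(\<integral>s. D2 m (t, s) \<partial>lborel) = (\<integral>s. G t * (indicator {0..1} s *\<^sub>R ?k s) \<partial>lborel)"
        by (simp add: D2_def add.commute)
      also have "\<dots> = G t * (\<integral>s. indicator {0..1} s *\<^sub>R ?k s \<partial>lborel)"
        by (rule integral_mult_right_zero)
      also have "(\<integral>s. indicator {0..1} s *\<^sub>R ?k s \<partial>lborel) = integral {0..1} ?k"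
        by (intro lebesgue_integral_eq_integral continuous_on_compose2[OF \<psi>(1)] continuous_intros) auto
      also have "\<dots> = integral {0..1} \<psi>"
        using \<psi> by (intro integral_periodic_shift) auto
      finally show "(\<integral>s. D2 m (t, s) \<partial>lborel) = G t * integral {0..1} \<psi>" .
    qed
    finally show ?thesis by simp
  qed
  have "(\<lambda>m. (\<integral>z. D1 m z \<partial>(lborel \<Otimes>\<^sub>M lborel))) \<longlonglongrightarrow> (\<integral>t. G t \<partial>lborel) * integral {0..1} \<psi>"
    using lim0 unfolding E2 by (rule LIM_zero_cancel)
  then show ?thesis
    by (rule Lim_transform_eventually) (auto simp: E1 intro!: eventually_sequentiallyI[of 1])
qed

text \<open>What one step of the Riesz product contributes: e^(iv) from the phase and 1 - 2iv from
  the product, with v = cos(2 pi s). The 2 splits into two characters with coefficients -i, the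
  largest that keep coefficients at most 1; the phase -i makes both factors act in the same
  direction.\<close>

definition riesz_factor :: "real \<Rightarrow> complex" where
  "riesz_factor s = cis (cos (2 * pi * s)) * (1 - 2 * \<i> * cos (2 * pi * s))"

lemma riesz_factor_continuous: "continuous_on A riesz_factor"
  unfolding riesz_factor_def by (intro continuous_intros)

lemma riesz_factor_periodic: "riesz_factor (s + 1) = riesz_factor s"
  by (simp add: riesz_factor_def distrib_left)

lemma riesz_factor_bound: "norm (riesz_factor s) \<le> 3"
proof -
  have "norm (1 - 2 * \<i> * complex_of_real (cos (2 * pi * s))) \<le> 1 + 2 * \<bar>cos (2 * pi * s)\<bar>"
    by (rule order.trans[OF norm_triangle_ineq4]) (simp add: norm_mult)
  then show ?thesis
    using abs_cos_le_one[of "2 * pi * s"] unfolding riesz_factor_def norm_mult norm_cis by linarith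
qed

text \<open>With v = cos(2 pi s), the real part is cos v + 2 v sin v. As cos v >= 1 - v^2/2 and v
  sin v >= v^2/2 for |v| <= 1, it is at least 1 + v^2/2, and v^2 has mean 1/2.\<close>

lemma riesz_factor_mean: "5 / 4 \<le> norm (integral {0..1} riesz_factor)"
proof -
  have cos_ge: "1 - v\<^sup>2 / 2 \<le> cos v" for v :: real
  proof -
    have "\<bar>sin (v / 2)\<bar>\<^sup>2 \<le> \<bar>v / 2\<bar>\<^sup>2"
      by (intro power_mono abs_sin_x_le_abs_x) simp
    then show ?thesis
      using cos_double_sin[of "v / 2"] by (simp add: power2_eq_square)
  qed
  have sin_ge: "v\<^sup>2 / 2 \<le> v * sin v" if "\<bar>v\<bar> \<le> 1" for v :: real
  proof -
    have pos: "v / 2 \<le> sin v" if v: "0 < v" "v \<le> 1" for v :: real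
    proof -
      obtain \<xi> where \<xi>: "0 < \<xi>" "\<xi> < v" "sin v - sin 0 = (v - 0) * cos \<xi>"
        using MVT2[of 0 v sin cos] v by auto
      have "\<xi>\<^sup>2 \<le> 1\<^sup>2" using \<xi> v by (intro power_mono) auto
      then have "1 / 2 \<le> cos \<xi>" using cos_ge[of \<xi>] by simp
      then have "v * (1 / 2) \<le> v * cos \<xi>" using v by (intro mult_left_mono) auto
      then show ?thesis using \<xi> by simp
    qed
    consider "v = 0" | "0 < v" | "v < 0" by linarith
    then show ?thesis
    proof cases
      case 2
      then have "v * (v / 2) \<le> v * sin v" using pos[of v] that by (intro mult_left_mono) auto
      then show ?thesis by (simp add: power2_eq_square)
    next
      case 3
      then have "(- v) * ((- v) / 2) \<le> (- v) * sin (- v)" using pos[of "- v"] that by (intro mult_left_mono) auto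
      then show ?thesis by (simp add: power2_eq_square)
    qed simp
  qed
  have re: "1 + (cos (2 * pi * s))\<^sup>2 / 2 \<le> Re (riesz_factor s)" for s
  proof -
    let ?v = "cos (2 * pi * s)"
    have "Re (riesz_factor s) = cos ?v + 2 * (?v * sin ?v)"
      by (simp add: riesz_factor_def)
    then show ?thesis
      using cos_ge[of ?v] sin_ge[of ?v] abs_cos_le_one[of "2 * pi * s"] by linarith
  qed
  have "((\<lambda>s. 1 + (cos (2 * pi * s))\<^sup>2 / 2) has_integral
      (1 + 1 / 4 + sin (4 * pi * 1) / (16 * pi)) - (0 + 0 / 4 + sin (4 * pi * 0) / (16 * pi))) {0..1::real}"
  proof (rule fundamental_theorem_of_calculus[where f = "\<lambda>s. s + s / 4 + sin (4 * pi * s) / (16 * pi)"])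
    fix s :: real
    have "cos (4 * pi * s) = 2 * (cos (2 * pi * s))\<^sup>2 - 1"
      using cos_double_cos[of "2 * pi * s"] by (simp add: algebra_simps)
    then have eq: "1 + 1 / 4 + 4 * pi * cos (4 * pi * s) / (16 * pi) = 1 + (cos (2 * pi * s))\<^sup>2 / 2"
      by (simp add: field_simps)
    have "((\<lambda>s. s + s / 4 + sin (4 * pi * s) / (16 * pi)) has_real_derivative
        1 + 1 / 4 + 4 * pi * cos (4 * pi * s) / (16 * pi)) (at s within {0..1})"
      by (auto intro!: derivative_eq_intros)
    then show "((\<lambda>s. s + s / 4 + sin (4 * pi * s) / (16 * pi)) has_vector_derivative
        1 + (cos (2 * pi * s))\<^sup>2 / 2) (at s within {0..1})"
      unfolding eq by (simp add: has_real_derivative_iff_has_vector_derivative)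
  qed simp
  moreover have "sin (4 * pi) = 0"
    using sin_npi[of 4] by (simp add: mult.commute)
  ultimately have I: "((\<lambda>s. 1 + (cos (2 * pi * s))\<^sup>2 / 2) has_integral 5 / 4) {0..1::real}"
    by simp
  have int: "riesz_factor integrable_on {0..1}"
    by (intro integrable_continuous_real riesz_factor_continuous)
  then have "((\<lambda>s. Re (riesz_factor s)) has_integral Re (integral {0..1} riesz_factor)) {0..1}"
    using has_integral_linear[OF integrable_integral[OF int] bounded_linear_Re] by (simp add: o_def)
  with I have "5 / 4 \<le> Re (integral {0..1} riesz_factor)"
    using re by (rule has_integral_le)
  then show ?thesis
    using complex_Re_le_cmod order.trans by blast
qed

subsection \<open>Fourier series\<close>

definition fourier_coeff :: "(real \<Rightarrow> complex) \<Rightarrow> int \<Rightarrow> complex" where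
  "fourier_coeff f n = integral {0..2*pi} (\<lambda>s. f s * cis (- (of_int n * s))) / of_real (2 * pi)"

text \<open>Powers of (1 - cos s)/2 are trigonometric polynomials concentrating at pi, so vanishing
  coefficients are incompatible with a nonzero value there. The point pi is the centre of the
  integration interval, which avoids any wrapping around.\<close>

lemma fourier_coeff_eq_0_imp_zero_at_pi:
  assumes f: "continuous_on UNIV f" and zero: "\<And>n. fourier_coeff f n = 0"
  shows "f pi = 0"
proof (rule ccontr)
  assume nz: "f pi \<noteq> 0"
  let ?u = "\<lambda>s::real. (1 - cos s) / 2"
  have u01: "0 \<le> ?u s" "?u s \<le> 1" for s
    using cos_le_one[of s] cos_ge_minus_one[of s] by auto
  \<comment> \<open>One more factor (1 - cos s)/2 combines the integrals for n, n - 1 and n + 1, so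
    all n are carried through the induction.\<close>
  have pw: "integral {0..2*pi} (\<lambda>s. f s * of_real (?u s ^ N) * cis (- (of_int n * s))) = 0" for N n
  proof (induction N arbitrary: n)
    case 0
    then show ?case using zero[of n] by (simp add: fourier_coeff_def)
  next
    case (Suc N)
    let ?h = "\<lambda>n s. f s * of_real (?u s ^ N) * cis (- (of_int n * s))"
    have int: "?h n integrable_on {0..2*pi}" for n
      by (intro integrable_continuous_real continuous_intros continuous_on_subset[OF f]) auto
    have I: "(?h n has_integral 0) {0..2*pi}" for n
      using integrable_integral[OF int[of n]] Suc.IH[of n] by simp
    have a: "((\<lambda>s. 1 / 2 * ?h n s - 1 / 4 * ?h (n - 1) s - 1 / 4 * ?h (n + 1) s) has_integral (1 / 2 * 0 - 1 / 4 * 0 - 1 / 4 * 0)) {0..2*pi}"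
      by (intro has_integral_diff has_integral_mult_right I)
    have b: "1 / 2 * ?h n s - 1 / 4 * ?h (n - 1) s - 1 / 4 * ?h (n + 1) s =
        f s * of_real (?u s ^ Suc N) * cis (- (of_int n * s))" for s
    proof -
      have c: "cis (- (of_int (n - 1) * s)) = cis (- (of_int n * s)) * cis s"
        "cis (- (of_int (n + 1) * s)) = cis (- (of_int n * s)) * cis (- s)"
        by (simp_all add: cis_mult algebra_simps)
      have d: "complex_of_real (?u s) = 1 / 2 - (cis s + cis (- s)) / 4"
        by (simp add: complex_eq_iff field_simps)
      have "f s * of_real (?u s ^ Suc N) * cis (- (of_int n * s)) =
          of_real (?u s) * ?h n s"
        by (simp only: power_Suc of_real_mult ac_simps)
      also have "\<dots> = 1 / 2 * ?h n s - 1 / 4 * ?h (n - 1) s - 1 / 4 * ?h (n + 1) s"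
        unfolding d c by (simp add: algebra_simps add_divide_distrib)
      finally show ?thesis by simp
    qed
    have "((\<lambda>s. f s * of_real (?u s ^ Suc N) * cis (- (of_int n * s))) has_integral 0) {0..2*pi}"
      using a by (simp only: b mult_zero_right diff_self)
    then show ?case by (rule integral_unique)
  qed
  define r where "r = norm (f pi)"
  have r: "r > 0" using nz by (simp add: r_def)
  have "isCont f pi"
    using f continuous_on_eq_continuous_at by blast
  then obtain d' where d': "d' > 0" "\<And>s. norm (s - pi) < d' \<Longrightarrow> norm (f s - f pi) < r / 2"
    using r unfolding continuous_at_eps_delta dist_norm by (metis zero_less_divide_iff zero_less_numeral)
  \<comment> \<open>At most pi, so that the ball stays within a period and the cosine is monotone on
    the distances involved.\<close>
  define d where "d = min d' pi"
  have d: "0 < d" "d \<le> pi" "d \<le> d'" using d' by (auto simp: d_def)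
  define \<zeta> where "\<zeta> = cnj (f pi) / of_real r"
  have \<zeta>: "norm \<zeta> = 1" "\<zeta> * f pi = of_real r"
  proof -
    have "f pi * cnj (f pi) = of_real (r\<^sup>2)"
      unfolding r_def by (rule complex_norm_square[symmetric])
    then show "\<zeta> * f pi = of_real r"
      using r by (simp add: \<zeta>_def field_simps power2_eq_square)
  qed (use r in \<open>simp add: \<zeta>_def norm_divide r_def\<close>)
  have pos: "r / 2 \<le> Re (\<zeta> * f s)" if "\<bar>s - pi\<bar> < d" for s
  proof -
    have "norm (\<zeta> * f s - of_real r) = norm (\<zeta> * (f s - f pi))"
      using \<zeta>(2) by (simp add: algebra_simps)
    also have "\<dots> = norm (f s - f pi)"
      by (simp only: norm_mult \<zeta>(1) mult_1)
    finally have "norm (\<zeta> * f s - of_real r) \<le> r / 2"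
      using d'(2)[of s] that d by simp
    moreover have "Re (of_real r - \<zeta> * f s) \<le> norm (\<zeta> * f s - of_real r)"
      using complex_Re_le_cmod[of "of_real r - \<zeta> * f s"] by (simp only: norm_minus_commute)
    ultimately show ?thesis by simp
  qed
  define \<phi> where "\<phi> = (\<lambda>s. indicator {0..2*pi} s *\<^sub>R (\<zeta> * f s))"
  have cont: "continuous_on {0..2*pi} (\<lambda>s. \<zeta> * f s)"
    by (intro continuous_intros continuous_on_subset[OF f]) auto
  have u_eq: "?u s = (1 + cos \<bar>s - pi\<bar>) / 2" for s
    by (simp add: cos_diff)
  let ?q1 = "(1 + cos d) / 2" and ?q2 = "(1 + cos (d / 2)) / 2"
  have "r / 2 * d * ?q2 ^ N - ?q1 ^ N * (\<integral>s. norm (\<phi> s) \<partial>lborel) \<le> Re (\<integral>s. \<phi> s * of_real (?u s ^ N) \<partial>lborel)" for N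
  proof (rule integral_power_concentration[where A = "ball pi d" and A' = "ball pi (d / 2)"])
    show "integrable lborel \<phi>"
      unfolding \<phi>_def by (rule lebesgue_integral_eq_integral(1)[OF cont])
    show "emeasure lborel (ball pi (d / 2)) = ennreal d"
      using d by (simp add: ball_eq_greaterThanLessThan)
    show "?u \<in> borel_measurable borel"
      by measurable
    show "0 \<le> Re (\<phi> s)" if "s \<in> ball pi d" for s
      using pos[of s] that r unfolding \<phi>_def by (auto simp: dist_real_def abs_minus_commute split: split_indicator)
    show "r / 2 \<le> Re (\<phi> s)" if "s \<in> ball pi (d / 2)" for s
    proof -
      have s: "\<bar>s - pi\<bar> < d / 2" using that by (simp add: dist_real_def abs_minus_commute)
      have "- (d / 2) < s - pi" "s - pi < d / 2" using s by (auto simp only: abs_less_iff)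
      then have "s \<in> {0..2*pi}" using d unfolding atLeastAtMost_iff by linarith
      then show ?thesis using pos[of s] s d by (simp add: \<phi>_def)
    qed
    show "\<phi> s = 0 \<or> ?u s \<le> ?q1" if "s \<notin> ball pi d" for s
    proof (cases "s \<in> {0..2*pi}")
      case True
      then have "cos \<bar>s - pi\<bar> \<le> cos d"
        using that d by (intro cos_monotone_0_pi_le) (auto simp: dist_real_def abs_le_iff)
      then show ?thesis unfolding u_eq by simp
    qed (simp add: \<phi>_def)
    show "?q2 \<le> ?u s" if "s \<in> ball pi (d / 2)" for s
    proof -
      have "cos (d / 2) \<le> cos \<bar>s - pi\<bar>"
        using that d by (intro cos_monotone_0_pi_le) (auto simp: dist_real_def abs_minus_commute)
      then show ?thesis unfolding u_eq by simp
    qed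
    show "0 \<le> ?q2" "0 \<le> ?q1"
      using cos_ge_minus_one[of d] cos_ge_minus_one[of "d / 2"] by (intro divide_nonneg_nonneg; linarith)+
  qed (use d r u01 in auto)
  moreover have "(\<integral>s. \<phi> s * of_real (?u s ^ N) \<partial>lborel) = 0" for N
  proof -
    have c: "continuous_on {0..2*pi} (\<lambda>s. f s * of_real (?u s ^ N))"
      by (intro continuous_intros continuous_on_subset[OF f]) auto
    have "(\<integral>s. \<phi> s * of_real (?u s ^ N) \<partial>lborel) =
        (\<integral>s. \<zeta> * (indicator {0..2*pi} s *\<^sub>R (f s * of_real (?u s ^ N))) \<partial>lborel)"
      by (intro Bochner_Integration.integral_cong) (auto simp: \<phi>_def)
    also have "\<dots> = \<zeta> * (\<integral>s. indicator {0..2*pi} s *\<^sub>R (f s * of_real (?u s ^ N)) \<partial>lborel)"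
      by (rule integral_mult_right_zero)
    also have "\<dots> = 0"
      unfolding lebesgue_integral_eq_integral(2)[OF c] using pw[of N 0] by simp
    finally show ?thesis .
  qed
  ultimately have "r / 2 * d * ?q2 ^ N \<le> ?q1 ^ N * (\<integral>s. norm (\<phi> s) \<partial>lborel)" for N
    by simp
  moreover have "?q1 < ?q2"
    using d cos_monotone_0_pi[of "d / 2" d] by simp
  moreover have "0 \<le> ?q1"
    using cos_ge_minus_one[of d] by (intro divide_nonneg_nonneg) linarith+
  ultimately show False
    using r d by (intro power_dominated_contradiction[of ?q1 ?q2 "r / 2 * d"]) auto
qed

text \<open>Translation multiplies each coefficient by a unimodular number, so any point can be
  moved to pi.\<close>

lemma fourier_coeff_eq_0_imp_zero:
  assumes f: "continuous_on UNIV f" and per: "\<And>x. f (x + 2 * pi) = f x"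
    and zero: "\<And>n. fourier_coeff f n = 0"
  shows "f x = 0"
proof -
  let ?a = "x - pi"
  let ?F = "\<lambda>s. f (s + ?a)"
  have "fourier_coeff ?F n = 0" for n
  proof -
    let ?h = "\<lambda>s. f s * cis (- (of_int n * (s - ?a)))"
    have "integral {0..2*pi} (\<lambda>s. f (s + ?a) * cis (- (of_int n * s))) = integral {0..2*pi} (\<lambda>s. ?h (s + ?a))"
      by simp
    also have "\<dots> = integral {0..2*pi} ?h"
    proof (rule integral_periodic_shift)
      show "continuous_on UNIV ?h" by (intro continuous_intros f)
      fix s
      have "cis (- (of_int n * (s + 2 * pi - ?a))) = cis (- (of_int n * (s - ?a))) * cis (2 * pi * of_int (- n))"
        by (simp add: cis_mult algebra_simps)
      also have "cis (2 * pi * of_int (- n)) = 1"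
        by (rule cis_multiple_2pi) simp
      finally show "?h (s + 2 * pi) = ?h s" by (simp add: per)
    qed simp
    also have "?h = (\<lambda>s. cis (of_int n * ?a) * (f s * cis (- (of_int n * s))))"
    proof
      fix s
      have "cis (- (of_int n * (s - ?a))) = cis (of_int n * ?a) * cis (- (of_int n * s))"
        by (simp add: cis_mult algebra_simps)
      then show "?h s = cis (of_int n * ?a) * (f s * cis (- (of_int n * s)))" by (simp add: ac_simps)
    qed
    also have "integral {0..2*pi} \<dots> = cis (of_int n * ?a) * integral {0..2*pi} (\<lambda>s. f s * cis (- (of_int n * s)))"
      by (rule integral_mult_right)
    also have "\<dots> = 0"
      using zero[of n] by (simp add: fourier_coeff_def)
    finally show ?thesis by (simp add: fourier_coeff_def)
  qed
  moreover have "continuous_on UNIV ?F"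
    by (intro continuous_on_compose2[OF f] continuous_intros) auto
  ultimately have "?F pi = 0"
    using fourier_coeff_eq_0_imp_zero_at_pi[of ?F] by blast
  then show ?thesis by simp
qed

lemma integral_cis_int: "integral {0..2*pi} (\<lambda>s. cis (of_int n * s)) = (if n = 0 then of_real (2 * pi) else 0)"
proof (cases "n = 0")
  case True
  have "integral {0..2*pi} (\<lambda>s. 1 :: complex) = (2 * pi) *\<^sub>R 1"
    using integral_unique[OF has_integral_const_real[of "1::complex" 0 "2*pi"]] by simp
  then show ?thesis using True by (simp add: of_real_def)
next
  case False
  have "((\<lambda>s. cis (of_int n * s)) has_integral
      (cis (of_int n * (2 * pi)) / (\<i> * of_int n) - cis (of_int n * 0) / (\<i> * of_int n))) {0..2*pi}"
  proof (rule fundamental_theorem_of_calculus[where f = "\<lambda>s. cis (of_int n * s) / (\<i> * of_int n)"])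
    fix s :: real
    have "((\<lambda>z. exp (\<i> * of_int n * z) / (\<i> * of_int n)) has_field_derivative exp (\<i> * of_int n * of_real s)) (at (of_real s))"
      using False by (auto intro!: derivative_eq_intros)
    from has_vector_derivative_real_field[OF this, of "{0..2*pi}"]
    show "((\<lambda>s. cis (of_int n * s) / (\<i> * of_int n)) has_vector_derivative cis (of_int n * s)) (at s within {0..2*pi})"
      by (simp add: cis_conv_exp mult.assoc)
  qed simp
  moreover have "cis (of_int n * (2 * pi)) = 1"
    using cis_multiple_2pi[of "of_int n"] by (simp add: mult.commute)
  ultimately show ?thesis using False by (simp add: integral_unique)
qed

lemma summable_on_power_abs_int:
  assumes "0 \<le> q" "q < (1::real)"
  shows "(\<lambda>n::int. q ^ nat \<bar>n\<bar>) summable_on UNIV"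
proof -
  have geo: "(\<lambda>m::nat. q ^ m) summable_on UNIV"
    using assms by (subst summable_on_UNIV_nonneg_real_iff) (auto simp: summable_geometric)
  have 1: "(\<lambda>n::int. q ^ nat \<bar>n\<bar>) summable_on range int"
    using geo by (subst summable_on_reindex) (auto simp: o_def)
  have inj: "inj (\<lambda>m. - int m)" by (simp add: inj_on_def)
  have 2: "(\<lambda>n::int. q ^ nat \<bar>n\<bar>) summable_on range (\<lambda>m. - int m)"
    using geo by (subst summable_on_reindex[OF inj]) (auto simp: o_def)
  have "(UNIV :: int set) = range int \<union> range (\<lambda>m. - int m)"
  proof -
    have "n \<in> range int \<union> range (\<lambda>m. - int m)" for n :: int
      by (cases n rule: int_cases2) auto
    then show ?thesis by blast
  qed
  then show ?thesis
    using summable_on_union[OF 1 2] by simp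
qed

text \<open>The series converges absolutely and uniformly to a continuous periodic function with the
  same coefficients; uniqueness of coefficients identifies it with f. The integers are enumerated by
  \<open>int_decode\<close> so that the tests for ordinary series apply.\<close>

lemma fourier_series:
  assumes f: "continuous_on UNIV f" and per: "\<And>x. f (x + 2 * pi) = f x"
    and bound: "\<And>n. norm (fourier_coeff f n) \<le> C * q ^ nat \<bar>n\<bar>" and q: "0 \<le> q" "q < 1"
  shows "((\<lambda>n. fourier_coeff f n * cis (of_int n * x)) has_sum f x) UNIV"
proof -
  let ?c = "fourier_coeff f"
  let ?t = "\<lambda>k x. ?c (int_decode k) * cis (of_int (int_decode k) * x)"
  let ?M = "\<lambda>k. C * q ^ nat \<bar>int_decode k\<bar>"
  have bij: "bij_betw int_decode UNIV UNIV"
    using bij_int_decode .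
  have M: "summable ?M"
  proof -
    have "(\<lambda>k. q ^ nat \<bar>int_decode k\<bar>) summable_on UNIV"
      using summable_on_power_abs_int[OF q] summable_on_reindex_bij_betw[OF bij, of "\<lambda>n. q ^ nat \<bar>n\<bar>"] by simp
    then have "summable (\<lambda>k. q ^ nat \<bar>int_decode k\<bar>)"
      using q by (simp add: summable_on_UNIV_nonneg_real_iff)
    then show ?thesis by (rule summable_mult)
  qed
  have le: "norm (?t k x) \<le> ?M k" for k x
    using bound by (simp add: norm_mult)
  define S where "S = (\<lambda>x. \<Sum>k. ?t k x)"
  have unif: "uniform_limit UNIV (\<lambda>n x. \<Sum>k<n. ?t k x) S sequentially"
    unfolding S_def by (rule Weierstrass_m_test[OF le M])
  have S_cont: "continuous_on UNIV S"
    by (rule uniform_limit_theorem[OF _ unif]) (auto intro!: always_eventually continuous_intros)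
  have S_sums: "(\<lambda>k. ?t k x) sums S x" for x
    unfolding S_def by (intro summable_sums summable_comparison_test'[OF M, of 0] le)
  have S_per: "S (x + 2 * pi) = S x" for x
  proof -
    have "cis (of_int n * (x + 2 * pi)) = cis (of_int n * x)" for n :: int
    proof -
      have "cis (of_int n * (x + 2 * pi)) = cis (of_int n * x) * cis (2 * pi * of_int n)"
        by (simp add: cis_mult algebra_simps)
      also have "cis (2 * pi * of_int n) = 1"
        by (rule cis_multiple_2pi) simp
      finally show ?thesis by simp
    qed
    then show ?thesis by (simp add: S_def)
  qed
  have S_coeff: "fourier_coeff S n = ?c n" for n
  proof -
    let ?e = "\<lambda>x. cis (- (of_int n * x))"
    have ul: "uniform_limit {0..2*pi} (\<lambda>m x. (\<Sum>k<m. ?t k x) * ?e x) (\<lambda>x. S x * ?e x) sequentially"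
    proof (rule uniform_lim_mult[OF uniform_limit_on_subset[OF unif subset_UNIV] uniform_limit_const])
      show "bounded (S ` {0..2*pi})"
        by (intro compact_imp_bounded compact_continuous_image continuous_on_subset[OF S_cont]) auto
      show "bounded (?e ` {0..2*pi})"
        by (intro compact_imp_bounded compact_continuous_image continuous_intros) auto
    qed
    have uc: "continuous_on {0..2*pi} (\<lambda>x. (\<Sum>k<m. ?t k x) * ?e x)" for m
      by (intro continuous_intros)
    obtain I J where I: "\<And>m. ((\<lambda>x. (\<Sum>k<m. ?t k x) * ?e x) has_integral I m) {0..2*pi}"
      and J: "((\<lambda>x. S x * ?e x) has_integral J) {0..2*pi}" and IJ: "I \<longlonglongrightarrow> J"
      using uniform_limit_integral[OF ul uc sequentially_bot] by blast
    have Im: "I m = (if n \<in> int_decode ` {..<m} then of_real (2 * pi) * ?c n else 0)" for m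
    proof -
      have hs: "((\<lambda>x. \<Sum>k<m. ?c (int_decode k) * cis (of_int (int_decode k - n) * x)) has_integral
          (\<Sum>k<m. ?c (int_decode k) * (if int_decode k - n = 0 then of_real (2 * pi) else 0))) {0..2*pi}"
      proof (intro has_integral_sum has_integral_mult_right)
        fix k
        have "(\<lambda>x. cis (of_int (int_decode k - n) * x)) integrable_on {0..2*pi}"
          by (intro integrable_continuous_real continuous_intros)
        from integrable_integral[OF this]
        show "((\<lambda>x. cis (of_int (int_decode k - n) * x)) has_integral (if int_decode k - n = 0 then of_real (2 * pi) else 0)) {0..2*pi}"
          unfolding integral_cis_int .
      qed simp
      have eqs: "(\<Sum>k<m. ?t k x) * ?e x = (\<Sum>k<m. ?c (int_decode k) * cis (of_int (int_decode k - n) * x))" for x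
        unfolding sum_distrib_right by (intro sum.cong refl) (simp add: mult.assoc cis_mult algebra_simps)
      have "I m = (\<Sum>k<m. ?c (int_decode k) * (if int_decode k - n = 0 then of_real (2 * pi) else 0))"
        by (rule has_integral_unique[OF I[of m, unfolded eqs] hs])
      also have "\<dots> = (\<Sum>j\<in>int_decode ` {..<m}. ?c j * (if j - n = 0 then of_real (2 * pi) else 0))"
        by (subst sum.reindex) (auto intro: inj_on_subset[OF inj_int_decode])
      also have "\<dots> = (if n \<in> int_decode ` {..<m} then of_real (2 * pi) * ?c n else 0)"
        by (simp add: if_distrib[of "\<lambda>z. ?c _ * z"] cong: if_cong)
      finally show ?thesis .
    qed
    have "\<forall>\<^sub>F m in sequentially. n \<in> int_decode ` {..<m}"
      by (rule eventually_sequentiallyI[of "Suc (int_encode n)"]) (metis image_eqI int_encode_inverse lessThan_iff Suc_le_lessD)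
    then have "\<forall>\<^sub>F m in sequentially. I m = of_real (2 * pi) * ?c n"
      by (rule eventually_mono) (simp only: Im if_True)
    then have "J = of_real (2 * pi) * ?c n"
      using IJ by (metis LIMSEQ_unique tendsto_eventually)
    then show ?thesis
      using J by (simp add: fourier_coeff_def[of S] integral_unique)
  qed
  have "f x - S x = 0"
  proof (rule fourier_coeff_eq_0_imp_zero[of "\<lambda>x. f x - S x"])
    show "continuous_on UNIV (\<lambda>x. f x - S x)"
      by (intro continuous_intros f S_cont)
    show "fourier_coeff (\<lambda>x. f x - S x) n = 0" for n
    proof -
      have "(\<lambda>s. f s * cis (- (of_int n * s))) integrable_on {0..2*pi}" "(\<lambda>s. S s * cis (- (of_int n * s))) integrable_on {0..2*pi}"
        by (intro integrable_continuous_real continuous_intros continuous_on_subset[OF f] continuous_on_subset[OF S_cont]; simp)+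
      then have "fourier_coeff (\<lambda>x. f x - S x) n = ?c n - fourier_coeff S n"
        by (simp add: fourier_coeff_def left_diff_distrib Henstock_Kurzweil_Integration.integral_diff diff_divide_distrib)
      then show ?thesis by (simp add: S_coeff)
    qed
  qed (simp add: per S_per)
  then have "(\<lambda>k. ?t k x) sums f x"
    using S_sums[of x] by simp
  moreover have "summable (\<lambda>k. norm (?t k x))"
    using le by (intro summable_comparison_test'[OF M, of 0]) auto
  ultimately have "((\<lambda>k. ?t k x) has_sum f x) UNIV"
    by (metis norm_summable_imp_has_sum)
  then show ?thesis
    using has_sum_reindex_bij_betw[OF bij, of "\<lambda>n. ?c n * cis (of_int n * x)"] by simp
qed

lemma norm_integral_le_length:
  fixes f :: "real \<Rightarrow> complex"
  assumes "continuous_on {0..2*pi} f" "\<And>s. norm (f s) \<le> B"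
  shows "norm (integral {0..2*pi} f) \<le> 2 * pi * B"
  using integral_bound[OF _ assms(1), of B] assms(2) by (simp add: mult.commute)

text \<open>Separate decay in each variable bounds the coefficient by q^max(|n|, |m|), and the
  maximum is at least half the sum: passing to the square root of q gives product decay. The sum is
  kept iterated, with \<open>b n y\<close> as the inner sum.\<close>

lemma double_fourier_series:
  fixes \<Phi> :: "real \<Rightarrow> real \<Rightarrow> complex"
  assumes cont: "continuous_on UNIV (\<lambda>(x, y). \<Phi> x y)"
    and per: "\<And>x y. \<Phi> (x + 2 * pi) y = \<Phi> x y" "\<And>x y. \<Phi> x (y + 2 * pi) = \<Phi> x y"
    and bound1: "\<And>y n. norm (fourier_coeff (\<lambda>x. \<Phi> x y) n) \<le> C * q ^ nat \<bar>n\<bar>"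
    and bound2: "\<And>x n. norm (fourier_coeff (\<lambda>y. \<Phi> x y) n) \<le> C * q ^ nat \<bar>n\<bar>"
    and q: "0 \<le> q" "q < 1"
  obtains c b where "\<And>n m. norm (c n m) \<le> C * (sqrt q ^ nat \<bar>n\<bar> * sqrt q ^ nat \<bar>m\<bar>)"
    "\<And>n y. ((\<lambda>m. c n m * cis (of_int m * y)) has_sum b n y) UNIV"
    "\<And>x y. ((\<lambda>n. b n y * cis (of_int n * x)) has_sum \<Phi> x y) UNIV"
proof -
  have C: "0 \<le> C"
    using order.trans[OF norm_ge_zero bound1[of 0 0]] by simp
  have cont2: "continuous_on A (\<lambda>z. \<Phi> (f z) (h z))" if "continuous_on A f" "continuous_on A h"
    for A :: "'c::topological_space set" and f h
    using continuous_on_compose2[OF cont continuous_on_Pair[OF that] subset_UNIV] by simp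
  define b where "b = (\<lambda>n y. fourier_coeff (\<lambda>x. \<Phi> x y) n)"
  define c where "c = (\<lambda>n m. fourier_coeff (b n) m)"
  have b_cont: "continuous_on UNIV (b n)" for n
  proof -
    have "continuous_on (UNIV \<times> cbox 0 (2 * pi)) (\<lambda>(y, x). \<Phi> x y * cis (- (of_int n * x)))"
      unfolding split_beta by (intro continuous_intros cont2)
    from integral_continuous_on_param[OF this] show ?thesis
      unfolding b_def fourier_coeff_def by (intro continuous_intros) simp_all
  qed
  have b_per: "b n (y + 2 * pi) = b n y" for n y
    by (simp add: b_def per)
  have c1: "norm (c n m) \<le> C * q ^ nat \<bar>n\<bar>" for n m
  proof -
    have "norm (integral {0..2*pi} (\<lambda>s. b n s * cis (- (of_int m * s)))) \<le> 2 * pi * (C * q ^ nat \<bar>n\<bar>)"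
      by (intro norm_integral_le_length continuous_intros continuous_on_subset[OF b_cont])
         (use bound1 in \<open>auto simp: norm_mult b_def\<close>)
    then show ?thesis
      by (simp add: c_def fourier_coeff_def[of "b n"] norm_divide norm_mult field_simps)
  qed
  \<comment> \<open>\<open>c\<close> is defined by transforming in x first; decay in m becomes
    visible after interchanging the integrals.\<close>
  have c2: "norm (c n m) \<le> C * q ^ nat \<bar>m\<bar>" for n m
  proof -
    let ?f = "\<lambda>x y. \<Phi> x y * cis (- (of_int n * x)) * cis (- (of_int m * y))"
    let ?b = "\<lambda>x. fourier_coeff (\<lambda>y. \<Phi> x y) m"
    have sw: "integral {0..2*pi} (\<lambda>x. integral {0..2*pi} (\<lambda>y. ?f x y)) = integral {0..2*pi} (\<lambda>y. integral {0..2*pi} (\<lambda>x. ?f x y))"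
    proof -
      have "continuous_on (cbox (0, 0) (2*pi, 2*pi)) (\<lambda>(x, y). ?f x y)"
        unfolding split_beta by (intro continuous_intros cont2)
      from integral_swap_continuous[OF this] show ?thesis by simp
    qed
    have 1: "integral {0..2*pi} (\<lambda>y. ?f x y) = of_real (2 * pi) * (?b x * cis (- (of_int n * x)))" for x
    proof -
      have "integral {0..2*pi} (\<lambda>y. ?f x y) = integral {0..2*pi} (\<lambda>y. cis (- (of_int n * x)) * (\<Phi> x y * cis (- (of_int m * y))))"
        by (simp add: ac_simps)
      also have "\<dots> = cis (- (of_int n * x)) * integral {0..2*pi} (\<lambda>y. \<Phi> x y * cis (- (of_int m * y)))"
        by (rule integral_mult_right)
      finally show ?thesis by (simp add: fourier_coeff_def)
    qed
    have 2: "integral {0..2*pi} (\<lambda>x. ?f x y) = of_real (2 * pi) * (b n y * cis (- (of_int m * y)))" for y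
    proof -
      have "integral {0..2*pi} (\<lambda>x. ?f x y) = integral {0..2*pi} (\<lambda>x. cis (- (of_int m * y)) * (\<Phi> x y * cis (- (of_int n * x))))"
        by (simp add: ac_simps)
      also have "\<dots> = cis (- (of_int m * y)) * integral {0..2*pi} (\<lambda>x. \<Phi> x y * cis (- (of_int n * x)))"
        by (rule integral_mult_right)
      finally show ?thesis by (simp add: fourier_coeff_def b_def)
    qed
    have "integral {0..2*pi} (\<lambda>y. b n y * cis (- (of_int m * y))) = integral {0..2*pi} (\<lambda>x. ?b x * cis (- (of_int n * x)))"
      using sw unfolding 1 2 integral_mult_right by simp
    moreover have "norm (integral {0..2*pi} (\<lambda>x. ?b x * cis (- (of_int n * x)))) \<le> 2 * pi * (C * q ^ nat \<bar>m\<bar>)"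
    proof (intro norm_integral_le_length continuous_intros)
      have "continuous_on (UNIV \<times> cbox 0 (2 * pi)) (\<lambda>(x, y). \<Phi> x y * cis (- (of_int m * y)))"
        unfolding split_beta by (intro continuous_intros cont2)
      from integral_continuous_on_param[OF this] have "continuous_on UNIV ?b"
        unfolding fourier_coeff_def by (intro continuous_intros) simp_all
      then show "continuous_on {0..2*pi} ?b" by (rule continuous_on_subset) simp
    qed (use bound2 in \<open>auto simp: norm_mult\<close>)
    ultimately show ?thesis
      by (simp add: c_def fourier_coeff_def[of "b n"] norm_divide norm_mult field_simps)
  qed
  show ?thesis
  proof (rule that[of c b])
    show "norm (c n m) \<le> C * (sqrt q ^ nat \<bar>n\<bar> * sqrt q ^ nat \<bar>m\<bar>)" for n m
    proof -
      have *: "q ^ max a b \<le> sqrt q ^ a * sqrt q ^ b" for a b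
      proof -
        have "q ^ max a b = sqrt q ^ (2 * max a b)"
          using q by (simp add: power_mult)
        also have "\<dots> \<le> sqrt q ^ (a + b)"
          using q by (intro power_decreasing) auto
        finally show ?thesis by (simp add: power_add)
      qed
      have "norm (c n m) \<le> C * q ^ max (nat \<bar>n\<bar>) (nat \<bar>m\<bar>)"
        using c1[of n m] c2[of n m] by (simp add: max_def)
      also have "\<dots> \<le> C * (sqrt q ^ nat \<bar>n\<bar> * sqrt q ^ nat \<bar>m\<bar>)"
        by (intro mult_left_mono * C)
      finally show ?thesis .
    qed
    show "((\<lambda>m. c n m * cis (of_int m * y)) has_sum b n y) UNIV" for n y
      unfolding c_def
      by (rule fourier_series[of "b n" C q]) (use b_cont b_per c2[unfolded c_def] q in auto)
    show "((\<lambda>n. b n y * cis (of_int n * x)) has_sum \<Phi> x y) UNIV" for x y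
      unfolding b_def by (rule fourier_series[of "\<lambda>x. \<Phi> x y" C q]) (auto intro!: cont2 continuous_intros simp: per bound1 q)
  qed
qed

subsection \<open>From decaying Fourier coefficients to power series\<close>

lemma has_sum_times:
  fixes u :: "'a \<Rightarrow> complex" and v :: "'b \<Rightarrow> complex"
  assumes u: "(u has_sum a) UNIV" and v: "(v has_sum b) UNIV"
    and sm: "(\<lambda>(j, k). u j * v k) summable_on UNIV"
  shows "((\<lambda>(j, k). u j * v k) has_sum (a * b)) UNIV"
proof -
  obtain s where s: "((\<lambda>(j, k). u j * v k) has_sum s) (UNIV \<times> UNIV)"
    using sm by (auto simp: summable_on_def)
  have "((\<lambda>j. u j * b) has_sum s) UNIV"
    by (rule has_sum_SigmaD[OF s]) (simp add: has_sum_cmult_right v)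
  then have "s = a * b"
    using has_sum_unique has_sum_cmult_left[OF u] by blast
  then show ?thesis using s by simp
qed

lemma summable_on_times_nonneg:
  fixes u :: "'a \<Rightarrow> real" and v :: "'b \<Rightarrow> real"
  assumes u: "u summable_on UNIV" "\<And>j. 0 \<le> u j" and v: "v summable_on UNIV" "\<And>k. 0 \<le> v k"
  shows "(\<lambda>(j, k). u j * v k) summable_on UNIV"
proof -
  have "(\<lambda>(j, k). u j * v k) summable_on (UNIV \<times> UNIV)"
  proof (rule summable_on_SigmaI)
    show "((\<lambda>k. case (j, k) of (j, k) \<Rightarrow> u j * v k) has_sum u j * infsum v UNIV) UNIV" for j
      using has_sum_cmult_right[OF has_sum_infsum[OF v(1)]] by simp
    show "(\<lambda>j. u j * infsum v UNIV) summable_on UNIV"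
      using has_sum_cmult_left[OF has_sum_infsum[OF u(1)]] by (auto simp: summable_on_def)
  qed (use u v in auto)
  then show ?thesis by simp
qed

text \<open>e^(in Arcsin z) is holomorphic in the unit disc, and on a small disc Arcsin is at most
  \<delta> in modulus, so the function is at most e^(\<delta>|n|) there and Cauchy's inequality
  applies. The growth in n can be made as slow as desired by shrinking \<rho>, which does not depend
  on n.\<close>

lemma cis_arcsin_power_series:
  assumes "\<delta> > 0"
  obtains \<rho> \<alpha> where "0 < \<rho>" "\<rho> < 1"
    "\<And>(n::int) (j::nat). norm (\<alpha> n j :: complex) \<le> exp \<delta> ^ nat \<bar>n\<bar> * (1 / \<rho>) ^ j"
    "\<And>n x. \<bar>x\<bar> < \<rho> \<Longrightarrow> (\<lambda>j. \<alpha> n j * of_real x ^ j) sums cis (of_int n * arcsin x)"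
proof -
  have hol: "Arcsin holomorphic_on ball 0 1"
  proof (rule holomorphic_on_Arcsin)
    fix z assume "z \<in> ball (0::complex) 1" "Im z = 0"
    then show "\<bar>Re z\<bar> < 1" using abs_Re_le_cmod[of z] by simp
  qed
  have "continuous_on (ball 0 1) Arcsin"
    by (rule holomorphic_on_imp_continuous_on[OF hol])
  then have "isCont Arcsin 0"
    by (simp add: continuous_on_eq_continuous_at)
  then obtain d where d: "d > 0" "\<And>z. norm (z::complex) < d \<Longrightarrow> norm (Arcsin z) < \<delta>"
    using assms unfolding continuous_at_eps_delta dist_norm by fastforce
  define \<rho> where "\<rho> = min d 1 / 2"
  have \<rho>: "0 < \<rho>" "\<rho> < 1" "\<rho> < d" using d by (auto simp: \<rho>_def)
  define E where "E = (\<lambda>(n::int) z. exp (\<i> * of_int n * Arcsin z))"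
  have E_hol: "E n holomorphic_on ball 0 1" for n
    unfolding E_def by (intro holomorphic_intros hol)
  define \<alpha> where "\<alpha> = (\<lambda>n j. (deriv ^^ j) (E n) 0 / fact j)"
  show ?thesis
  proof (rule that[OF \<rho>(1,2), of \<alpha>])
    fix n j
    have "norm ((deriv ^^ j) (E n) 0) \<le> fact j * exp \<delta> ^ nat \<bar>n\<bar> / \<rho> ^ j"
    proof (rule Cauchy_inequality)
      show "E n holomorphic_on ball 0 \<rho>"
        using E_hol \<rho> by (rule_tac holomorphic_on_subset) auto
      show "continuous_on (cball 0 \<rho>) (E n)"
        using holomorphic_on_imp_continuous_on[OF E_hol[of n]] \<rho> by (rule_tac continuous_on_subset) auto
      fix z :: complex assume "norm (0 - z) = \<rho>"
      then have "norm (Arcsin z) \<le> \<delta>"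
        using d(2)[of z] \<rho> by simp
      then have "norm (\<i> * of_int n * Arcsin z) \<le> real (nat \<bar>n\<bar>) * \<delta>"
        by (simp add: norm_mult mult_left_mono)
      then have "norm (E n z) \<le> exp (real (nat \<bar>n\<bar>) * \<delta>)"
        unfolding E_def by (intro order.trans[OF norm_exp]) simp
      then show "norm (E n z) \<le> exp \<delta> ^ nat \<bar>n\<bar>"
        by (simp only: exp_of_nat_mult)
    qed (use \<rho> in simp)
    then show "norm (\<alpha> n j) \<le> exp \<delta> ^ nat \<bar>n\<bar> * (1 / \<rho>) ^ j"
      using \<rho> by (simp add: \<alpha>_def norm_divide field_simps)
  next
    fix n :: int and x :: real assume x: "\<bar>x\<bar> < \<rho>"
    have "(\<lambda>j. (deriv ^^ j) (E n) 0 / fact j * (of_real x - 0) ^ j) sums E n (of_real x)"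
      using x \<rho> by (intro holomorphic_power_series[OF E_hol]) auto
    moreover have "E n (of_real x) = cis (of_int n * arcsin x)"
      using x \<rho> of_real_arcsin[of x] by (simp add: E_def cis_conv_exp ac_simps)
    ultimately show "(\<lambda>j. \<alpha> n j * of_real x ^ j) sums cis (of_int n * arcsin x)"
      by (simp add: \<alpha>_def)
  qed
qed

text \<open>Expanding each character of arcsin gives a fourfold series in n, m, j, k. It converges
  absolutely, so it may be summed over n, m first, which yields the power series, or over j, k
  first, which returns the double Fourier series.\<close>

lemma double_arcsin_series:
  fixes c :: "int \<Rightarrow> int \<Rightarrow> complex"
  assumes c: "\<And>n m. norm (c n m) \<le> C * (p ^ nat \<bar>n\<bar> * p ^ nat \<bar>m\<bar>)" and p: "0 < p" "p < 1"
  obtains a \<rho> where "0 < \<rho>" "\<rho> < 1"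
    "\<And>x y b \<Phi>. \<bar>x\<bar> < \<rho> \<Longrightarrow> \<bar>y\<bar> < \<rho> \<Longrightarrow>
      (\<And>n. ((\<lambda>m. c n m * cis (of_int m * arcsin y)) has_sum b n) UNIV) \<Longrightarrow>
      ((\<lambda>n. b n * cis (of_int n * arcsin x)) has_sum \<Phi>) UNIV \<Longrightarrow>
      (\<lambda>(j, k). norm (a j k * of_real (x ^ j * y ^ k))) summable_on UNIV \<and>
      ((\<lambda>(j, k). a j k * of_real (x ^ j * y ^ k)) has_sum \<Phi>) UNIV"
proof -
  have C: "0 \<le> C"
    using order.trans[OF norm_ge_zero c[of 0 0]] by simp
  \<comment> \<open>Chosen so that p e^\<delta> is the square root of p: half of the decay of the
    coefficients absorbs the growth of the expansions.\<close>
  define \<delta> where "\<delta> = - ln p / 2"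
  have \<delta>: "\<delta> > 0" using p by (simp add: \<delta>_def)
  define \<kappa> where "\<kappa> = p * exp \<delta>"
  have \<kappa>: "0 < \<kappa>" "\<kappa> < 1"
  proof -
    have "\<kappa> = exp (ln p) * exp (- ln p / 2)"
      using p by (simp add: \<kappa>_def \<delta>_def)
    also have "\<dots> = exp (ln p / 2)"
      unfolding exp_add[symmetric] by simp
    finally have "\<kappa> = exp (ln p / 2)" .
    then show "0 < \<kappa>" "\<kappa> < 1" using p by simp_all
  qed
  obtain \<rho> \<alpha> where \<rho>: "0 < \<rho>" "\<rho> < 1"
    and \<alpha>: "\<And>(n::int) (j::nat). norm (\<alpha> n j :: complex) \<le> exp \<delta> ^ nat \<bar>n\<bar> * (1 / \<rho>) ^ j"
    and ser: "\<And>n x. \<bar>x\<bar> < \<rho> \<Longrightarrow> (\<lambda>j. \<alpha> n j * of_real x ^ j) sums cis (of_int n * arcsin x)"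
  proof (rule cis_arcsin_power_series[OF \<delta>], goal_cases)
    case (1 \<rho> \<alpha>)
    show ?case by (rule 1(1)[OF 1(2,3)]) (rule 1(4), rule 1(5))
  qed
  let ?U = "\<lambda>(n::int, m::int). \<kappa> ^ nat \<bar>n\<bar> * \<kappa> ^ nat \<bar>m\<bar>"
  have U: "?U summable_on UNIV" "\<And>z. 0 \<le> ?U z"
    using \<kappa> by (auto intro!: summable_on_times_nonneg summable_on_power_abs_int)
  have term_le: "norm (c n m * \<alpha> n j * \<alpha> m k) \<le> C * ?U (n, m) * ((1 / \<rho>) ^ j * (1 / \<rho>) ^ k)" for n m j k
  proof -
    have "norm (c n m * \<alpha> n j * \<alpha> m k) \<le> (C * (p ^ nat \<bar>n\<bar> * p ^ nat \<bar>m\<bar>)) * (exp \<delta> ^ nat \<bar>n\<bar> * (1 / \<rho>) ^ j) * (exp \<delta> ^ nat \<bar>m\<bar> * (1 / \<rho>) ^ k)"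
      unfolding norm_mult using C p \<rho> by (intro mult_mono c \<alpha> mult_nonneg_nonneg) auto
    also have "\<dots> = C * ?U (n, m) * ((1 / \<rho>) ^ j * (1 / \<rho>) ^ k)"
      by (simp only: \<kappa>_def power_mult_distrib prod.case ac_simps)
    finally show ?thesis .
  qed
  define a where "a = (\<lambda>j k. infsum (\<lambda>(n, m). c n m * \<alpha> n j * \<alpha> m k) UNIV)"
  have a_sum: "((\<lambda>(n, m). c n m * \<alpha> n j * \<alpha> m k) has_sum a j k) UNIV" for j k
  proof -
    have "(\<lambda>z. C * ((1 / \<rho>) ^ j * (1 / \<rho>) ^ k) * ?U z) summable_on UNIV"
      by (intro summable_on_cmult_right U)
    then have "(\<lambda>z. norm (case z of (n, m) \<Rightarrow> c n m * \<alpha> n j * \<alpha> m k)) summable_on UNIV"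
    proof (rule Infinite_Sum.abs_summable_on_comparison_test')
      fix z :: "int \<times> int"
      obtain n m where z: "z = (n, m)" by (cases z)
      show "norm (case z of (n, m) \<Rightarrow> c n m * \<alpha> n j * \<alpha> m k) \<le> C * ((1 / \<rho>) ^ j * (1 / \<rho>) ^ k) * ?U z"
        using term_le[of n m j k] unfolding z prod.case by (simp only: ac_simps)
    qed
    then show ?thesis
      unfolding a_def by (rule has_sum_infsum[OF Infinite_Sum.abs_summable_summable])
  qed
  define D where "D = C * infsum ?U UNIV"
  have a_le: "norm (a j k) \<le> D * ((1 / \<rho>) ^ j * (1 / \<rho>) ^ k)" for j k
  proof -
    have hs: "((\<lambda>z. C * ((1 / \<rho>) ^ j * (1 / \<rho>) ^ k) * ?U z) has_sum (C * ((1 / \<rho>) ^ j * (1 / \<rho>) ^ k) * infsum ?U UNIV)) UNIV"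
      by (intro has_sum_cmult_right has_sum_infsum U)
    have "norm (a j k) \<le> C * ((1 / \<rho>) ^ j * (1 / \<rho>) ^ k) * infsum ?U UNIV"
    proof (rule norm_infsum_le[OF a_sum hs])
      fix z :: "int \<times> int"
      obtain n m where z: "z = (n, m)" by (cases z)
      show "norm (case z of (n, m) \<Rightarrow> c n m * \<alpha> n j * \<alpha> m k) \<le> C * ((1 / \<rho>) ^ j * (1 / \<rho>) ^ k) * ?U z"
        using term_le[of n m j k] unfolding z prod.case by (simp only: ac_simps)
    qed
    then show ?thesis by (simp add: D_def ac_simps)
  qed
  show ?thesis
  proof (rule that[OF \<rho>, of a])
    fix x y b \<Phi>
    assume x: "\<bar>x\<bar> < \<rho>" and y: "\<bar>y\<bar> < \<rho>"
      and b: "\<And>n. ((\<lambda>m. c n m * cis (of_int m * arcsin y)) has_sum b n) UNIV"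
      and \<Phi>: "((\<lambda>n. b n * cis (of_int n * arcsin x)) has_sum \<Phi>) UNIV"
    define X Y where "X = \<bar>x\<bar> / \<rho>" and "Y = \<bar>y\<bar> / \<rho>"
    have XY: "0 \<le> X" "X < 1" "0 \<le> Y" "Y < 1"
      using x y \<rho> by (auto simp: X_def Y_def)
    let ?W = "\<lambda>(j::nat, k::nat). X ^ j * Y ^ k"
    have geo: "(\<lambda>j. X ^ j) summable_on UNIV" "(\<lambda>k. Y ^ k) summable_on UNIV"
      using XY by (subst summable_on_UNIV_nonneg_real_iff; simp add: summable_geometric)+
    have W: "?W summable_on UNIV" "\<And>z. 0 \<le> ?W z"
      using XY geo by (auto intro!: summable_on_times_nonneg)
    have xy: "\<bar>x ^ j * y ^ k\<bar> * ((1 / \<rho>) ^ j * (1 / \<rho>) ^ k) = ?W (j, k)" for j k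
      by (simp add: X_def Y_def abs_mult power_abs power_divide)
    have "(\<lambda>z. D * ?W z) summable_on UNIV"
      by (intro summable_on_cmult_right W)
    then have "(\<lambda>z. norm (case z of (j, k) \<Rightarrow> a j k * of_real (x ^ j * y ^ k))) summable_on UNIV"
    proof (rule Infinite_Sum.abs_summable_on_comparison_test')
      fix z :: "nat \<times> nat"
      obtain j k where z: "z = (j, k)" by (cases z)
      have "norm (a j k * of_real (x ^ j * y ^ k)) \<le> D * ((1 / \<rho>) ^ j * (1 / \<rho>) ^ k) * \<bar>x ^ j * y ^ k\<bar>"
        unfolding norm_mult norm_of_real by (intro mult_right_mono a_le) auto
      also have "\<dots> = D * ?W (j, k)"
        unfolding xy[symmetric] by (simp add: ac_simps)
      finally show "norm (case z of (j, k) \<Rightarrow> a j k * of_real (x ^ j * y ^ k)) \<le> D * ?W z"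
        by (simp add: z)
    qed
    then have abs: "(\<lambda>(j, k). norm (a j k * of_real (x ^ j * y ^ k))) summable_on UNIV"
      by (simp only: case_prod_unfold)
    \<comment> \<open>The full fourfold family, dominated by a product of four geometric families,
      two in n and m and two in j and k.\<close>
    define f where "f = (\<lambda>((n, m), (j, k)). c n m * \<alpha> n j * \<alpha> m k * of_real (x ^ j * y ^ k))"
    have f_sum: "f summable_on UNIV"
    proof -
      have "(\<lambda>(z, w). ?U z * ?W w) summable_on UNIV"
        by (intro summable_on_times_nonneg U W)
      then have "(\<lambda>z. C * (case z of (z, w) \<Rightarrow> ?U z * ?W w)) summable_on UNIV"
        by (rule summable_on_cmult_right)
      then have "(\<lambda>z. norm (f z)) summable_on UNIV"
      proof (rule Infinite_Sum.abs_summable_on_comparison_test')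
        fix z :: "(int \<times> int) \<times> (nat \<times> nat)"
        obtain n m j k where z: "z = ((n, m), (j, k))" by (metis prod.exhaust)
        have "norm (f z) \<le> C * ?U (n, m) * ((1 / \<rho>) ^ j * (1 / \<rho>) ^ k) * \<bar>x ^ j * y ^ k\<bar>"
          unfolding f_def z prod.case norm_mult[of "_ * _ * _"] norm_of_real by (intro mult_right_mono term_le[unfolded prod.case]) auto
        also have "\<dots> = C * (?U (n, m) * ?W (j, k))"
          unfolding xy[symmetric] by (simp only: ac_simps)
        finally show "norm (f z) \<le> C * (case z of (z, w) \<Rightarrow> ?U z * ?W w)"
          by (simp add: z)
      qed
      then show ?thesis by (rule Infinite_Sum.abs_summable_summable)
    qed
    then obtain S where S: "(f has_sum S) (UNIV \<times> UNIV)"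
      by (auto simp: summable_on_def)
    have cisx: "((\<lambda>j. \<alpha> n j * of_real x ^ j) has_sum cis (of_int n * arcsin x)) UNIV" if "\<bar>x\<bar> < \<rho>" for n x
    proof -
      have "summable (\<lambda>j. norm (\<alpha> n j * of_real x ^ j))"
      proof (rule summable_comparison_test'[where N = 0])
        show "summable (\<lambda>j. exp \<delta> ^ nat \<bar>n\<bar> * (\<bar>x\<bar> / \<rho>) ^ j)"
          using that \<rho> by (intro summable_mult summable_geometric) auto
        show "norm (norm (\<alpha> n j * of_real x ^ j)) \<le> exp \<delta> ^ nat \<bar>n\<bar> * (\<bar>x\<bar> / \<rho>) ^ j" for j
          using mult_right_mono[OF \<alpha>[of n j], of "\<bar>x\<bar> ^ j"]
          by (simp add: norm_mult norm_power power_divide)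
      qed
      from norm_summable_imp_has_sum[OF this ser[OF that]] show ?thesis .
    qed
    have "((\<lambda>(n, m). c n m * (cis (of_int n * arcsin x) * cis (of_int m * arcsin y))) has_sum S) UNIV"
    proof (rule has_sum_SigmaD[OF S], goal_cases)
      case (1 z)
      obtain n m where z: "z = (n, m)" by (cases z)
      have sm: "(\<lambda>w. f (z, w)) summable_on UNIV"
        using summable_on_SigmaD1[of "\<lambda>z w. f (z, w)" UNIV "\<lambda>_. UNIV" z] f_sum by simp
      \<comment> \<open>Summability over (j, k) is known for the terms that contain c n m, but the
        product formula needs it without that factor. It is cancelled, which requires the zero case
        to be set apart.\<close>
      show ?case
      proof (cases "c n m = 0")
        case True
        then show ?thesis by (simp add: z f_def split_beta)
      next
        case False
        have e: "f (z, w) = c n m * (case w of (j, k) \<Rightarrow> (\<alpha> n j * of_real x ^ j) * (\<alpha> m k * of_real y ^ k))" for w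
          by (cases w) (simp add: z f_def ac_simps)
        have aux: "inverse (c n m) * (c n m * X) = X" for X
          using False by (metis left_inverse mult.assoc mult_1)
        have "(\<lambda>w. inverse (c n m) * f (z, w)) summable_on UNIV"
          by (intro summable_on_cmult_right sm)
        then have "(\<lambda>(j, k). (\<alpha> n j * of_real x ^ j) * (\<alpha> m k * of_real y ^ k)) summable_on UNIV"
          unfolding e aux .
        from has_sum_times[OF cisx[OF x] cisx[OF y] this]
        show ?thesis
          unfolding e by (simp add: z has_sum_cmult_right)
      qed
    qed
    then have S2: "((\<lambda>(n, m). c n m * (cis (of_int n * arcsin x) * cis (of_int m * arcsin y))) has_sum S) (UNIV \<times> UNIV)"
      by simp
    have "((\<lambda>n. b n * cis (of_int n * arcsin x)) has_sum S) UNIV"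
    proof (rule has_sum_SigmaD[OF S2])
      fix n :: int
      have "((\<lambda>m. c n m * cis (of_int m * arcsin y) * cis (of_int n * arcsin x)) has_sum b n * cis (of_int n * arcsin x)) UNIV"
        by (rule has_sum_cmult_left[OF b])
      then show "((\<lambda>m. case (n, m) of (n, m) \<Rightarrow> c n m * (cis (of_int n * arcsin x) * cis (of_int m * arcsin y))) has_sum
          b n * cis (of_int n * arcsin x)) UNIV"
        by (simp add: mult.assoc mult.commute[of "cis (of_int n * arcsin x)"])
    qed
    then have "S = \<Phi>"
      using \<Phi> has_sum_unique by blast
    have "((\<lambda>(w, z). f (z, w)) has_sum S) (UNIV \<times> UNIV)"
      by (rule has_sum_swap[THEN iffD1, OF S])
    then have "((\<lambda>w. case w of (j, k) \<Rightarrow> a j k * of_real (x ^ j * y ^ k)) has_sum S) UNIV"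
    proof (rule has_sum_SigmaD, goal_cases)
      case (1 w)
      obtain j k where w: "w = (j, k)" by (cases w)
      show ?case
        using has_sum_cmult_left[OF a_sum[of j k], of "of_real (x ^ j * y ^ k)"]
        by (simp add: w f_def split_beta)
    qed
    then show "(\<lambda>(j, k). norm (a j k * of_real (x ^ j * y ^ k))) summable_on UNIV \<and>
      ((\<lambda>(j, k). a j k * of_real (x ^ j * y ^ k)) has_sum \<Phi>) UNIV"
      using abs \<open>S = \<Phi>\<close> by simp
  qed
qed

text \<open>Two instances of the hypothesis suffice: \<sigma> = 1 with \<tau> = i sin y makes the
  first coordinate oscillate with the second frozen, and \<sigma> = i with \<tau> = sin x does the
  converse. Both freezing values have modulus at most 1.\<close>

lemma real_analytic_at_of_coeff_decay:
  fixes \<Psi> :: "complex \<Rightarrow> complex"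
  assumes cont: "continuous_on UNIV \<Psi>" and r: "0 < r" and q: "0 \<le> q" "q < 1"
    and decay: "\<And>\<sigma> \<tau> N. norm \<sigma> \<le> 1 \<Longrightarrow> norm \<tau> \<le> 1 \<Longrightarrow>
      norm (fourier_coeff (\<lambda>\<theta>. \<Psi> (Complex s0 t0 + of_real r * (\<sigma> * of_real (sin \<theta>) + \<tau>))) N) \<le> C * q ^ nat \<bar>N\<bar>"
  shows "\<exists>a :: nat \<Rightarrow> nat \<Rightarrow> complex. \<forall>\<^sub>F (s, t) in nhds (s0, t0).
     (\<lambda>(j, k). norm (a j k * of_real ((s - s0) ^ j * (t - t0) ^ k))) summable_on UNIV \<and>
     ((\<lambda>(j, k). a j k * of_real ((s - s0) ^ j * (t - t0) ^ k)) has_sum \<Psi> (Complex s t)) UNIV"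
proof -
  \<comment> \<open>The later choice of \<delta> takes a logarithm, so the ratio is made positive;
    1/4 is an arbitrary number in (0, 1).\<close>
  define q' where "q' = max q (1 / 4)"
  have q': "0 < q'" "q' < 1" "q \<le> q'" using q by (auto simp: q'_def)
  have C: "0 \<le> C"
    using order.trans[OF norm_ge_zero decay[of 0 0 0]] by simp
  have decay': "norm (fourier_coeff (\<lambda>\<theta>. \<Psi> (Complex s0 t0 + of_real r * (\<sigma> * of_real (sin \<theta>) + \<tau>))) N) \<le> C * q' ^ nat \<bar>N\<bar>"
    if "norm \<sigma> \<le> 1" "norm \<tau> \<le> 1" for \<sigma> \<tau> N
    using decay[OF that, of N] mult_left_mono[OF power_mono[OF q'(3) q(1), of "nat \<bar>N\<bar>"] C] by linarith
  define \<Phi> where "\<Phi> = (\<lambda>x y. \<Psi> (Complex s0 t0 + of_real r * (of_real (sin x) + \<i> * of_real (sin y))))"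
  obtain c b where c: "\<And>n m. norm (c n m) \<le> C * (sqrt q' ^ nat \<bar>n\<bar> * sqrt q' ^ nat \<bar>m\<bar>)"
    and b: "\<And>n y. ((\<lambda>m. c n m * cis (of_int m * y)) has_sum b n y) UNIV"
    and \<Phi>: "\<And>x y. ((\<lambda>n. b n y * cis (of_int n * x)) has_sum \<Phi> x y) UNIV"
  proof (rule double_fourier_series[of \<Phi> C q'])
    show "continuous_on UNIV (\<lambda>(x, y). \<Phi> x y)"
      unfolding \<Phi>_def split_beta by (intro continuous_on_compose2[OF cont] continuous_intros) auto
    show "norm (fourier_coeff (\<lambda>x. \<Phi> x y) n) \<le> C * q' ^ nat \<bar>n\<bar>" for y n
      using decay'[of 1 "\<i> * of_real (sin y)" n] by (simp add: \<Phi>_def norm_mult)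
    show "norm (fourier_coeff (\<lambda>y. \<Phi> x y) n) \<le> C * q' ^ nat \<bar>n\<bar>" for x n
      using decay'[of \<i> "of_real (sin x)" n] by (simp add: \<Phi>_def norm_mult add.commute)
  qed (use q' in \<open>auto simp: \<Phi>_def\<close>)
  have sq: "0 < sqrt q'" "sqrt q' < 1" using q' by auto
  obtain a \<rho> where \<rho>: "0 < \<rho>" "\<rho> < 1"
    and a: "\<And>x y b \<Phi>. \<bar>x\<bar> < \<rho> \<Longrightarrow> \<bar>y\<bar> < \<rho> \<Longrightarrow>
      (\<And>n. ((\<lambda>m. c n m * cis (of_int m * arcsin y)) has_sum b n) UNIV) \<Longrightarrow>
      ((\<lambda>n. b n * cis (of_int n * arcsin x)) has_sum \<Phi>) UNIV \<Longrightarrow>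
      (\<lambda>(j, k). norm (a j k * of_real (x ^ j * y ^ k))) summable_on UNIV \<and>
      ((\<lambda>(j, k). a j k * of_real (x ^ j * y ^ k)) has_sum \<Phi>) UNIV"
  proof (rule double_arcsin_series[OF c sq], goal_cases)
    case 1
    show ?case by (rule 1(1)[OF 1(2,3)]) (rule 1(4); assumption)
  qed
  define A where "A = (\<lambda>j k. a j k / of_real (r ^ j * r ^ k))"
  have main: "(\<lambda>(j, k). norm (A j k * of_real ((s - s0) ^ j * (t - t0) ^ k))) summable_on UNIV \<and>
     ((\<lambda>(j, k). A j k * of_real ((s - s0) ^ j * (t - t0) ^ k)) has_sum \<Psi> (Complex s t)) UNIV"
    if "\<bar>s - s0\<bar> < r * \<rho>" "\<bar>t - t0\<bar> < r * \<rho>" for s t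
  proof -
    define x y where "x = (s - s0) / r" and "y = (t - t0) / r"
    have xy: "\<bar>x\<bar> < \<rho>" "\<bar>y\<bar> < \<rho>"
      using that r by (auto simp: x_def y_def field_simps)
    have "\<Phi> (arcsin x) (arcsin y) = \<Psi> (Complex s0 t0 + of_real r * (of_real x + \<i> * of_real y))"
      using xy \<rho> by (simp add: \<Phi>_def)
    also have "Complex s0 t0 + of_real r * (of_real x + \<i> * of_real y) = Complex s t"
      using r by (simp add: complex_eq_iff x_def y_def)
    finally have \<Phi>_eq: "\<Phi> (arcsin x) (arcsin y) = \<Psi> (Complex s t)" .
    have eq: "A j k * of_real ((s - s0) ^ j * (t - t0) ^ k) = a j k * of_real (x ^ j * y ^ k)" for j k
      by (simp add: A_def x_def y_def power_divide)
    show ?thesis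
      using a[OF xy b \<Phi>] unfolding eq \<Phi>_eq by blast
  qed
  have "open ({s0 - r * \<rho><..<s0 + r * \<rho>} \<times> {t0 - r * \<rho><..<t0 + r * \<rho>})"
    by (intro open_Times) auto
  then have "\<forall>\<^sub>F z in nhds (s0, t0). z \<in> {s0 - r * \<rho><..<s0 + r * \<rho>} \<times> {t0 - r * \<rho><..<t0 + r * \<rho>}"
    using r \<rho> by (intro eventually_nhds_in_open) auto
  then have "\<forall>\<^sub>F (s, t) in nhds (s0, t0).
     (\<lambda>(j, k). norm (A j k * of_real ((s - s0) ^ j * (t - t0) ^ k))) summable_on UNIV \<and>
     ((\<lambda>(j, k). A j k * of_real ((s - s0) ^ j * (t - t0) ^ k)) has_sum \<Psi> (Complex s t)) UNIV"
    by eventually_elim (clarify, rule main, auto simp: abs_less_iff)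
  then show ?thesis by blast
qed

subsection \<open>Gliding hump\<close>

text \<open>The centres lie on one axis at distance 8 \<delta>(j) from 0 with \<delta> halving each
  time. Centres i < j are then at least 4 \<delta>(i) apart, more than the sum of the radii, and
  every bump stays within 9 \<delta>(j) of the origin, where \<eta> is 1.\<close>

lemma bump_sequence:
  fixes \<rho> :: real
  assumes \<rho>: "\<rho> > 0"
  obtains \<eta> :: "real^'n::finite \<Rightarrow> real" and \<psi> :: "nat \<Rightarrow> real^'n \<Rightarrow> real" and y \<delta> where
    "(\<lambda>t. of_real (\<eta> t)) \<in> schwartz" "\<And>t. 0 \<le> \<eta> t" "\<And>t. \<eta> t \<le> 1" "\<eta> 0 = 1"
    "\<And>j. (\<lambda>t. of_real (\<psi> j t)) \<in> schwartz" "\<And>j t. 0 \<le> \<psi> j t" "\<And>j t. \<psi> j t \<le> 1"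
    "\<And>j. 0 < \<delta> j" "\<And>j. \<delta> j \<le> 1 / 4"
    "\<And>j t. dist (y j) t \<le> \<delta> j / 2 \<Longrightarrow> \<psi> j t = 1"
    "\<And>j t. dist (y j) t \<ge> \<delta> j \<Longrightarrow> \<psi> j t = 0"
    "\<And>j t. dist (y j) t \<le> \<delta> j \<Longrightarrow> norm t \<le> \<rho> \<and> \<eta> t = 1"
    "\<And>i j t. i \<noteq> j \<Longrightarrow> \<psi> i t \<noteq> 0 \<Longrightarrow> \<psi> j t = 0"
    "\<And>j. \<psi> j 0 = 0" "y \<longlonglongrightarrow> 0"
proof -
  \<comment> \<open>The cap 1/4 keeps each bump well inside one period cell, so that
    \<open>peak\<close> has no second maximum on it.\<close>
  define \<rho>1 where "\<rho>1 = min \<rho> (1 / 4)"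
  have \<rho>1: "0 < \<rho>1" "\<rho>1 \<le> \<rho>" "\<rho>1 \<le> 1 / 4" using \<rho> by (auto simp: \<rho>1_def)
  let ?e = "axis (undefined::'n) 1 :: real^'n"
  define y where "y = (\<lambda>j::nat. (\<rho>1 / 2 * (1 / 2) ^ j) *\<^sub>R ?e)"
  define \<delta> where "\<delta> = (\<lambda>j::nat. \<rho>1 / 16 * (1 / 2) ^ j)"
  have \<delta>: "0 < \<delta> j" "\<delta> j \<le> \<rho>1 / 16" for j
    using \<rho>1 by (simp_all add: \<delta>_def power_le_one)
  have norm_y: "norm (y j) = 8 * \<delta> j" for j
    using \<rho>1 by (simp add: y_def \<delta>_def)
  obtain \<eta> :: "real^'n \<Rightarrow> real" where \<eta>: "(\<lambda>t. of_real (\<eta> t)) \<in> schwartz" "\<And>t. 0 \<le> \<eta> t" "\<And>t. \<eta> t \<le> 1"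
    "\<And>t. dist 0 t \<le> 2 * \<rho>1 / 2 \<Longrightarrow> \<eta> t = 1"
    using bump_function[of "2 * \<rho>1" "0 :: real^'n"] \<rho>1 by (metis zero_less_mult_iff zero_less_numeral)
  have "\<exists>\<psi>. (\<lambda>t. of_real (\<psi> t)) \<in> schwartz \<and> (\<forall>t. 0 \<le> \<psi> t) \<and> (\<forall>t. \<psi> t \<le> 1) \<and>
      (\<forall>t. dist (y j) t \<le> \<delta> j / 2 \<longrightarrow> \<psi> t = 1) \<and> (\<forall>t. dist (y j) t \<ge> \<delta> j \<longrightarrow> \<psi> t = 0)" for j
    by (rule bump_function[OF \<delta>(1)[of j], of "y j"]) blast
  then obtain \<psi> where \<psi>: "\<And>j. (\<lambda>t. of_real (\<psi> j t)) \<in> schwartz" "\<And>j t. 0 \<le> \<psi> j t" "\<And>j t. \<psi> j t \<le> 1"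
    "\<And>j t. dist (y j) t \<le> \<delta> j / 2 \<Longrightarrow> \<psi> j t = 1" "\<And>j t. dist (y j) t \<ge> \<delta> j \<Longrightarrow> \<psi> j t = 0"
    by metis
  have far: "\<psi> j t = 0" if "i < j" "\<psi> i t \<noteq> 0" for i j t
  proof (rule \<psi>(5))
    have d: "dist (y i) t < \<delta> i" using that \<psi>(5)[of i t] by force
    have "(1 / 2 :: real) ^ j \<le> (1 / 2) ^ Suc i"
      using that by (intro power_decreasing) auto
    then have le: "\<delta> j \<le> \<delta> i / 2"
      using \<rho>1 by (simp add: \<delta>_def)
    have "dist (y i) (y j) = \<bar>norm (y i) - norm (y j)\<bar>"
      using \<rho>1 by (simp add: y_def dist_norm flip: scaleR_diff_left)
    then have "dist (y i) (y j) \<ge> 4 * \<delta> i"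
      unfolding norm_y using le by linarith
    then show "\<delta> j \<le> dist (y j) t"
      using d le dist_triangle[of "y i" "y j" t] \<delta>(1)[of i] by (simp add: dist_commute)
  qed
  show ?thesis
  proof (rule that[of \<eta> \<psi> \<delta> y])
    show "\<psi> j t = 0" if "i \<noteq> j" "\<psi> i t \<noteq> 0" for i j t
      using far that by (meson nat_neq_iff)
    show "norm t \<le> \<rho> \<and> \<eta> t = 1" if "dist (y j) t \<le> \<delta> j" for j t
    proof -
      have "norm t \<le> norm (y j) + dist (y j) t"
        by (metis dist_0_norm dist_triangle dist_commute add.commute)
      also have "\<dots> \<le> 9 * \<delta> j" unfolding norm_y using that by simp
      finally have "norm t \<le> \<rho>1" using \<delta>(2)[of j] \<rho>1 by simp
      then show ?thesis using \<rho>1 \<eta>(4)[of t] by simp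
    qed
    show "\<psi> j 0 = 0" for j
      using \<psi>(5)[of j 0] norm_y[of j] \<delta>(1)[of j] by simp
    show "y \<longlonglongrightarrow> 0"
      unfolding tendsto_norm_zero_iff[symmetric, of y] norm_y \<delta>_def
      by (intro tendsto_mult_right_zero LIMSEQ_realpow_zero) auto
    show "\<eta> 0 = 1" using \<eta>(4)[of 0] \<rho>1 by simp
    show "\<delta> j \<le> 1 / 4" for j using \<delta>(2)[of j] \<rho>1 by simp
  qed (use \<eta> \<psi> \<delta> in auto)
qed

text \<open>\<Gamma> stands for the kernel above. From here on only its integrability, its
  continuity, the bounded pairings and its positivity near 0 after a rotation are used; \<Psi> is
  the operating function read on the complex plane.\<close>

locale operating = window g for g :: "real^'n::finite \<Rightarrow> complex" +
  fixes p :: ennreal and \<Psi> :: "complex \<Rightarrow> complex" and \<Gamma> :: "real^'n \<Rightarrow> complex"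
    and \<zeta> :: complex and \<rho> c0 :: real
  assumes p_ge_1: "1 \<le> p"
    and operates: "\<And>f. f \<in> modulation_functions g p \<Longrightarrow> (\<lambda>x. \<Psi> (f x)) \<in> modulation_functions g p"
    and \<Gamma>_integrable: "integrable lborel \<Gamma>" and \<Gamma>_continuous: "continuous_on UNIV \<Gamma>"
    and pairing: "\<And>h M. h \<in> modulation_functions g p \<Longrightarrow> (\<And>t. norm (h t) \<le> M) \<Longrightarrow>
      \<exists>C. \<forall>R T. trig_poly 1 R T \<longrightarrow> norm (\<integral>t. h t * T t * \<Gamma> t \<partial>lborel) \<le> C"
    and \<zeta>: "norm \<zeta> = 1" and \<rho>_pos: "\<rho> > 0" and c0_pos: "c0 > 0"
    and \<Gamma>_positive: "\<And>t. norm t \<le> \<rho> \<Longrightarrow> c0 \<le> Re (\<zeta> * \<Gamma> t)"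
begin

lemma dominated_operates: "dominated f K \<Longrightarrow> (\<lambda>x. \<Psi> (f x)) \<in> modulation_functions g p"
  using operates dominated_imp_modulation_function p_ge_1 by blast

lemma dominated_operates_continuous: "dominated f K \<Longrightarrow> continuous_on UNIV (\<lambda>x. \<Psi> (f x))"
  using dominated_operates by (auto simp: modulation_functions_def)

text \<open>Any sequence converging fast enough to \<open>z0\<close> consists of values of a single dominated function
  at points converging to the origin.\<close>

lemma \<Psi>_continuous: "continuous_on UNIV \<Psi>"
proof (rule ccontr)
  assume "\<not> continuous_on UNIV \<Psi>"
  then obtain z0 where "\<not> isCont \<Psi> z0"
    by (auto simp: continuous_on_eq_continuous_at)
  then obtain \<epsilon> where \<epsilon>: "\<epsilon> > 0" "\<And>d. d > 0 \<Longrightarrow> \<exists>z. dist z z0 < d \<and> \<not> dist (\<Psi> z) (\<Psi> z0) < \<epsilon>"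
    unfolding continuous_at_eps_delta by blast
  obtain \<eta> :: "real^'n \<Rightarrow> real" and \<psi> y \<delta> where
    \<eta>: "(\<lambda>t. of_real (\<eta> t)) \<in> schwartz" "\<eta> 0 = 1" and
    \<psi>: "\<And>j. (\<lambda>t. of_real (\<psi> j t)) \<in> schwartz" and \<delta>: "\<And>j. 0 < (\<delta> j :: real)"
    and \<psi>1: "\<And>j t. dist (y j) t \<le> \<delta> j / 2 \<Longrightarrow> \<psi> j t = 1"
    and \<eta>1: "\<And>j t. dist (y j) t \<le> \<delta> j \<Longrightarrow> norm t \<le> \<rho> \<and> \<eta> t = 1"
    and dis: "\<And>i j t. i \<noteq> j \<Longrightarrow> \<psi> i t \<noteq> 0 \<Longrightarrow> \<psi> j t = 0"
    and \<psi>0: "\<And>j. \<psi> j 0 = 0" and y: "y \<longlonglongrightarrow> 0"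
    by (rule bump_sequence[OF \<rho>_pos]) blast
  have "\<exists>K. \<forall>j. dominated (\<lambda>t. of_real (\<psi> j t)) (K j)"
    by (rule choice) (metis schwartz_imp_dominated \<psi>)
  then obtain K where K: "\<And>j. dominated (\<lambda>t. of_real (\<psi> j t)) (K j)" by blast
  have K0: "0 \<le> K j" for j using dominated_nonneg K by blast
  \<comment> \<open>The bumps shrink and nothing is known about the growth of their bounds K j, so
    the points are chosen close enough to z0 to compensate for it.\<close>
  have "\<exists>z. \<forall>j. dist (z j) z0 < (1 / 2) ^ j / (K j + 1) \<and> \<not> dist (\<Psi> (z j)) (\<Psi> z0) < \<epsilon>"
  proof (rule choice, rule allI)
    fix j
    have "(1 / 2) ^ j / (K j + 1) > 0"
      using K0[of j] by (intro divide_pos_pos) auto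
    from \<epsilon>(2)[OF this] show "\<exists>z. dist z z0 < (1 / 2) ^ j / (K j + 1) \<and> \<not> dist (\<Psi> z) (\<Psi> z0) < \<epsilon>" .
  qed
  then obtain z where z: "\<And>j. dist (z j) z0 < (1 / 2) ^ j / (K j + 1)" "\<And>j. \<not> dist (\<Psi> (z j)) (\<Psi> z0) < \<epsilon>"
    by blast
  have zK: "norm (z j - z0) * K j \<le> (1 / 2) ^ j" for j
  proof -
    have "norm (z j - z0) * K j \<le> (1 / 2) ^ j / (K j + 1) * K j"
      using z(1)[of j] K0[of j] by (intro mult_right_mono) (auto simp: dist_norm)
    also have "\<dots> = (1 / 2) ^ j * (K j / (K j + 1))" by simp
    also have "\<dots> \<le> (1 / 2) ^ j * 1"
      using K0[of j] by (intro mult_left_mono) auto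
    finally show ?thesis by simp
  qed
  have sm: "summable (\<lambda>j. norm (z j - z0) * K j)"
  proof (rule summable_comparison_test'[where N = 0])
    show "summable (\<lambda>j. (1 / 2 :: real) ^ j)" by (rule summable_geometric) simp
    show "norm (norm (z j - z0) * K j) \<le> (1 / 2) ^ j" for j
      using zK[of j] K0[of j] by (simp add: abs_mult)
  qed
  obtain L where L: "dominated (\<lambda>t. of_real (\<eta> t)) L"
    using schwartz_imp_dominated[OF \<eta>(1)] .
  define f where "f = (\<lambda>t. z0 * of_real (\<eta> t) + (\<Sum>j. (z j - z0) * of_real (\<psi> j t)))"
  have "dominated f (norm z0 * L + (\<Sum>j. norm (z j - z0) * K j))"
    unfolding f_def by (intro dominated_add dominated_suminf dominated_cmult K L sm)
  then have cont: "continuous_on UNIV (\<lambda>x. \<Psi> (f x))"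
    by (rule dominated_operates_continuous)
  have f0: "f 0 = z0"
    by (simp add: f_def \<eta> \<psi>0)
  have fy: "f (y j) = z j" for j
  proof -
    have "\<psi> j (y j) = 1" using \<psi>1[of j "y j"] \<delta>[of j] by simp
    moreover from this have "\<psi> i (y j) = 0" if "i \<noteq> j" for i
      using dis[of j i "y j"] that by simp
    then have "(\<Sum>i. (z i - z0) * of_real (\<psi> i (y j))) = (\<Sum>i\<in>{j}. (z i - z0) * of_real (\<psi> i (y j)))"
      by (intro suminf_finite) auto
    moreover have "\<eta> (y j) = 1" using \<eta>1[of j "y j"] \<delta>[of j] by simp
    ultimately show ?thesis by (simp add: f_def)
  qed
  have "(\<lambda>j. \<Psi> (f (y j))) \<longlonglongrightarrow> \<Psi> (f 0)"
    using cont y continuous_on_tendsto_compose[OF cont y] by simp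
  then have "(\<lambda>j. \<Psi> (z j)) \<longlonglongrightarrow> \<Psi> z0"
    by (simp add: f0 fy)
  then have "\<forall>\<^sub>F j in sequentially. dist (\<Psi> (z j)) (\<Psi> z0) < \<epsilon>"
    using \<epsilon> by (simp add: tendsto_iff)
  then show False
    using z(2) eventually_happens'[OF sequentially_bot] by blast
qed

lemma \<Psi>_bounded_on_cball:
  obtains M where "M > 0" "\<And>z. norm z \<le> R \<Longrightarrow> norm (\<Psi> z) \<le> M"
proof -
  have "bounded (\<Psi> ` cball 0 R)"
    by (intro compact_imp_bounded compact_continuous_image continuous_on_subset[OF \<Psi>_continuous]) auto
  then obtain M where "M > 0" "\<And>z. z \<in> cball 0 R \<Longrightarrow> norm (\<Psi> z) \<le> M"
    by (auto simp: bounded_pos)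
  then show ?thesis by (intro that[of M]) auto
qed

lemma \<Psi>_compose_continuous: "continuous_on A f \<Longrightarrow> continuous_on A (\<lambda>x. \<Psi> (f x))"
  by (rule continuous_on_compose2[OF \<Psi>_continuous]) auto

lemma pairing_integrable:
  assumes G: "continuous_on UNIV G" "\<And>t. norm (G t) \<le> B" and T: "trig_poly 1 R T"
  shows "integrable lborel (\<lambda>t. \<Psi> (G t) * T t * \<Gamma> t)"
proof -
  obtain M where M: "M > 0" "\<And>z. norm z \<le> B \<Longrightarrow> norm (\<Psi> z) \<le> M"
    using \<Psi>_bounded_on_cball by blast
  obtain BT where BT: "BT > 0" "\<And>t. norm (T t) \<le> BT"
    using trig_poly_bounded[OF T] by blast
  have "integrable lborel (\<lambda>t. \<Gamma> t * (\<Psi> (G t) * T t))"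
  proof (rule integrable_mult_bounded[OF \<Gamma>_integrable])
    have "continuous_on UNIV (\<lambda>t. \<Psi> (G t) * T t)"
      by (intro continuous_intros \<Psi>_compose_continuous G trig_poly_continuous_on[OF T])
    then show "(\<lambda>t. \<Psi> (G t) * T t) \<in> borel_measurable lborel"
      by (simp add: borel_measurable_continuous_onI)
    show "norm (\<Psi> (G t) * T t) \<le> M * BT" for t
      unfolding norm_mult using M(2)[OF G(2)] BT M(1) by (intro mult_mono) auto
  qed
  then show ?thesis by (simp add: ac_simps)
qed

text \<open>For one fixed \<open>T\<close> the pairing is continuous in the supremum norm, by
  uniform continuity of \<Psi> on a ball. No uniformity in \<open>T\<close> is claimed: d may depend
  on it, which the gliding hump permits.\<close>

lemma pairing_stable:
  assumes G0: "continuous_on UNIV G0" "\<And>t. norm (G0 t) \<le> B" and T: "trig_poly 1 R T" and "\<epsilon> > 0"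
  obtains d where "d > 0" "\<And>G. continuous_on UNIV G \<Longrightarrow> (\<And>t. norm (G t - G0 t) \<le> d) \<Longrightarrow>
    norm ((\<integral>t. \<Psi> (G t) * T t * \<Gamma> t \<partial>lborel) - (\<integral>t. \<Psi> (G0 t) * T t * \<Gamma> t \<partial>lborel)) \<le> \<epsilon>"
proof -
  obtain BT where BT: "BT > 0" "\<And>t. norm (T t) \<le> BT"
    using trig_poly_bounded[OF T] by blast
  define I where "I = (\<integral>t. norm (\<Gamma> t) \<partial>lborel)"
  have I: "0 \<le> I" by (simp add: I_def)
  define \<omega> where "\<omega> = \<epsilon> / (BT * I + 1)"
  have den: "BT * I + 1 > 0" using BT I by (intro add_nonneg_pos) auto
  then have \<omega>: "\<omega> > 0" using \<open>\<epsilon> > 0\<close> by (simp add: \<omega>_def)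
  have "uniformly_continuous_on (cball 0 (B + 1)) \<Psi>"
    by (intro compact_uniformly_continuous continuous_on_subset[OF \<Psi>_continuous]) auto
  then obtain d' where d': "d' > 0"
    "\<And>u v. u \<in> cball 0 (B + 1) \<Longrightarrow> v \<in> cball 0 (B + 1) \<Longrightarrow> dist u v < d' \<Longrightarrow> dist (\<Psi> u) (\<Psi> v) < \<omega>"
    using \<omega> unfolding uniformly_continuous_on_def by meson
  show ?thesis
  proof (rule that[of "min (d' / 2) 1"])
    show "min (d' / 2) 1 > 0" using d' by simp
    fix G assume G: "continuous_on UNIV G" and close: "\<And>t. norm (G t - G0 t) \<le> min (d' / 2) 1"
    have GB: "norm (G t) \<le> B + 1" for t
      using close[of t] G0(2)[of t] norm_triangle_ineq[of "G t - G0 t" "G0 t"] by simp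
    have pt: "norm (\<Psi> (G t) - \<Psi> (G0 t)) \<le> \<omega>" for t
      using d'(2)[of "G t" "G0 t"] GB[of t] G0(2)[of t] close[of t] d'(1) by (auto simp: dist_norm)
    note int = pairing_integrable[OF G GB T] pairing_integrable[OF G0 T]
    have "norm ((\<integral>t. \<Psi> (G t) * T t * \<Gamma> t \<partial>lborel) - (\<integral>t. \<Psi> (G0 t) * T t * \<Gamma> t \<partial>lborel)) =
        norm (\<integral>t. \<Psi> (G t) * T t * \<Gamma> t - \<Psi> (G0 t) * T t * \<Gamma> t \<partial>lborel)"
      using int by (simp add: Bochner_Integration.integral_diff)
    also have "\<dots> \<le> (\<integral>t. norm (\<Psi> (G t) * T t * \<Gamma> t - \<Psi> (G0 t) * T t * \<Gamma> t) \<partial>lborel)"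
      by (rule integral_norm_bound)
    also have "\<dots> \<le> (\<integral>t. \<omega> * BT * norm (\<Gamma> t) \<partial>lborel)"
    proof (rule Bochner_Integration.integral_mono)
      show "integrable lborel (\<lambda>t. norm (\<Psi> (G t) * T t * \<Gamma> t - \<Psi> (G0 t) * T t * \<Gamma> t))"
        using int by (intro integrable_norm Bochner_Integration.integrable_diff)
      show "integrable lborel (\<lambda>t. \<omega> * BT * norm (\<Gamma> t))"
        using \<Gamma>_integrable by simp
      fix t
      have "norm (\<Psi> (G t) * T t * \<Gamma> t - \<Psi> (G0 t) * T t * \<Gamma> t) = norm (\<Psi> (G t) - \<Psi> (G0 t)) * norm (T t) * norm (\<Gamma> t)"
        by (simp only: norm_mult[symmetric] left_diff_distrib)
      also have "\<dots> \<le> \<omega> * BT * norm (\<Gamma> t)"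
        using pt[of t] BT(2)[of t] \<omega> by (intro mult_right_mono mult_mono) auto
      finally show "norm (\<Psi> (G t) * T t * \<Gamma> t - \<Psi> (G0 t) * T t * \<Gamma> t) \<le> \<omega> * BT * norm (\<Gamma> t)" .
    qed
    also have "\<dots> = \<omega> * (BT * I)"
      by (simp add: I_def)
    also have "\<dots> \<le> \<epsilon>"
      using den \<open>\<epsilon> > 0\<close> by (simp add: \<omega>_def field_simps)
    finally show "norm ((\<integral>t. \<Psi> (G t) * T t * \<Gamma> t \<partial>lborel) - (\<integral>t. \<Psi> (G0 t) * T t * \<Gamma> t \<partial>lborel)) \<le> \<epsilon>" .
  qed
qed

text \<open>\<sigma> and \<tau> are complex so that one family covers an oscillation in either
  coordinate direction around any frozen value of the other. The admissible function sits inside the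
  sine as a phase, where averaging over \<theta> can extract it.\<close>

definition perturbation :: "(real^'n \<Rightarrow> real) \<Rightarrow> real \<Rightarrow> complex \<Rightarrow> complex \<Rightarrow> real \<Rightarrow> (real^'n \<Rightarrow> real) \<Rightarrow> real^'n \<Rightarrow> complex" where
  "perturbation \<psi> r \<sigma> \<tau> \<theta> f t = of_real (r * \<psi> t) * (\<sigma> * of_real (sin (\<theta> + f t)) + \<tau>)"

definition admissible :: "(real^'n \<Rightarrow> real) \<Rightarrow> bool" where
  "admissible f \<longleftrightarrow> continuous_on UNIV f \<and> multiplier (\<lambda>t. of_real (f t)) 1"

text \<open>The bound is the same for all \<theta>, all admissible f and all \<sigma>, \<tau> in the
  unit disc, and it is linear in r: shrinking r alone fits the perturbation into any budget.\<close>

lemma dominated_perturbation: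
  assumes \<psi>: "dominated (\<lambda>t. of_real (\<psi> t)) K" and f: "admissible f" and \<sigma>\<tau>: "norm \<sigma> \<le> 1" "norm \<tau> \<le> 1" and r: "0 \<le> r"
  shows "dominated (perturbation \<psi> r \<sigma> \<tau> \<theta> f) (r * ((exp 1 + 1) * K))"
proof -
  have "multiplier (\<lambda>t. \<sigma> * of_real (sin (\<theta> + f t)) + \<tau>) (norm \<sigma> * exp 1 + norm \<tau>)"
    using f unfolding admissible_def by (intro multiplier_add multiplier_mult multiplier_const multiplier_sin_add) auto
  then have "multiplier (\<lambda>t. \<sigma> * of_real (sin (\<theta> + f t)) + \<tau>) (exp 1 + 1)"
    using \<sigma>\<tau> by (elim multiplier_mono) (intro add_mono mult_left_le_one_le, auto)
  from dominated_cmult[OF multiplierD[OF this \<psi>], of "of_real r"] show ?thesis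
    using r by (simp add: perturbation_def[abs_def] ac_simps)
qed

text \<open>Gliding hump: if the bound failed near every bump, perturbations at disjoint bumps would add up
  to a dominated function whose image under \<open>\<Psi>\<close> has unbounded pairings.\<close>

lemma uniform_bound_near_some_bump:
  assumes \<eta>: "(\<lambda>t. of_real (\<eta> t)) \<in> schwartz" and \<psi>: "\<And>j::nat. (\<lambda>t. of_real (\<psi> j t)) \<in> schwartz"
    and dis: "\<And>i j t. i \<noteq> j \<Longrightarrow> \<psi> i t \<noteq> 0 \<Longrightarrow> \<psi> j t = (0::real)"
  obtains j r H K C where "r > 0" "dominated H K" "\<And>t. \<psi> j t \<noteq> 0 \<Longrightarrow> H t = 0"
    "\<And>\<sigma> \<tau> \<theta> f R T. norm \<sigma> \<le> 1 \<Longrightarrow> norm \<tau> \<le> 1 \<Longrightarrow> admissible f \<Longrightarrow> trig_poly 1 R T \<Longrightarrow>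
      norm (\<integral>t. \<Psi> (z0 * of_real (\<eta> t) + H t + perturbation (\<psi> j) r \<sigma> \<tau> \<theta> f t) * T t * \<Gamma> t \<partial>lborel) \<le> C"
proof (rule ccontr)
  note obt = that
  assume not_thesis: "\<not> thesis"
  have fail: "\<exists>\<sigma> \<tau> \<theta> f R T. norm \<sigma> \<le> 1 \<and> norm \<tau> \<le> 1 \<and> admissible f \<and> trig_poly 1 R T \<and>
      norm (\<integral>t. \<Psi> (z0 * of_real (\<eta> t) + H t + perturbation (\<psi> j) r \<sigma> \<tau> \<theta> f t) * T t * \<Gamma> t \<partial>lborel) > C"
    if "r > 0" "dominated H K" "\<And>t. \<psi> j t \<noteq> 0 \<Longrightarrow> H t = 0" for j r H K C
  proof (rule ccontr)
    assume neg: "\<not> ?thesis"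
    have "norm (\<integral>t. \<Psi> (z0 * of_real (\<eta> t) + H t + perturbation (\<psi> j) r \<sigma> \<tau> \<theta> f t) * T t * \<Gamma> t \<partial>lborel) \<le> C"
      if "norm \<sigma> \<le> 1" "norm \<tau> \<le> 1" "admissible f" "trig_poly 1 R T" for \<sigma> \<tau> \<theta> f R T
    proof (rule ccontr)
      assume "\<not> norm (\<integral>t. \<Psi> (z0 * of_real (\<eta> t) + H t + perturbation (\<psi> j) r \<sigma> \<tau> \<theta> f t) * T t * \<Gamma> t \<partial>lborel) \<le> C"
      then show False using neg that unfolding not_le by blast
    qed
    from obt[OF that(1,2) that(3) this] have thesis .
    with not_thesis show False ..
  qed
  obtain L where L: "dominated (\<lambda>t. of_real (\<eta> t)) L"
    using schwartz_imp_dominated[OF \<eta>] .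
  have base: "dominated (\<lambda>t. z0 * of_real (\<eta> t)) (norm z0 * L)"
    by (intro dominated_cmult L)
  have "\<exists>K. \<forall>j. dominated (\<lambda>t. of_real (\<psi> j t)) (K j)"
    by (rule choice) (metis schwartz_imp_dominated \<psi>)
  then obtain K where K: "\<And>j. dominated (\<lambda>t. of_real (\<psi> j t)) (K j)" by blast
  have K0: "0 \<le> K j" for j using dominated_nonneg K by blast
  \<comment> \<open>A state of the construction at stage j: the sum H of the perturbations made so
    far, zero on all bumps from j on, and the budget \<epsilon> for the next one.\<close>
  define P where "P = (\<lambda>j (H, \<epsilon>::real). (\<exists>K. dominated H K) \<and> (\<forall>i\<ge>j. \<forall>t. \<psi> i t \<noteq> 0 \<longrightarrow> H t = 0) \<and> \<epsilon> > 0)"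
  \<comment> \<open>A transition: a summand h within the budget makes the pairing with some
    \<open>T\<close> exceed j, and keeps it above j for every function within 2 \<epsilon>' of the
    new state.\<close>
  define Q where "Q = (\<lambda>(j::nat) (H, \<epsilon>) (H', \<epsilon>'). \<exists>h T R. trig_poly 1 R T \<and> dominated h \<epsilon> \<and> H' = (\<lambda>t. H t + h t) \<and>
      \<epsilon>' \<le> \<epsilon> / 2 \<and> (\<forall>G. continuous_on UNIV G \<longrightarrow> (\<forall>t. norm (G t - (z0 * of_real (\<eta> t) + H' t)) \<le> 2 * \<epsilon>') \<longrightarrow>
        norm (\<integral>t. \<Psi> (G t) * T t * \<Gamma> t \<partial>lborel) > real j))"
  have "\<exists>X. (\<forall>j. P j (X j)) \<and> X 0 = (\<lambda>t. 0, 1) \<and> (\<forall>j. Q j (X j) (X (Suc j)))"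
  proof -
    have start: "P 0 (\<lambda>t. 0, 1)"
      using dominated_0 by (auto simp: P_def)
    have step: "\<exists>Y. P (Suc j) Y \<and> Q j X Y" if PjX: "P j X" for j X
    proof -
      obtain H \<epsilon> where X: "X = (H, \<epsilon>)" by (cases X)
      obtain KH where KH: "dominated H KH" and zero: "\<And>i t. j \<le> i \<Longrightarrow> \<psi> i t \<noteq> 0 \<Longrightarrow> H t = 0" and \<epsilon>: "\<epsilon> > 0"
        using PjX by (auto simp: P_def X)
      \<comment> \<open>The amplitude at which a perturbation on bump j has bound at most
        \<epsilon>, whatever its other parameters are.\<close>
      define r where "r = \<epsilon> / ((exp 1 + 1) * K j + 1)"
      have den: "(exp 1 + 1) * K j + 1 > 0"
        using K0[of j] by (intro add_nonneg_pos mult_nonneg_nonneg add_nonneg_nonneg) auto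
      then have r: "r > 0" using \<epsilon> by (simp add: r_def)
      obtain \<sigma> \<tau> \<theta> f R T where s: "norm \<sigma> \<le> 1" "norm \<tau> \<le> 1" "admissible f" "trig_poly 1 R T"
        and big: "norm (\<integral>t. \<Psi> (z0 * of_real (\<eta> t) + H t + perturbation (\<psi> j) r \<sigma> \<tau> \<theta> f t) * T t * \<Gamma> t \<partial>lborel) > real j + 1"
        using fail[OF r KH zero[OF order_refl], where C = "real j + 1"] by blast
      define h where "h = perturbation (\<psi> j) r \<sigma> \<tau> \<theta> f"
      have "r * ((exp 1 + 1) * K j) \<le> \<epsilon>"
        using den \<epsilon> by (simp add: r_def field_simps)
      then have h: "dominated h \<epsilon>"
        unfolding h_def using dominated_perturbation[OF K s(3,1,2)] r dominated_mono by (meson less_imp_le)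
      define H' where "H' = (\<lambda>t. H t + h t)"
      have H': "dominated H' (KH + \<epsilon>)"
        unfolding H'_def by (intro dominated_add KH h)
      define G0 where "G0 = (\<lambda>t. z0 * of_real (\<eta> t) + H' t)"
      have G0: "dominated G0 (norm z0 * L + (KH + \<epsilon>))"
        unfolding G0_def by (intro dominated_add base H')
      have big': "norm (\<integral>t. \<Psi> (G0 t) * T t * \<Gamma> t \<partial>lborel) > real j + 1"
        using big by (simp add: G0_def H'_def h_def add.assoc)
      obtain d where d: "d > 0" "\<And>G. continuous_on UNIV G \<Longrightarrow> (\<And>t. norm (G t - G0 t) \<le> d) \<Longrightarrow>
          norm ((\<integral>t. \<Psi> (G t) * T t * \<Gamma> t \<partial>lborel) - (\<integral>t. \<Psi> (G0 t) * T t * \<Gamma> t \<partial>lborel)) \<le> 1"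
      proof (rule pairing_stable[OF dominated_continuous_on[OF G0] dominated_bound[OF G0] s(4) zero_less_one], goal_cases)
        case (1 d)
        show ?case by (rule 1(1)[OF 1(2)]) (rule 1(3); assumption)
      qed
      \<comment> \<open>Halving makes the budgets summable with tail at most 2 \<epsilon>'; the
        bound d/2 keeps that tail within the stability radius, so later summands cannot undo this
        stage. The margin 1 in the choice of the integral is spent on that change.\<close>
      define \<epsilon>' where "\<epsilon>' = min (\<epsilon> / 2) (d / 2)"
      have "P (Suc j) (H', \<epsilon>')"
      proof -
        have "H' t = 0" if "Suc j \<le> i" "\<psi> i t \<noteq> 0" for i t
        proof -
          have "\<psi> j t = 0" using dis[of i j t] that by auto
          then show ?thesis
            using zero[of i t] that by (simp add: H'_def h_def perturbation_def)
        qed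
        then show ?thesis using H' \<epsilon> d by (auto simp: P_def \<epsilon>'_def)
      qed
      moreover have "Q j X (H', \<epsilon>')"
      proof -
        have "norm (\<integral>t. \<Psi> (G t) * T t * \<Gamma> t \<partial>lborel) > real j"
          if G: "continuous_on UNIV G" "\<And>t. norm (G t - (z0 * of_real (\<eta> t) + H' t)) \<le> 2 * \<epsilon>'" for G
        proof -
          have "norm (G t - G0 t) \<le> d" for t
            using G(2)[of t] by (simp add: G0_def \<epsilon>'_def)
          from d(2)[OF G(1) this] big' show ?thesis
            using norm_triangle_ineq2[of "\<integral>t. \<Psi> (G0 t) * T t * \<Gamma> t \<partial>lborel" "\<integral>t. \<Psi> (G t) * T t * \<Gamma> t \<partial>lborel"]
            by (simp add: norm_minus_commute)
        qed
        then show ?thesis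
          unfolding Q_def X prod.case using s(4) h by (intro exI[of _ h] exI[of _ T] exI[of _ R]) (auto simp: H'_def \<epsilon>'_def)
      qed
      ultimately show ?thesis by blast
    qed
    define nxt where "nxt = (\<lambda>j X. SOME Y. P (Suc j) Y \<and> Q j X Y)"
    define X where "X = rec_nat (\<lambda>t. 0, 1) nxt"
    have X0: "X 0 = (\<lambda>t. 0, 1)" and XS: "X (Suc j) = nxt j (X j)" for j
      by (simp_all add: X_def)
    have nxt: "P (Suc j) (nxt j Y) \<and> Q j Y (nxt j Y)" if "P j Y" for j Y
      unfolding nxt_def using someI_ex[OF step[OF that]] .
    have PX: "P j (X j)" for j
      by (induction j) (use start nxt X0 XS in auto)
    then show ?thesis using X0 XS nxt by (intro exI[of _ X]) auto
  qed
  then obtain X where PX: "\<And>j. P j (X j)" and X0: "X 0 = (\<lambda>t. 0, 1)" and QX: "\<And>j. Q j (X j) (X (Suc j))"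
    by blast
  define H \<epsilon> where "H = (\<lambda>j. fst (X j))" and "\<epsilon> = (\<lambda>j. snd (X j))"
  have X: "X j = (H j, \<epsilon> j)" for j by (simp add: H_def \<epsilon>_def)
  have "\<exists>h. \<forall>j. dominated (h j) (\<epsilon> j) \<and> H (Suc j) = (\<lambda>t. H j t + h j t)"
    by (rule choice) (use QX in \<open>fastforce simp: Q_def X\<close>)
  then obtain h where h: "\<And>j. dominated (h j) (\<epsilon> j)" and HS: "\<And>j. H (Suc j) = (\<lambda>t. H j t + h j t)"
    by blast
  have \<epsilon>S: "\<epsilon> (Suc j) \<le> \<epsilon> j / 2" and \<epsilon>0: "\<epsilon> j > 0" for j
    using QX[of j] PX[of j] by (auto simp: Q_def P_def X)
  have H_sum: "H j t = (\<Sum>i<j. h i t)" for j t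
  proof (induction j)
    case 0
    then show ?case using X0 by (simp add: X)
  qed (simp add: HS)
  have \<epsilon>_geo: "\<epsilon> (k + j) \<le> \<epsilon> j * (1 / 2) ^ k" for j k
  proof (induction k)
    case (Suc k)
    then show ?case using \<epsilon>S[of "k + j"] by simp
  qed simp
  \<comment> \<open>All summands from stage j on total at most 2 \<epsilon>(j), which is the
    tolerance built into the transitions.\<close>
  have geo: "(\<lambda>k. \<epsilon> j * (1 / 2) ^ k) sums (2 * \<epsilon> j)" for j
    using sums_mult[OF geometric_sums[of "1 / 2 :: real"], of "\<epsilon> j"] by (simp add: mult.commute)
  have sm\<epsilon>: "summable (\<lambda>k. \<epsilon> (k + j))" for j
  proof (rule summable_comparison_test'[OF sums_summable[OF geo], of 0])
    show "norm (\<epsilon> (k + j)) \<le> \<epsilon> j * (1 / 2) ^ k" for k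
      using \<epsilon>_geo[of k j] \<epsilon>0[of "k + j"] by simp
  qed
  define f where "f = (\<lambda>t. z0 * of_real (\<eta> t) + (\<Sum>j. h j t))"
  have f: "dominated f (norm z0 * L + (\<Sum>j. \<epsilon> j))"
    unfolding f_def using sm\<epsilon>[of 0] by (intro dominated_add base dominated_suminf h) simp
  obtain M where M: "M > 0" "\<And>z. norm z \<le> norm z0 * L + (\<Sum>j. \<epsilon> j) \<Longrightarrow> norm (\<Psi> z) \<le> M"
    using \<Psi>_bounded_on_cball by blast
  obtain C where C: "\<And>R T. trig_poly 1 R T \<Longrightarrow> norm (\<integral>t. \<Psi> (f t) * T t * \<Gamma> t \<partial>lborel) \<le> C"
    using pairing[OF dominated_operates[OF f] M(2)[OF dominated_bound[OF f]]] by blast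
  obtain j where j: "real j > C" using reals_Archimedean2 by blast
  have close: "norm (f t - (z0 * of_real (\<eta> t) + H (Suc j) t)) \<le> 2 * \<epsilon> (Suc j)" for t
  proof -
    have le: "norm (h i t) \<le> \<epsilon> i" for i using dominated_bound[OF h] .
    have smh: "summable (\<lambda>i. norm (h i t))"
    proof (rule summable_comparison_test'[of \<epsilon> 0])
      show "summable \<epsilon>" using sm\<epsilon>[of 0] by simp
      show "norm (norm (h i t)) \<le> \<epsilon> i" for i using le[of i] by simp
    qed
    have "f t - (z0 * of_real (\<eta> t) + H (Suc j) t) = (\<Sum>k. h (k + Suc j) t)"
      unfolding f_def H_sum using suminf_split_initial_segment[OF summable_norm_cancel[OF smh], of "Suc j"] by simp
    also have "norm \<dots> \<le> (\<Sum>k. norm (h (k + Suc j) t))"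
      by (rule summable_norm) (rule summable_ignore_initial_segment[OF smh])
    also have "\<dots> \<le> (\<Sum>k. \<epsilon> (Suc j) * (1 / 2) ^ k)"
      by (rule suminf_le[OF order.trans[OF le \<epsilon>_geo] summable_ignore_initial_segment[OF smh] sums_summable[OF geo]])
    also have "\<dots> = 2 * \<epsilon> (Suc j)"
      using geo by (rule sums_unique[symmetric])
    finally show ?thesis .
  qed
  obtain T R where T: "trig_poly 1 R T"
    and big: "\<And>G. continuous_on UNIV G \<Longrightarrow> (\<And>t. norm (G t - (z0 * of_real (\<eta> t) + H (Suc j) t)) \<le> 2 * \<epsilon> (Suc j)) \<Longrightarrow>
        norm (\<integral>t. \<Psi> (G t) * T t * \<Gamma> t \<partial>lborel) > real j"
    using QX[of j] unfolding Q_def X prod.case by blast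
  from big[OF dominated_continuous_on[OF f] close] C[OF T] j show False by linarith
qed

end

subsection \<open>Exponential decay of the Fourier coefficients\<close>

lemma continuous_on_peak: "continuous_on A (peak y)"
  unfolding peak_def by (intro continuous_intros) auto

lemma peak_bounds: "0 \<le> peak y t" "peak y t \<le> 1"
proof -
  have "0 \<le> (\<Sum>i\<in>UNIV. (1 + cos (2 * pi * (t $ i - y $ i))) / 2)"
  proof (intro sum_nonneg divide_nonneg_nonneg)
    show "0 \<le> 1 + cos (2 * pi * (t $ i - y $ i))" for i
      using cos_ge_minus_one[of "2 * pi * (t $ i - y $ i)"] by linarith
  qed simp
  then show "0 \<le> peak y t" by (simp add: peak_def)
  have "(\<Sum>i\<in>UNIV. (1 + cos (2 * pi * (t $ i - y $ i))) / 2) \<le> (\<Sum>i\<in>(UNIV::'a set). 1)"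
    by (intro sum_mono) simp
  then show "peak y t \<le> 1" by (simp add: peak_def)
qed

lemma peak_self: "peak y y = 1"
  by (simp add: peak_def)

text \<open>Within distance 1/4 no other integer translate of y is reached, and a coordinate in
  which t differs from y has cosine below 1.\<close>

lemma peak_less_1:
  fixes y t :: "real^'n::finite"
  assumes "t \<noteq> y" "dist y t \<le> 1 / 4"
  shows "peak y t < 1"
proof -
  obtain i where i: "t $ i \<noteq> y $ i"
    using assms(1) by (auto simp: vec_eq_iff)
  have "\<bar>t $ i - y $ i\<bar> \<le> 1 / 4"
    using component_le_norm_cart[of "t - y" i] assms(2) by (simp add: dist_norm norm_minus_commute)
  then have "2 * pi * \<bar>t $ i - y $ i\<bar> \<le> pi"
    using pi_gt_zero by (simp add: field_simps)
  then have "cos (2 * pi * \<bar>t $ i - y $ i\<bar>) < cos 0"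
    using i by (intro cos_monotone_0_pi) auto
  moreover have "cos (2 * pi * \<bar>t $ i - y $ i\<bar>) = cos (2 * pi * (t $ i - y $ i))"
    using cos_abs_real[of "2 * pi * (t $ i - y $ i)"] by (simp add: abs_mult)
  ultimately have lt: "(1 + cos (2 * pi * (t $ i - y $ i))) / 2 < 1"
    by simp
  have "(\<Sum>i\<in>UNIV. (1 + cos (2 * pi * (t $ i - y $ i))) / 2) < (\<Sum>i\<in>(UNIV::'n set). 1)"
    by (rule sum_strict_mono_ex1) (use lt in auto)
  then show ?thesis by (simp add: peak_def)
qed

context operating
begin

text \<open>Averaging in \<open>\<theta>\<close> against a character turns the shift of the phase by \<open>f\<close> into a factor.\<close>

lemma averaged_bound:
  fixes G :: "real^'n \<Rightarrow> complex" and N :: int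
  assumes G: "continuous_on UNIV G" "\<And>t. norm (G t) \<le> B" and \<psi>: "continuous_on UNIV \<psi>" "\<And>t. \<bar>\<psi> t\<bar> \<le> 1"
    and r: "0 \<le> r" and \<sigma>\<tau>: "norm \<sigma> \<le> 1" "norm \<tau> \<le> 1"
    and f: "continuous_on UNIV f" and T: "trig_poly 1 R T"
    and C: "\<And>\<theta>. norm (\<integral>t. \<Psi> (G t + perturbation \<psi> r \<sigma> \<tau> \<theta> f t) * T t * \<Gamma> t \<partial>lborel) \<le> C"
  shows "norm (\<integral>t. cis (of_int N * f t) *
      integral {0..2*pi} (\<lambda>s. \<Psi> (G t + of_real (r * \<psi> t) * (\<sigma> * of_real (sin s) + \<tau>)) * cis (- (of_int N * s))) * T t * \<Gamma> t \<partial>lborel)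
      \<le> 2 * pi * C"
proof -
  let ?W = "\<lambda>\<theta> t. \<Psi> (G t + perturbation \<psi> r \<sigma> \<tau> \<theta> f t)"
  have pert_le: "norm (perturbation \<psi> r \<sigma> \<tau> \<theta> f t) \<le> 2 * r" for \<theta> t
  proof -
    have "norm (\<sigma> * of_real (sin (\<theta> + f t))) \<le> 1 * 1"
      unfolding norm_mult norm_of_real by (intro mult_mono \<sigma>\<tau> abs_sin_le_one) auto
    then have "norm (\<sigma> * of_real (sin (\<theta> + f t)) + \<tau>) \<le> 1 * 1 + 1"
      by (intro order.trans[OF norm_triangle_ineq] add_mono \<sigma>\<tau>)
    then have "norm (perturbation \<psi> r \<sigma> \<tau> \<theta> f t) \<le> (r * 1) * (1 * 1 + 1)"
      using \<psi>(2)[of t] r unfolding perturbation_def norm_mult[of "of_real _"] norm_of_real abs_mult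
      by (intro mult_mono) auto
    then show ?thesis by simp
  qed
  obtain M where M: "M > 0" "\<And>z. norm z \<le> B + 2 * r \<Longrightarrow> norm (\<Psi> z) \<le> M"
    using \<Psi>_bounded_on_cball by blast
  have W_le: "norm (?W \<theta> t) \<le> M" for \<theta> t
    using G(2)[of t] pert_le[of \<theta> t] by (intro M(2) order.trans[OF norm_triangle_ineq]) auto
  obtain BT where BT: "BT > 0" "\<And>t. norm (T t) \<le> BT"
    using trig_poly_bounded[OF T] by blast
  \<comment> \<open>Substituting s = \<theta> + f t over a full period leaves the integral unchanged
    up to the character, which contributes the factor e^(iN f(t)).\<close>
  have shift: "cis (of_int N * f t) *
      integral {0..2*pi} (\<lambda>s. \<Psi> (G t + of_real (r * \<psi> t) * (\<sigma> * of_real (sin s) + \<tau>)) * cis (- (of_int N * s))) =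
      integral {0..2*pi} (\<lambda>\<theta>. ?W \<theta> t * cis (- (of_int N * \<theta>)))" for t
  proof -
    let ?h = "\<lambda>s. cis (of_int N * f t) * (\<Psi> (G t + of_real (r * \<psi> t) * (\<sigma> * of_real (sin s) + \<tau>)) * cis (- (of_int N * s)))"
    have "?W \<theta> t * cis (- (of_int N * \<theta>)) = ?h (\<theta> + f t)" for \<theta>
    proof -
      have "cis (- (of_int N * \<theta>)) = cis (of_int N * f t) * cis (- (of_int N * (\<theta> + f t)))"
        by (simp add: cis_mult algebra_simps)
      then show ?thesis by (simp add: perturbation_def ac_simps)
    qed
    moreover have "integral {0..2*pi} (\<lambda>\<theta>. ?h (\<theta> + f t)) = integral {0..2*pi} ?h"
    proof (rule integral_periodic_shift)
      show "continuous_on UNIV ?h"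
        by (intro continuous_intros \<Psi>_compose_continuous)
      fix s
      have "cis (- (of_int N * (s + 2 * pi))) = cis (- (of_int N * s)) * cis (2 * pi * of_int (- N))"
        by (simp add: cis_mult algebra_simps)
      also have "cis (2 * pi * of_int (- N)) = 1"
        by (rule cis_multiple_2pi) simp
      finally show "?h (s + 2 * pi) = ?h s" by simp
    qed simp
    ultimately show ?thesis by simp
  qed
  let ?F = "\<lambda>t \<theta>. indicator {0..2*pi} \<theta> *\<^sub>R (?W \<theta> t * cis (- (of_int N * \<theta>)) * T t * \<Gamma> t)"
  have W_cont: "continuous_on UNIV (\<lambda>z. ?W (snd z) (fst z) * cis (- (of_int N * snd z)) * T (fst z))"
    unfolding perturbation_def
    by (intro continuous_intros \<Psi>_compose_continuous continuous_on_compose2[OF G(1)] continuous_on_compose2[OF \<psi>(1)]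
        continuous_on_compose2[OF f] continuous_on_compose2[OF trig_poly_continuous_on[OF T, of UNIV]]) auto
  have [measurable]: "\<Gamma> \<in> borel_measurable borel"
    using \<Gamma>_continuous by (rule borel_measurable_continuous_onI)
  have base: "integrable (lborel \<Otimes>\<^sub>M lborel) (\<lambda>z. indicator {0..2*pi} (snd z) *\<^sub>R \<Gamma> (fst z))"
  proof (rule lborel_pair.Fubini_integrable)
    have "(\<integral>\<theta>. norm (indicator {0..2*pi} \<theta> *\<^sub>R \<Gamma> t) \<partial>lborel) = 2 * pi * norm (\<Gamma> t)" for t
      by simp
    then show "integrable lborel (\<lambda>t. \<integral>\<theta>. norm (indicator {0..2*pi} (snd (t, \<theta>)) *\<^sub>R \<Gamma> (fst (t, \<theta>))) \<partial>lborel)"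
      using \<Gamma>_integrable by simp
  qed (auto intro!: AE_I2)
  have Fint: "integrable (lborel \<Otimes>\<^sub>M lborel) (\<lambda>(t, \<theta>). ?F t \<theta>)"
  proof -
    have "integrable (lborel \<Otimes>\<^sub>M lborel) (\<lambda>z. (indicator {0..2*pi} (snd z) *\<^sub>R \<Gamma> (fst z)) *
        (?W (snd z) (fst z) * cis (- (of_int N * snd z)) * T (fst z)))"
    proof (rule integrable_mult_bounded[OF base])
      show "(\<lambda>z. ?W (snd z) (fst z) * cis (- (of_int N * snd z)) * T (fst z)) \<in> borel_measurable (lborel \<Otimes>\<^sub>M lborel)"
        unfolding lborel_prod using borel_measurable_continuous_onI[OF W_cont] by simp
      show "norm (?W (snd z) (fst z) * cis (- (of_int N * snd z)) * T (fst z)) \<le> M * BT" for z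
        unfolding norm_mult norm_cis mult_1_right using W_le BT M(1) by (intro mult_mono) auto
    qed
    moreover have "(\<lambda>(t, \<theta>). ?F t \<theta>) = (\<lambda>z. (indicator {0..2*pi} (snd z) *\<^sub>R \<Gamma> (fst z)) *
        (?W (snd z) (fst z) * cis (- (of_int N * snd z)) * T (fst z)))"
      by (rule ext) (simp add: case_prod_unfold mult.commute split: split_indicator)
    ultimately show ?thesis by (simp only:)
  qed
  have "(\<integral>t. integral {0..2*pi} (\<lambda>\<theta>. ?W \<theta> t * cis (- (of_int N * \<theta>))) * T t * \<Gamma> t \<partial>lborel) = (\<integral>t. \<integral>\<theta>. ?F t \<theta> \<partial>lborel \<partial>lborel)"
  proof (intro Bochner_Integration.integral_cong refl)
    fix t
    have c: "continuous_on {0..2*pi} (\<lambda>\<theta>. ?W \<theta> t * cis (- (of_int N * \<theta>)))"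
      unfolding perturbation_def by (intro continuous_intros \<Psi>_compose_continuous)
    have "(\<integral>\<theta>. ?F t \<theta> \<partial>lborel) = (\<integral>\<theta>. (indicator {0..2*pi} \<theta> *\<^sub>R (?W \<theta> t * cis (- (of_int N * \<theta>)))) * (T t * \<Gamma> t) \<partial>lborel)"
      by (simp add: mult.assoc)
    also have "\<dots> = (\<integral>\<theta>. indicator {0..2*pi} \<theta> *\<^sub>R (?W \<theta> t * cis (- (of_int N * \<theta>))) \<partial>lborel) * (T t * \<Gamma> t)"
      by (rule integral_mult_left_zero)
    finally show "integral {0..2*pi} (\<lambda>\<theta>. ?W \<theta> t * cis (- (of_int N * \<theta>))) * T t * \<Gamma> t = (\<integral>\<theta>. ?F t \<theta> \<partial>lborel)"
      unfolding lebesgue_integral_eq_integral(2)[OF c] by (simp add: mult.assoc)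
  qed
  also have "\<dots> = (\<integral>\<theta>. \<integral>t. ?F t \<theta> \<partial>lborel \<partial>lborel)"
    by (rule lborel_pair.Fubini_integral[OF Fint, symmetric])
  finally have fub: "(\<integral>t. integral {0..2*pi} (\<lambda>\<theta>. ?W \<theta> t * cis (- (of_int N * \<theta>))) * T t * \<Gamma> t \<partial>lborel) =
      (\<integral>\<theta>. \<integral>t. ?F t \<theta> \<partial>lborel \<partial>lborel)" .
  have "norm (\<integral>t. integral {0..2*pi} (\<lambda>\<theta>. ?W \<theta> t * cis (- (of_int N * \<theta>))) * T t * \<Gamma> t \<partial>lborel) \<le>
      (\<integral>\<theta>. norm (\<integral>t. ?F t \<theta> \<partial>lborel) \<partial>lborel)"
    unfolding fub by (rule integral_norm_bound)
  also have "\<dots> \<le> (\<integral>\<theta>. indicator {0..2*pi} \<theta> * C \<partial>lborel)"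
  proof (rule Bochner_Integration.integral_mono)
    show "integrable lborel (\<lambda>\<theta>. norm (\<integral>t. ?F t \<theta> \<partial>lborel))"
      by (intro integrable_norm lborel_pair.integrable_snd[OF Fint])
    show "integrable lborel (\<lambda>\<theta>. indicator {0..2*pi::real} \<theta> * C)"
      by (intro integrable_mult_left integrable_real_indicator) auto
    fix \<theta> :: real
    have "(\<integral>t. ?F t \<theta> \<partial>lborel) = (\<integral>t. (indicator {0..2*pi} \<theta> *\<^sub>R cis (- (of_int N * \<theta>))) * (?W \<theta> t * T t * \<Gamma> t) \<partial>lborel)"
      by (intro Bochner_Integration.integral_cong refl) (simp add: ac_simps)
    also have "\<dots> = (indicator {0..2*pi} \<theta> *\<^sub>R cis (- (of_int N * \<theta>))) * (\<integral>t. ?W \<theta> t * T t * \<Gamma> t \<partial>lborel)"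
      by (rule integral_mult_right_zero)
    finally have e: "(\<integral>t. ?F t \<theta> \<partial>lborel) = (indicator {0..2*pi} \<theta> *\<^sub>R cis (- (of_int N * \<theta>))) * (\<integral>t. ?W \<theta> t * T t * \<Gamma> t \<partial>lborel)" .
    show "norm (\<integral>t. ?F t \<theta> \<partial>lborel) \<le> indicator {0..2*pi} \<theta> * C"
      unfolding e norm_mult norm_scaleR norm_cis using C[of \<theta>] by (simp add: mult_left_mono)
  qed
  also have "\<dots> = 2 * pi * C"
    by simp
  finally show ?thesis unfolding shift .
qed

text \<open>Each step adds one lacunary cosine to the phase and one factor to the Riesz product; letting the
  new frequency tend to infinity gains the mean of \<open>riesz_factor\<close>.\<close>

lemma riesz_product_gain:
  fixes b :: "real^'n \<Rightarrow> complex" and N :: int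
  assumes b: "continuous_on UNIV b" "\<And>t. norm t > l \<Longrightarrow> b t = 0" and N: "N \<noteq> 0"
    and D: "\<And>f R T. admissible f \<Longrightarrow> trig_poly 1 R T \<Longrightarrow> norm (\<integral>t. cis (of_int N * f t) * T t * b t \<partial>lborel) \<le> D"
    and "m \<le> nat \<bar>N\<bar>" "continuous_on UNIV f" "multiplier (\<lambda>t. of_real (f t)) (1 - real m / real (nat \<bar>N\<bar>))" "trig_poly 1 R T"
  shows "(5 / 4) ^ m * norm (\<integral>t. cis (of_int N * f t) * T t * b t \<partial>lborel) \<le> D"
  using assms(5-)
\<comment> \<open>m counts the cosines still to be added, and 1 - m/|N| is the part of the
  multiplier bound 1 already spent. At m = 0 the phase has become admissible and the hypothesis
  applies.\<close>
proof (induction m arbitrary: f R T)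
  case 0
  then show ?case using D[of f R T] by (simp add: admissible_def)
next
  case (Suc m)
  let ?n = "real (nat \<bar>N\<bar>)" and ?e = "axis undefined 1 :: real^'n"
  have n: "?n > 0" "real_of_int N * (sgn (real_of_int N) / ?n) = 1"
    using N by (auto simp: sgn_if)
  define G where "G = (\<lambda>t. cis (of_int N * f t) * T t * b t)"
  have G: "continuous_on UNIV G" "norm t > l \<Longrightarrow> G t = 0" for t
    unfolding G_def using b Suc.prems(2) by (auto intro!: continuous_intros trig_poly_continuous_on[OF Suc.prems(4)])
  have step: "(5 / 4) ^ m * norm (\<integral>t. G t * riesz_factor (real k * (t $ undefined)) \<partial>lborel) \<le> D"
    \<comment> \<open>The lacunarity condition that prevents the spectra in the Riesz product from
      overlapping.\<close>
    if k: "real k > 2 * R" for k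
  proof -
    let ?m = "real k *\<^sub>R ?e"
    have m: "?m \<bullet> t = real k * (t $ undefined)" for t
      by (simp add: inner_axis')
    \<comment> \<open>The amplitude 1/|N|, with the sign of N, makes N times the added term exactly
      one cosine of amplitude 1, whatever the sign of N.\<close>
    define f' where "f' = (\<lambda>t. f t + sgn (real_of_int N) / ?n * cos (2 * pi * (?m \<bullet> t)))"
    have A: "multiplier (\<lambda>t. of_real (f t) + of_real (sgn (real_of_int N) / ?n) * of_real (cos (2 * pi * (?m \<bullet> t))))
        ((1 - real (Suc m) / ?n) + norm (of_real (sgn (real_of_int N) / ?n) :: complex) * 1)"
      using Suc.prems by (intro multiplier_add multiplier_mult multiplier_const multiplier_cos) auto
    have E: "(1 - real (Suc m) / ?n) + norm (of_real (sgn (real_of_int N) / ?n) :: complex) * 1 = 1 - real m / ?n"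
      using N n(1) by (simp add: norm_divide sgn_if add_divide_distrib)
    have f'_mult: "multiplier (\<lambda>t. of_real (f' t)) (1 - real m / ?n)"
      using A by (simp only: E f'_def of_real_add of_real_mult)
    have f'_cont: "continuous_on UNIV f'"
      unfolding f'_def using Suc.prems by (intro continuous_intros) auto
    have "integer_vector ?m" by (simp add: integer_vector_def axis_def)
    then have T': "trig_poly 1 (R + norm ?m) (\<lambda>t. T t * (1 - 2 * \<i> * cos (2 * pi * (?m \<bullet> t))))"
      using k Suc.prems by (intro trig_poly_riesz) auto
    have ceq: "cis (of_int N * f' t) = cis (of_int N * f t) * cis (cos (2 * pi * (?m \<bullet> t)))" for t
    proof -
      have "of_int N * f' t = of_int N * f t + (real_of_int N * (sgn (real_of_int N) / ?n)) * cos (2 * pi * (?m \<bullet> t))"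
        by (simp only: f'_def distrib_left mult.assoc)
      then show ?thesis unfolding n(2) by (simp add: cis_mult)
    qed
    have "cis (of_int N * f' t) * (T t * (1 - 2 * \<i> * cos (2 * pi * (?m \<bullet> t)))) * b t =
        G t * riesz_factor (real k * (t $ undefined))" for t
      by (simp only: ceq m G_def riesz_factor_def ac_simps)
    then show ?thesis
      using Suc.IH[OF _ f'_cont f'_mult T'] Suc.prems(1) by simp
  qed
  have "(\<lambda>k. \<integral>t. G t * riesz_factor (real k * (t $ undefined)) \<partial>lborel) \<longlonglongrightarrow> (\<integral>t. G t \<partial>lborel) * integral {0..1} riesz_factor"
    by (rule oscillation_weak_limit[OF G riesz_factor_continuous riesz_factor_periodic riesz_factor_bound])
  then have lim: "(\<lambda>k. (5 / 4) ^ m * norm (\<integral>t. G t * riesz_factor (real k * (t $ undefined)) \<partial>lborel)) \<longlonglongrightarrow>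
      (5 / 4) ^ m * norm ((\<integral>t. G t \<partial>lborel) * integral {0..1} riesz_factor)"
    by (intro tendsto_intros)
  obtain k0 where k0: "real k0 > 2 * R" using reals_Archimedean2 by blast
  have le: "(5 / 4) ^ m * norm ((\<integral>t. G t \<partial>lborel) * integral {0..1} riesz_factor) \<le> D"
  proof (rule LIMSEQ_le_const2[OF lim], intro exI[of _ k0] allI impI)
    fix k assume "k0 \<le> k"
    then show "(5 / 4) ^ m * norm (\<integral>t. G t * riesz_factor (real k * (t $ undefined)) \<partial>lborel) \<le> D"
      using k0 by (intro step) linarith
  qed
  have "(5 / 4) ^ Suc m * norm (\<integral>t. G t \<partial>lborel) = (5 / 4) ^ m * (norm (\<integral>t. G t \<partial>lborel) * (5 / 4))"
    by simp
  also have "\<dots> \<le> (5 / 4) ^ m * norm ((\<integral>t. G t \<partial>lborel) * integral {0..1} riesz_factor)"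
    unfolding norm_mult by (intro mult_left_mono riesz_factor_mean) auto
  finally have "(5 / 4) ^ Suc m * norm (\<integral>t. G t \<partial>lborel) \<le> (5 / 4) ^ m * norm ((\<integral>t. G t \<partial>lborel) * integral {0..1} riesz_factor)" .
  from order.trans[OF this le] show ?case by (simp only: G_def)
qed

text \<open>Put \<beta> for 2 pi times the coefficient. The averaged function equals \<beta> on the
  inner ball, and full use of the Riesz gain bounds its pairing with the |N|-th power of the peak by
  a constant times (4/5)^|N|. Concentration bounds the same pairing from below by |\<beta>| q2^|N|
  times a constant, up to an error of order q1^|N|.\<close>

lemma coefficient_decay:
  obtains r q C where "r > 0" "0 \<le> q" "q < 1"
    "\<And>\<sigma> \<tau> N. norm \<sigma> \<le> 1 \<Longrightarrow> norm \<tau> \<le> 1 \<Longrightarrow>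
      norm (fourier_coeff (\<lambda>s. \<Psi> (z0 + of_real r * (\<sigma> * of_real (sin s) + \<tau>))) N) \<le> C * q ^ nat \<bar>N\<bar>"
proof -
  obtain \<eta> :: "real^'n \<Rightarrow> real" and \<psi> :: "nat \<Rightarrow> real^'n \<Rightarrow> real" and y \<delta> where
    \<eta>: "(\<lambda>t. of_real (\<eta> t)) \<in> schwartz" "\<And>t. 0 \<le> \<eta> t" "\<And>t. \<eta> t \<le> 1" and
    \<psi>: "\<And>j. (\<lambda>t. of_real (\<psi> j t)) \<in> schwartz" "\<And>j t. 0 \<le> \<psi> j t" "\<And>j t. \<psi> j t \<le> 1"
    and \<delta>: "\<And>j. 0 < (\<delta> j :: real)" "\<And>j. \<delta> j \<le> 1 / 4"
    and \<psi>1: "\<And>j t. dist (y j) t \<le> \<delta> j / 2 \<Longrightarrow> \<psi> j t = 1"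
    and \<psi>0: "\<And>j t. dist (y j) t \<ge> \<delta> j \<Longrightarrow> \<psi> j t = 0"
    and \<eta>1: "\<And>j t. dist (y j) t \<le> \<delta> j \<Longrightarrow> norm t \<le> \<rho> \<and> \<eta> t = 1"
    and dis: "\<And>i j t. i \<noteq> j \<Longrightarrow> \<psi> i t \<noteq> 0 \<Longrightarrow> \<psi> j t = 0"
    by (rule bump_sequence[OF \<rho>_pos]) blast
  obtain j r H K C where r: "r > 0" and H: "dominated H K" and H0: "\<And>t. \<psi> j t \<noteq> 0 \<Longrightarrow> H t = 0"
    and C: "\<And>\<sigma> \<tau> \<theta> f R T. norm \<sigma> \<le> 1 \<Longrightarrow> norm \<tau> \<le> 1 \<Longrightarrow> admissible f \<Longrightarrow> trig_poly 1 R T \<Longrightarrow>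
      norm (\<integral>t. \<Psi> (z0 * of_real (\<eta> t) + H t + perturbation (\<psi> j) r \<sigma> \<tau> \<theta> f t) * T t * \<Gamma> t \<partial>lborel) \<le> C"
    by (rule uniform_bound_near_some_bump[where \<eta> = \<eta> and \<psi> = \<psi> and ?z0.0 = z0, OF \<eta>(1) \<psi>(1)], erule (1) dis, blast)
  define d where "d = \<delta> j"
  have d: "0 < d" "d \<le> 1 / 4" using \<delta> by (auto simp: d_def)
  define G where "G = (\<lambda>t. z0 * of_real (\<eta> t) + H t)"
  have \<eta>_cont: "continuous_on UNIV (\<lambda>t. complex_of_real (\<eta> t))" and \<psi>_contc: "continuous_on UNIV (\<lambda>t. complex_of_real (\<psi> j t))"
    by (rule schwartz_continuous_on[OF \<eta>(1)], rule schwartz_continuous_on[OF \<psi>(1)])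
  have \<psi>_cont: "continuous_on UNIV (\<psi> j)"
    using continuous_on_Re[OF \<psi>_contc] by simp
  have \<psi>_abs: "\<bar>\<psi> j t\<bar> \<le> 1" for t using \<psi>(2,3)[of j t] by simp
  have G: "continuous_on UNIV G"
    unfolding G_def by (intro continuous_intros \<eta>_cont dominated_continuous_on[OF H])
  have GB: "norm (G t) \<le> norm z0 + K" for t
  proof -
    have "norm (z0 * of_real (\<eta> t)) \<le> norm z0 * 1"
      unfolding norm_mult norm_of_real using \<eta>(2,3)[of t] by (intro mult_left_mono) auto
    then show ?thesis
      unfolding G_def using dominated_bound[OF H, of t] by (intro order.trans[OF norm_triangle_ineq] add_mono) auto
  qed
  obtain M where M: "M > 0" "\<And>z. norm z \<le> norm z0 + K + 2 * r \<Longrightarrow> norm (\<Psi> z) \<le> M"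
    using \<Psi>_bounded_on_cball by blast
  have osc: "norm (of_real x * (\<sigma> * of_real (sin s) + \<tau>)) \<le> 2 * r"
    if "norm \<sigma> \<le> 1" "norm \<tau> \<le> 1" "\<bar>x\<bar> \<le> r" for x s :: real and \<sigma> \<tau> :: complex
  proof -
    have "norm (\<sigma> * of_real (sin s)) \<le> 1 * 1"
      unfolding norm_mult norm_of_real using that by (intro mult_mono abs_sin_le_one) auto
    then have "norm (\<sigma> * of_real (sin s) + \<tau>) \<le> 1 * 1 + 1"
      using that by (intro order.trans[OF norm_triangle_ineq] add_mono)
    then have "norm (of_real x * (\<sigma> * of_real (sin s) + \<tau>)) \<le> r * (1 * 1 + 1)"
      unfolding norm_mult[of "of_real x"] norm_of_real using that(3) by (intro mult_mono) auto
    then show ?thesis by simp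
  qed
  have x_le: "\<bar>r * \<psi> j t\<bar> \<le> r" for t
    using r \<psi>_abs[of t] by (simp add: abs_mult mult_left_le)
  have \<Psi>M: "norm (\<Psi> (G t + of_real (r * \<psi> j t) * (\<sigma> * of_real (sin s) + \<tau>))) \<le> M"
    if "norm \<sigma> \<le> 1" "norm \<tau> \<le> 1" for \<sigma> \<tau> s t
    using GB[of t] osc[OF that x_le[of t], of s] by (intro M(2) order.trans[OF norm_triangle_ineq]) linarith
  have K0: "0 \<le> K" using dominated_nonneg[OF H] .
  have admissible_0: "admissible (\<lambda>t. 0)"
    using multiplier_mono[OF multiplier_const[of 0], of 1] by (simp add: admissible_def)
  have C0: "0 \<le> C"
    using order.trans[OF norm_ge_zero C[of 0 0, OF _ _ admissible_0 trig_poly_const[of 1, unfolded norm_one]]] by simp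
  define I where "I = (\<integral>t. norm (\<Gamma> t) \<partial>lborel)"
  have I0: "0 \<le> I" by (simp add: I_def)
  \<comment> \<open>On the transition annulus the averaged function is only bounded. Compactness and
    \<open>peak_less_1\<close> provide a factor below 1 there.\<close>
  obtain q1 where q1: "0 \<le> q1" "q1 < 1" "\<And>t. d / 2 \<le> dist (y j) t \<Longrightarrow> dist (y j) t \<le> d \<Longrightarrow> peak (y j) t \<le> q1"
  proof -
    let ?S = "cball (y j) d - ball (y j) (d / 2)"
    show ?thesis
    proof (cases "?S = {}")
      case True
      show ?thesis
      proof (rule that[of 0])
        fix t assume "d / 2 \<le> dist (y j) t" "dist (y j) t \<le> d"
        then have "t \<in> ?S" by simp
        with True show "peak (y j) t \<le> 0" by blast
      qed simp_all
    next
      case False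
      have "compact ?S" by (intro compact_diff) auto
      then obtain t0 where t0: "t0 \<in> ?S" "\<And>t. t \<in> ?S \<Longrightarrow> peak (y j) t \<le> peak (y j) t0"
        using continuous_attains_sup[OF _ False continuous_on_peak] by blast
      have "t0 \<noteq> y j" "dist (y j) t0 \<le> 1 / 4" using t0(1) d by auto
      then have "peak (y j) t0 < 1" by (rule peak_less_1)
      then show ?thesis using that[of "peak (y j) t0"] t0(2) peak_bounds(1) by auto
    qed
  qed
  \<comment> \<open>\<open>qm\<close> dominates both error rates, the annulus and the inverse 4/5 of
    the Riesz gain. \<open>q2\<close> is put strictly between \<open>qm\<close> and 1, so that
    \<open>qm / q2\<close> is a genuine decay rate.\<close>
  define qm where "qm = max q1 (4 / 5)"
  define q2 where "q2 = (1 + qm) / 2"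
  have qm: "0 < qm" "qm < 1" "q1 \<le> qm" "4 / 5 \<le> qm" using q1 by (auto simp: qm_def)
  have q2: "0 < q2" "qm < q2" "q2 < 1" using qm by (auto simp: q2_def)
  have "isCont (peak (y j)) (y j)"
    using continuous_on_peak[of UNIV "y j"] continuous_on_eq_continuous_at by blast
  then obtain e where e: "e > 0" "\<And>t. dist t (y j) < e \<Longrightarrow> dist (peak (y j) t) 1 < 1 - q2"
    using q2(3) unfolding continuous_at_eps_delta peak_self by (metis diff_gt_0_iff_gt)
  define a where "a = min e (d / 2)"
  have a: "0 < a" "a \<le> e" "a \<le> d / 2" using e d by (auto simp: a_def)
  have peak_ge: "q2 \<le> peak (y j) t" if "t \<in> ball (y j) a" for t
    using e(2)[of t] that a by (auto simp: dist_real_def dist_commute)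
  obtain v where v: "emeasure lborel (ball (y j) a) = ennreal v" "0 \<le> v"
    using emeasure_lborel_ball_finite[of "y j" a]
    by (metis ennreal_cases infinity_ennreal_def less_irrefl)
  have v0: "v > 0"
    using content_ball_pos[OF a(1), of "y j"] v unfolding measure_def by simp
  define J where "J = 2 * pi * M * I"
  have J0: "0 \<le> J" using M I0 by (simp add: J_def)
  \<comment> \<open>The summand M takes care of N = 0, which the Riesz argument leaves out; the
    fraction is what the comparison for other N produces.\<close>
  define C' where "C' = M + (2 * pi * C + J) / (c0 * v)"
  have C': "M \<le> C'" "(2 * pi * C + J) / (c0 * v) \<le> C'"
    using M C0 J0 c0_pos v0 by (auto simp: C'_def)
  show ?thesis
  proof (rule that[OF r, of "qm / q2" C'])
    show "0 \<le> qm / q2" "qm / q2 < 1" using qm q2 by auto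
    fix \<sigma> \<tau> :: complex and N :: int
    assume \<sigma>\<tau>: "norm \<sigma> \<le> 1" "norm \<tau> \<le> 1"
    let ?fc = "fourier_coeff (\<lambda>s. \<Psi> (z0 + of_real r * (\<sigma> * of_real (sin s) + \<tau>))) N"
    show "norm ?fc \<le> C' * (qm / q2) ^ nat \<bar>N\<bar>"
    proof (cases "N = 0")
      case True
      have "norm (\<Psi> (z0 + of_real r * (\<sigma> * of_real (sin s) + \<tau>))) \<le> M" for s
        using osc[OF \<sigma>\<tau>, of r s] r K0 by (intro M(2) order.trans[OF norm_triangle_ineq]) auto
      then have "norm (integral {0..2*pi} (\<lambda>s. \<Psi> (z0 + of_real r * (\<sigma> * of_real (sin s) + \<tau>)) * cis (- (of_int N * s)))) \<le> 2 * pi * M"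
        by (intro norm_integral_le_length continuous_intros \<Psi>_compose_continuous) (auto simp: norm_mult)
      then have "norm ?fc \<le> M"
        by (simp add: fourier_coeff_def norm_divide norm_mult field_simps)
      then show ?thesis using True C' by simp
    next
      case False
      let ?n = "nat \<bar>N\<bar>"
      define b where "b = (\<lambda>t. integral {0..2*pi} (\<lambda>s. \<Psi> (G t + of_real (r * \<psi> j t) * (\<sigma> * of_real (sin s) + \<tau>)) * cis (- (of_int N * s))))"
      define \<beta> where "\<beta> = of_real (2 * pi) * ?fc"
      have b_cont: "continuous_on UNIV b"
      proof -
        have "continuous_on (UNIV \<times> cbox 0 (2 * pi))
            (\<lambda>(t, s). \<Psi> (G t + of_real (r * \<psi> j t) * (\<sigma> * of_real (sin s) + \<tau>)) * cis (- (of_int N * s)))"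
          unfolding split_beta
          by (intro continuous_intros \<Psi>_compose_continuous continuous_on_compose2[OF G] continuous_on_compose2[OF \<psi>_cont]) auto
        from integral_continuous_on_param[OF this] show ?thesis by (simp add: b_def)
      qed
      have b_bound: "norm (b t) \<le> 2 * pi * M" for t
        unfolding b_def using \<Psi>M[OF \<sigma>\<tau>, of t]
        by (intro norm_integral_le_length continuous_intros \<Psi>_compose_continuous) (auto simp: norm_mult)
      \<comment> \<open>Off the bump nothing oscillates in s, so only the zeroth coefficient could
        survive, and N is not 0.\<close>
      have b_0: "b t = 0" if "d \<le> dist (y j) t" for t
      proof -
        have "\<psi> j t = 0" using \<psi>0 that by (simp add: d_def)
        then have "b t = integral {0..2*pi} (\<lambda>s. \<Psi> (G t) * cis (of_int (- N) * s))"
          by (simp add: b_def)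
        also have "\<dots> = \<Psi> (G t) * integral {0..2*pi} (\<lambda>s. cis (of_int (- N) * s))"
          by (rule integral_mult_right)
        finally show ?thesis unfolding integral_cis_int using False by simp
      qed
      \<comment> \<open>Near the centre \<psi> and \<eta> are 1 and H vanishes, so the integrand no
        longer depends on t.\<close>
      have b_\<beta>: "b t = \<beta>" if "dist (y j) t \<le> d / 2" for t
      proof -
        have 1: "\<psi> j t = 1" using \<psi>1 that by (simp add: d_def)
        moreover have "\<eta> t = 1" using \<eta>1[of j t] that d by (simp add: d_def)
        moreover have "H t = 0" using H0[of t] 1 by simp
        ultimately show ?thesis
          by (simp add: b_def G_def \<beta>_def fourier_coeff_def)
      qed
      have near: "norm t \<le> \<rho>" if "dist (y j) t \<le> d" for t
        using \<eta>1[of j t] that by (simp add: d_def)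
      define b' where "b' = (\<lambda>t. b t * \<Gamma> t)"
      have b'_cont: "continuous_on UNIV b'"
        unfolding b'_def by (intro continuous_intros b_cont \<Gamma>_continuous)
      have b'_0: "b' t = 0" if "norm t > \<rho>" for t
        using near[of t] b_0[of t] that by (cases "d \<le> dist (y j) t") (auto simp: b'_def)
      have avg: "norm (\<integral>t. cis (of_int N * f t) * T t * b' t \<partial>lborel) \<le> 2 * pi * C"
        if f: "admissible f" and T: "trig_poly 1 R T" for f R T
      proof -
        have "norm (\<integral>t. cis (of_int N * f t) * b t * T t * \<Gamma> t \<partial>lborel) \<le> 2 * pi * C"
          unfolding b_def
          using f r C[OF \<sigma>\<tau> f T]
          by (intro averaged_bound[OF G GB \<psi>_cont \<psi>_abs _ \<sigma>\<tau> _ T]) (auto simp: admissible_def G_def)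
        then show ?thesis by (simp add: b'_def ac_simps)
      qed
      \<comment> \<open>Starting from phase 0 the whole budget is available: |N| cosines are added,
        each gaining 5/4, while the peak power serves as initial polynomial.\<close>
      have "(5 / 4) ^ ?n * norm (\<integral>t. cis (of_int N * 0) * of_real (peak (y j) t ^ ?n) * b' t \<partial>lborel) \<le> 2 * pi * C"
      proof (rule riesz_product_gain[OF b'_cont b'_0 False avg order_refl _ _ trig_poly_peak_power])
        show "multiplier (\<lambda>t. of_real 0) (1 - real ?n / real ?n)"
          using False multiplier_const[of 0] by simp
      qed auto
      then have small: "norm (\<integral>t. b' t * of_real (peak (y j) t ^ ?n) \<partial>lborel) \<le> 2 * pi * C * (4 / 5) ^ ?n"
        by (simp add: power_divide field_simps)
      show ?thesis
      proof (cases "\<beta> = 0")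
        case True
        then show ?thesis using C' M qm q2 by (simp add: \<beta>_def)
      next
        case False
        \<comment> \<open>A unimodular rotation: it cancels the argument of \<beta> and supplies
          \<zeta>, so that the real part of w b' is at least |\<beta>| c0 on the inner ball.\<close>
        define w where "w = \<zeta> * cnj \<beta> / of_real (norm \<beta>)"
        have w: "norm w = 1" using False \<zeta> by (simp add: w_def norm_mult norm_divide)
        have w\<beta>: "w * (\<beta> * z) = of_real (norm \<beta>) * (\<zeta> * z)" for z
        proof -
          have "cnj \<beta> * \<beta> = of_real (norm \<beta>) * of_real (norm \<beta>)"
            using complex_norm_square[of \<beta>] by (simp add: power2_eq_square mult.commute)
          then show ?thesis using False by (simp add: w_def field_simps)
        qed
        have b'_int: "integrable lborel b'"
        proof -
          have "integrable lborel (\<lambda>t. \<Gamma> t * b t)"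
            by (rule integrable_mult_bounded[OF \<Gamma>_integrable _ b_bound]) (simp add: borel_measurable_continuous_onI b_cont)
          then show ?thesis by (simp add: b'_def mult.commute)
        qed
        have re: "norm \<beta> * c0 \<le> Re (w * b' t)" if "dist (y j) t \<le> d / 2" for t
        proof -
          have "c0 \<le> Re (\<zeta> * \<Gamma> t)" using near[of t] that d by (intro \<Gamma>_positive) auto
          then have "norm \<beta> * c0 \<le> norm \<beta> * Re (\<zeta> * \<Gamma> t)" by (intro mult_left_mono) auto
          also have "\<dots> = Re (w * b' t)"
            unfolding b'_def b_\<beta>[OF that] w\<beta> by simp
          finally show ?thesis .
        qed
        have J: "(\<integral>t. norm (w * b' t) \<partial>lborel) \<le> J"
        proof -
          have "(\<integral>t. norm (w * b' t) \<partial>lborel) \<le> (\<integral>t. 2 * pi * M * norm (\<Gamma> t) \<partial>lborel)"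
          proof (rule Bochner_Integration.integral_mono)
            show "norm (w * b' t) \<le> 2 * pi * M * norm (\<Gamma> t)" for t
              unfolding b'_def norm_mult[of w] norm_mult[of "b t"] w mult_1 by (intro mult_right_mono b_bound) auto
          qed (use b'_int \<Gamma>_integrable in auto)
          then show ?thesis by (simp add: J_def I_def)
        qed
        have "norm \<beta> * c0 * v * q2 ^ ?n - q1 ^ ?n * (\<integral>t. norm (w * b' t) \<partial>lborel) \<le>
            Re (\<integral>t. (w * b' t) * of_real (peak (y j) t ^ ?n) \<partial>lborel)"
        proof (rule integral_power_concentration[where A = "cball (y j) (d / 2)" and A' = "ball (y j) a"])
          show "integrable lborel (\<lambda>t. w * b' t)" using b'_int by simp
          show "peak (y j) \<in> borel_measurable borel"
            by (intro borel_measurable_continuous_onI continuous_on_peak)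
          show "0 \<le> Re (w * b' t)" if "t \<in> cball (y j) (d / 2)" for t
          proof -
            have "0 \<le> norm \<beta> * c0" using c0_pos by simp
            also have "\<dots> \<le> Re (w * b' t)" using that by (intro re) simp
            finally show ?thesis .
          qed
          show "norm \<beta> * c0 \<le> Re (w * b' t)" if "t \<in> ball (y j) a" for t
            using that a by (intro re) simp
          show "w * b' t = 0 \<or> peak (y j) t \<le> q1" if "t \<notin> cball (y j) (d / 2)" for t
            using q1(3)[of t] b_0[of t] that by (cases "d \<le> dist (y j) t") (auto simp: b'_def)
        qed (use peak_bounds peak_ge v a q1 q2 c0_pos in auto)
        also have "\<dots> \<le> norm (\<integral>t. w * (b' t * of_real (peak (y j) t ^ ?n)) \<partial>lborel)"
          unfolding mult.assoc by (rule complex_Re_le_cmod)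
        also have "\<dots> = norm (\<integral>t. b' t * of_real (peak (y j) t ^ ?n) \<partial>lborel)"
          by (simp only: integral_mult_right_zero norm_mult w mult_1)
        also have "\<dots> \<le> 2 * pi * C * (4 / 5) ^ ?n" by (rule small)
        finally have "norm \<beta> * c0 * v * q2 ^ ?n \<le> 2 * pi * C * (4 / 5) ^ ?n + q1 ^ ?n * (\<integral>t. norm (w * b' t) \<partial>lborel)"
          by linarith
        also have "\<dots> \<le> 2 * pi * C * qm ^ ?n + qm ^ ?n * J"
          using C0 qm q1 J J0 by (intro add_mono mult_left_mono mult_mono power_mono) auto
        also have "\<dots> = (2 * pi * C + J) * qm ^ ?n"
          by (simp add: algebra_simps)
        finally have main: "norm \<beta> * (c0 * v * q2 ^ ?n) \<le> (2 * pi * C + J) * qm ^ ?n"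
          by (simp add: mult.assoc)
        have pos: "c0 * v * q2 ^ ?n > 0" using c0_pos v0 q2 by simp
        have "norm \<beta> \<le> (2 * pi * C + J) * qm ^ ?n / (c0 * v * q2 ^ ?n)"
          using main pos by (simp add: pos_le_divide_eq)
        also have "\<dots> = (2 * pi * C + J) / (c0 * v) * (qm / q2) ^ ?n"
          by (simp add: power_divide)
        also have "\<dots> \<le> C' * (qm / q2) ^ ?n"
          using qm q2 by (intro mult_right_mono C') auto
        finally have "norm \<beta> \<le> C' * (qm / q2) ^ ?n" .
        moreover have "norm ?fc \<le> norm \<beta>"
        proof -
          have "1 * norm ?fc \<le> (2 * pi) * norm ?fc"
            using pi_ge_two by (intro mult_right_mono) auto
          then show ?thesis by (simp add: \<beta>_def norm_mult)
        qed
        ultimately show ?thesis by linarith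
      qed
    qed
  qed
qed

lemma real_analytic_operating: "real_analytic (\<lambda>(s, t). \<Psi> (Complex s t))"
  unfolding real_analytic_def
proof (intro allI)
  fix s0 t0 :: real
  obtain r q C where rq: "r > 0" "0 \<le> q" "q < 1" and dec:
    "\<And>\<sigma> \<tau> N. norm \<sigma> \<le> 1 \<Longrightarrow> norm \<tau> \<le> 1 \<Longrightarrow>
      norm (fourier_coeff (\<lambda>s. \<Psi> (Complex s0 t0 + of_real r * (\<sigma> * of_real (sin s) + \<tau>))) N) \<le> C * q ^ nat \<bar>N\<bar>"
    using coefficient_decay[of "Complex s0 t0"] by blast
  show "\<exists>a :: nat \<Rightarrow> nat \<Rightarrow> complex. \<forall>\<^sub>F (s, t) in nhds (s0, t0).
     (\<lambda>(j, k). norm (a j k * of_real ((s - s0) ^ j * (t - t0) ^ k))) summable_on UNIV \<and>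
     ((\<lambda>(j, k). a j k * of_real ((s - s0) ^ j * (t - t0) ^ k)) has_sum (case (s, t) of (s, t) \<Rightarrow> \<Psi> (Complex s t))) UNIV"
    using real_analytic_at_of_coeff_decay[OF \<Psi>_continuous rq dec] by simp
qed

end

theorem theorem3p4:
  fixes g :: "real^'n::finite \<Rightarrow> complex"
    and p :: ennreal
    and F :: "real \<times> real \<Rightarrow> complex"
  assumes "g \<in> schwartz" and "g \<noteq> (\<lambda>x. 0)"
    and "1 \<le> p"
    and "operates_in_modulation_space g p F"
  shows "real_analytic F \<and> (p < \<infinity> \<longrightarrow> F (0, 0) = 0)"
proof -
  interpret window g
    using assms(1,2) by unfold_locales
  \<comment> \<open>Reading F on the complex plane turns pairs of real and imaginary parts into
    single values of f.\<close>
  define \<Psi> where "\<Psi> = (\<lambda>z. F (Re z, Im z))"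
  have op: "(\<lambda>x. \<Psi> (f x)) \<in> modulation_functions g p" if "f \<in> modulation_functions g p" for f
    using assms(4) that by (simp add: operates_in_modulation_space_def \<Psi>_def)
  obtain B \<zeta> \<rho> c b where B: "B \<in> sets borel" "emeasure lborel B = ennreal b" "0 \<le> b"
    and \<zeta>: "norm \<zeta> = 1" "\<rho> > 0" "c > 0"
    and pos: "\<And>t. norm t \<le> \<rho> \<Longrightarrow> c \<le> Re (\<zeta> * kernel B (box 0 1) t)"
    by (rule kernel_positive) blast
  have fin: "emeasure lborel B < \<infinity>" "emeasure lborel (box 0 (1 :: real^'n)) < \<infinity>"
    using B emeasure_lborel_box_finite[of 0 "1 :: real^'n"] by auto
  interpret operating g p \<Psi> "kernel B (box 0 1)" \<zeta> \<rho> c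
  proof
    show "integrable lborel (kernel B (box 0 1))"
      by (intro kernel_integrable B fin) auto
    show "continuous_on UNIV (kernel B (box 0 1))"
      by (intro kernel_continuous_on B fin) auto
    show "\<exists>C. \<forall>R T. trig_poly 1 R T \<longrightarrow> norm (\<integral>t. h t * T t * kernel B (box 0 1) t \<partial>lborel) \<le> C"
      if "h \<in> modulation_functions g p" "\<And>t. norm (h t) \<le> M" for h M
      by (rule modulation_function_pairing_bound[OF that(1) assms(3) that(2) B]) blast
  qed (use assms(3) op \<zeta> pos in auto)
  have "(\<lambda>(s, t). \<Psi> (Complex s t)) = F"
    by (auto simp: \<Psi>_def)
  then have "real_analytic F"
    using real_analytic_operating by simp
  moreover have "F (0, 0) = 0" if "p < \<infinity>"
  proof (rule ccontr)
    assume "F (0, 0) \<noteq> 0"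
    then have "(\<lambda>x. F (0, 0)) \<notin> modulation_functions g p"
      by (intro const_not_modulation_function assms that)
    \<comment> \<open>The zero function is dominated, hence in the space, and its image is the
      constant F (0, 0).\<close>
    moreover have "(\<lambda>x. \<Psi> 0) \<in> modulation_functions g p"
      by (intro op dominated_imp_modulation_function[OF dominated_0] assms)
    ultimately show False by (simp add: \<Psi>_def)
  qed
  ultimately show ?thesis by blast
qed

end
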